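(* Let $0<\varepsilon<0.1$ be a fixed constant and $k\ge 1$ a fixed integer. There are a constant $c=c(k)>0$, a threshold $q_5(\varepsilon;k)$ and a constant $C(k,\varepsilon)>0$ such that: if $q\ge q_5(\varepsilon;k)$ is prime, $a,b$ are integers with $(a,q)=1$, and $q^{1/2+\varepsilon}\le x\le q$, then \[ \Bigl|\sum_{\substack{n\le x\\ (n,q)=1}}\tau_k(n)\,e_q(an^{*}+bn)\Bigr|\;\le\; C(k,\varepsilon)\,x\,q^{-c\varepsilon^{4}}. \]
   Context: $\tau_k(n)$ is the $k$-fold divisor function (number of ordered representations $n=n_1\cdots n_k$ with positive integers $n_i$). $e_q(v)=e^{2\pi i v/q}$. For $(n,q)=1$, $n^{*}$ denotes an integer with $nn^{*}\equiv 1\pmod q$. *)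

theory Defs
  imports "HOL-Analysis.Analysis" "HOL-Number_Theory.Number_Theory"
begin

definition divisor_k :: "nat \<Rightarrow> nat \<Rightarrow> nat" where
  "divisor_k k n = card {f \<in> {0..<k} \<rightarrow>\<^sub>E {1..n}. (\<Prod>i<k. f i) = n}"

definition eq :: "int \<Rightarrow> int \<Rightarrow> complex" where
  "eq q v = exp (2 * pi * \<i> * of_int v / of_int q)"

definition modinv :: "int \<Rightarrow> int \<Rightarrow> int" where
  "modinv q n = (SOME m. [n * m = 1] (mod q))"

end

theory Submission
  imports Defs "HOL-Computational_Algebra.Squarefree" "HOL-Library.Discrete_Functions"
begin

text \<open>Writing \<open>\<tau>\<^sub>k\<close> as a \<open>k\<close>-fold convolution and splitting into dyadic boxes, let \<open>n \<sim> N\<close> be the largest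
of the \<open>k\<close> variables and \<open>m\<close> the product of the others. This leaves bilinear sums
\<open>\<Sum>\<^sub>m \<gamma>\<^sub>m \<Sum>\<^sub>n e\<^sub>q(a m\<^sup>* n\<^sup>* + b m n)\<close>. Shift \<open>n\<close> to \<open>n + u t\<close> with \<open>u \<le> U\<close>, \<open>t < T\<close>, so that
\<open>(n + u t)\<^sup>* = u\<^sup>* (n u\<^sup>* + t)\<^sup>*\<close>; then Cauchy--Schwarz and Hoelder reduce everything to even moments over all
residues, that is, to additive energies of reciprocals. The linear phase only survives as a
frequency of the variable \<open>t\<close>. Rounding that frequency to a grid of \<open>L \<approx> T q\<^sup>2\<^sup>\<delta>\<close> points makes it
independent of \<open>m\<close>, \<open>n\<close> and \<open>u\<close>, at the cost of a factor \<open>L\<close> inside a \<open>2r\<close>-th moment.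

There are three ranges. If \<open>N\<close> exceeds \<open>q\<^sup>1\<^sup>/\<^sup>2\<close> by a small power, there are more pairs \<open>(n, u)\<close> than residues, and
each \<open>m\<close> can be treated separately. If \<open>q\<^sup>1\<^sup>/\<^sup>6 \<le> N\<close>, take \<open>T = q\<^sup>\<delta>\<close>: counting roots of rational functions
controls the energies of all but few progressions, and the \<open>m\<close>-variable contributes the number of
solutions of \<open>m\<^sub>1\<^sup>* + m\<^sub>2\<^sup>* \<equiv> m\<^sub>3\<^sup>* + m\<^sub>4\<^sup>*\<close>. If \<open>N \<le> q\<^sup>1\<^sup>/\<^sup>6\<close>, take \<open>U = 1\<close> and \<open>T\<close> slightly smaller than \<open>N\<close>, and
use the bound \<open>q\<^sup>o\<^sup>(\<^sup>1\<^sup>) N\<^sup>r (1 + N\<^sup>2\<^sup>r\<^sup>-\<^sup>1 / q)\<close> for the number of solutions of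
\<open>n\<^sub>1\<^sup>* + \<dots> + n\<^sub>r\<^sup>* \<equiv> n\<^sub>r\<^sub>+\<^sub>1\<^sup>* + \<dots> + n\<^sub>2\<^sub>r\<^sup>*\<close>. No bound for complete Kloosterman sums is used.\<close>

text \<open>In the long and medium ranges T = q^\<delta>, and grid, divisor bounds and constants
  together cost only q^O(\<delta>), against a gain of q^(-\<epsilon>/8) inside a root of order
  \<open>2 * r\<close> or \<open>4 * r\<close>. There T^r must reach q before the diagonal solutions
  become harmless, so \<open>r\<close> is about 1/\<delta> and q^(-\<epsilon>\<delta>/64) survives;
  with \<delta> proportional to \<epsilon>/k this is quadratic in \<epsilon>.

  The energy of the reciprocals of m \<le> R, divided by R^4, is about R^(-2) + R^(-1/2) q^(-1/2),
  and R N is at least q^(1/2+\<epsilon>/2). In the medium range the second term is under control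
  from N = q^(1/6) on. In the short range \<open>L\<close> costs a full factor N, and both terms are
  under control exactly up to N = q^(1/6). So the two methods meet without a gap.

  The short range needs N^r \<ge> q^(1/2) with bounded \<open>r\<close>. Since N is the largest of k
  dyadic sizes whose product exceeds q^(1/2), some r \<le> k suffices.\<close>

definition E :: "real \<Rightarrow> complex" where
  "E \<theta> = cis (2 * pi * \<theta>)"

lemma norm_E [simp]: "norm (E \<theta>) = 1"
  by (simp add: E_def)

lemma E_add: "E (x + y) = E x * E y"
  by (simp add: E_def cis_mult distrib_left)

lemma E_0 [simp]: "E 0 = 1"
  by (simp add: E_def)

lemma cnj_E: "cnj (E x) = E (- x)"
  by (simp add: E_def cis_cnj)

lemma E_diff: "E (x - y) = E x * cnj (E y)"
  using E_add[of x "-y"] by (simp add: cnj_E)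

lemma E_of_int [simp]: "E (of_int n) = 1"
  by (simp add: E_def cis_multiple_2pi)

lemma E_frac: "E (x + of_int n) = E x"
  by (simp add: E_add)

lemma E_power: "E x ^ n = E (real n * x)"
  by (simp add: E_def Complex.DeMoivre mult_ac)

lemma E_eq_1_iff: "E x = 1 \<longleftrightarrow> x \<in> \<int>"
proof
  assume "E x = 1"
  then have "cos (2 * pi * x) = 1"
    by (metis E_def cis.sel(1) one_complex.sel(1))
  then obtain n :: int where "2 * pi * x = of_int n * 2 * pi"
    by (auto simp: cos_one_2pi_int)
  then have "x = of_int n" by simp
  then show "x \<in> \<int>" by simp
next
  assume "x \<in> \<int>" then show "E x = 1" by (auto elim: Ints_cases)
qed

text \<open>The chord 2 |sin((a - b)/2)| is at most the arc |a - b|. This Lipschitz bound is what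
  makes rounding of frequencies affordable.\<close>

lemma norm_E_diff: "norm (E x - E y) \<le> 2 * pi * \<bar>x - y\<bar>"
proof -
  have "norm (cis a - cis b) \<le> \<bar>a - b\<bar>" for a b :: real
  proof -
    have "norm (cis a - cis b) = norm (cis b * (cis (a - b) - 1))"
      by (simp add: algebra_simps cis_mult)
    also have "\<dots> = norm (cis (a - b) - 1)" by (simp add: norm_mult)
    also have "\<dots> = 2 * \<bar>sin ((a - b) / 2)\<bar>"
      using dist_exp_i_1[of "a - b"] by (simp add: cis_conv_exp)
    also have "\<dots> \<le> \<bar>a - b\<bar>"
      using abs_sin_le_one abs_sin_x_le_abs_x[of "(a - b) / 2"] by simp
    finally show ?thesis .
  qed
  from this[of "2*pi*x" "2*pi*y"] show ?thesis
    by (simp add: E_def abs_mult flip: right_diff_distrib mult.assoc)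
qed

section \<open>The additive character modulo q and its orthogonality\<close>

lemma eq_conv_E: "eq q v = E (of_int v / of_int q)"
  by (simp add: eq_def E_def cis_conv_exp mult_ac)

lemma norm_eq [simp]: "norm (eq q v) = 1"
  by (simp add: eq_conv_E)

lemma eq_add: "eq q (v + w) = eq q v * eq q w"
  by (simp add: eq_conv_E add_divide_distrib E_add)

lemma eq_diff: "eq q (v - w) = eq q v * cnj (eq q w)"
  by (simp add: eq_conv_E diff_divide_distrib E_diff)

lemma eq_0 [simp]: "eq q 0 = 1"
  by (simp add: eq_conv_E)

lemma eq_cong:
  assumes "[v = w] (mod q)"
  shows "eq q v = eq q w"
proof (cases "q = 0")
  case True then show ?thesis using assms by (simp add: cong_def)
next
  case False
  from assms obtain k where "v = w + q * k"
    by (metis cong_iff_lin cong_sym)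
  then have "of_int v / of_int q = of_int w / of_int q + real_of_int k"
    using False by (simp add: add_divide_distrib)
  then show ?thesis by (simp add: eq_conv_E E_frac)
qed

lemma eq_eq_1_iff:
  assumes "q \<noteq> 0"
  shows "eq q v = 1 \<longleftrightarrow> q dvd v"
proof
  assume "eq q v = 1"
  then have "real_of_int v / of_int q \<in> \<int>" by (simp add: eq_conv_E E_eq_1_iff)
  then obtain k where "real_of_int v / of_int q = of_int k" by (auto elim: Ints_cases)
  then have "real_of_int v = of_int (k * q)" using assms by (simp add: field_simps)
  then have "v = k * q" by linarith
  then show "q dvd v" by simp
next
  assume "q dvd v"
  then have "[v = 0] (mod q)" by (simp add: cong_0_iff)
  then show "eq q v = 1" using eq_cong by fastforce
qed

lemma eq_mult_nat: "eq q (int n * v) = eq q v ^ n"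
  by (simp add: eq_conv_E E_power)

lemma eq_orthogonality:
  fixes q :: nat
  assumes "q > 0"
  shows "(\<Sum>\<kappa><q. eq (int q) (int \<kappa> * v)) = (if int q dvd v then of_nat q else 0)"
proof -
  have *: "(\<Sum>\<kappa><q. eq (int q) (int \<kappa> * v)) = (\<Sum>\<kappa><q. eq (int q) v ^ \<kappa>)"
    by (simp add: eq_mult_nat)
  have "eq (int q) v ^ q = 1"
    using eq_mult_nat[of "int q" q v] eq_eq_1_iff[of "int q" "int q * v"] assms by simp
  then show ?thesis
    using eq_eq_1_iff[of "int q" v] assms
    by (auto simp: * geometric_sum)
qed

subsection \<open>Moments\<close>

text \<open>Opening the square and summing over \<kappa> first leaves only the pairs with congruent
  values, each of weight at most q. The coefficients are arbitrary of modulus at most 1, so phases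
  that do not involve \<kappa> can be carried along for free.\<close>

lemma second_moment_le:
  fixes q :: nat and \<Lambda> :: "'a \<Rightarrow> int" and c :: "'a \<Rightarrow> complex"
  assumes "q > 0" "finite F" "\<And>f. f \<in> F \<Longrightarrow> norm (c f) \<le> 1"
  shows "(\<Sum>\<kappa><q. norm (\<Sum>f\<in>F. c f * eq (int q) (int \<kappa> * \<Lambda> f)) ^ 2)
           \<le> real q * real (card {(f, g) \<in> F \<times> F. [\<Lambda> f = \<Lambda> g] (mod int q)})"
proof -
  let ?e = "eq (int q)"
  let ?S = "{(f, g) \<in> F \<times> F. [\<Lambda> f = \<Lambda> g] (mod int q)}"
  have sq: "complex_of_real (norm (\<Sum>f\<in>F. c f * ?e (int \<kappa> * \<Lambda> f)) ^ 2)
      = (\<Sum>(f, g)\<in>F \<times> F. c f * cnj (c g) * ?e (int \<kappa> * (\<Lambda> f - \<Lambda> g)))" for \<kappa>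
  proof -
    have "complex_of_real (norm (\<Sum>f\<in>F. c f * ?e (int \<kappa> * \<Lambda> f)) ^ 2)
        = (\<Sum>f\<in>F. c f * ?e (int \<kappa> * \<Lambda> f)) * cnj (\<Sum>g\<in>F. c g * ?e (int \<kappa> * \<Lambda> g))"
      by (rule complex_norm_square)
    also have "\<dots> = (\<Sum>f\<in>F. \<Sum>g\<in>F. c f * ?e (int \<kappa> * \<Lambda> f) * cnj (c g * ?e (int \<kappa> * \<Lambda> g)))"
      by (simp add: sum_product)
    also have "\<dots> = (\<Sum>f\<in>F. \<Sum>g\<in>F. c f * cnj (c g) * ?e (int \<kappa> * (\<Lambda> f - \<Lambda> g)))"
      by (intro sum.cong refl) (simp add: right_diff_distrib eq_diff mult_ac)
    finally show ?thesis by (simp add: sum.cartesian_product)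
  qed
  have "complex_of_real (\<Sum>\<kappa><q. norm (\<Sum>f\<in>F. c f * ?e (int \<kappa> * \<Lambda> f)) ^ 2)
      = (\<Sum>\<kappa><q. \<Sum>(f, g)\<in>F \<times> F. c f * cnj (c g) * ?e (int \<kappa> * (\<Lambda> f - \<Lambda> g)))"
    unfolding of_real_sum sq ..
  also have "\<dots> = (\<Sum>(f, g)\<in>F \<times> F. c f * cnj (c g) * (\<Sum>\<kappa><q. ?e (int \<kappa> * (\<Lambda> f - \<Lambda> g))))"
    by (subst sum.swap) (simp add: case_prod_beta sum_distrib_left)
  also have "\<dots> = (\<Sum>(f, g)\<in>F \<times> F. if [\<Lambda> f = \<Lambda> g] (mod int q) then of_nat q * (c f * cnj (c g)) else 0)"
    by (intro sum.cong refl)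
       (auto simp: eq_orthogonality[OF assms(1)] cong_iff_dvd_diff)
  also have "\<dots> = (\<Sum>(f, g)\<in>?S. of_nat q * (c f * cnj (c g)))"
    using assms(2) by (intro sum.mono_neutral_cong_right) (auto split: if_splits)
  finally have eq: "complex_of_real (\<Sum>\<kappa><q. norm (\<Sum>f\<in>F. c f * ?e (int \<kappa> * \<Lambda> f)) ^ 2)
      = (\<Sum>(f, g)\<in>?S. of_nat q * (c f * cnj (c g)))" .
  have "(\<Sum>\<kappa><q. norm (\<Sum>f\<in>F. c f * ?e (int \<kappa> * \<Lambda> f)) ^ 2)
      = norm (\<Sum>(f, g)\<in>?S. of_nat q * (c f * cnj (c g)))"
    unfolding eq[symmetric] norm_of_real by (rule abs_of_nonneg[symmetric]) (auto intro: sum_nonneg)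
  also have "\<dots> \<le> (\<Sum>p\<in>?S. real q)"
  proof (rule sum_norm_le)
    fix p assume "p \<in> ?S"
    then obtain f g where p: "p = (f, g)" "f \<in> F" "g \<in> F" by auto
    have "norm (c f) * norm (c g) \<le> 1"
      using assms(3)[OF p(2)] assms(3)[OF p(3)] by (simp add: mult_le_one)
    then show "norm (case p of (f, g) \<Rightarrow> of_nat q * (c f * cnj (c g))) \<le> real q"
      by (simp add: p norm_mult mult_left_le)
  qed
  finally show ?thesis by (simp add: mult.commute)
qed

section \<open>Even moments as counts of solutions in tuples\<close>

definition tuples :: "nat \<Rightarrow> nat \<Rightarrow> (nat \<Rightarrow> nat) set" where
  "tuples r T = {..<r} \<rightarrow>\<^sub>E {..<T}"

definition Jcount :: "nat \<Rightarrow> nat \<Rightarrow> (nat \<Rightarrow> int) \<Rightarrow> nat \<Rightarrow> nat" where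
  "Jcount q r l T =
     card {(f, g) \<in> tuples r T \<times> tuples r T. [(\<Sum>i<r. l (f i)) = (\<Sum>i<r. l (g i))] (mod int q)}"

lemma finite_tuples [simp]: "finite (tuples r T)"
  by (simp add: tuples_def finite_PiE)

lemma eq_sum: "finite I \<Longrightarrow> eq q (\<Sum>i\<in>I. v i) = (\<Prod>i\<in>I. eq q (v i))"
  by (induction I rule: finite_induct) (auto simp: eq_add)

text \<open>The r-th power of the inner sum is a linear form indexed by r-tuples, with frequency the
  sum of the \<open>l (f i)\<close>. The 2r-th moment is therefore a second moment over
  tuples.\<close>

lemma even_moment_le:
  fixes q :: nat and l :: "nat \<Rightarrow> int" and c :: "nat \<Rightarrow> complex"
  assumes "q > 0" "\<And>t. t < T \<Longrightarrow> norm (c t) \<le> 1"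
  shows "(\<Sum>\<kappa><q. norm (\<Sum>t<T. c t * eq (int q) (int \<kappa> * l t)) ^ (2 * r)) \<le> real q * real (Jcount q r l T)"
proof -
  let ?e = "eq (int q)"
  have "norm (\<Sum>t<T. c t * ?e (int \<kappa> * l t)) ^ (2 * r)
      = norm (\<Sum>f\<in>tuples r T. (\<Prod>i<r. c (f i)) * ?e (int \<kappa> * (\<Sum>i<r. l (f i)))) ^ 2" for \<kappa>
  proof -
    have "(\<Sum>t<T. c t * ?e (int \<kappa> * l t)) ^ r = (\<Prod>i<r. \<Sum>t<T. c t * ?e (int \<kappa> * l t))"
      by simp
    also have "\<dots> = (\<Sum>f\<in>tuples r T. \<Prod>i<r. c (f i) * ?e (int \<kappa> * l (f i)))"
      unfolding tuples_def by (subst prod_sum_PiE) auto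
    also have "\<dots> = (\<Sum>f\<in>tuples r T. (\<Prod>i<r. c (f i)) * ?e (int \<kappa> * (\<Sum>i<r. l (f i))))"
      by (simp add: prod.distrib eq_sum sum_distrib_left)
    finally have eq: "(\<Sum>t<T. c t * ?e (int \<kappa> * l t)) ^ r
      = (\<Sum>f\<in>tuples r T. (\<Prod>i<r. c (f i)) * ?e (int \<kappa> * (\<Sum>i<r. l (f i))))" .
    have "norm (\<Sum>t<T. c t * ?e (int \<kappa> * l t)) ^ (2 * r) = norm ((\<Sum>t<T. c t * ?e (int \<kappa> * l t)) ^ r) ^ 2"
      by (simp only: norm_power power_mult[symmetric] mult.commute[of 2 r])
    then show ?thesis unfolding eq .
  qed
  then have "(\<Sum>\<kappa><q. norm (\<Sum>t<T. c t * ?e (int \<kappa> * l t)) ^ (2 * r))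
     = (\<Sum>\<kappa><q. norm (\<Sum>f\<in>tuples r T. (\<Prod>i<r. c (f i)) * ?e (int \<kappa> * (\<Sum>i<r. l (f i)))) ^ 2)"
    by simp
  also have "\<dots> \<le> real q * real (Jcount q r l T)"
    unfolding Jcount_def
  proof (rule second_moment_le)
    fix f assume "f \<in> tuples r T"
    then show "norm (\<Prod>i<r. c (f i)) \<le> 1"
      using assms(2) by (auto simp: tuples_def prod_norm[symmetric] intro!: prod_le_1)
  qed (use assms in auto)
  finally show ?thesis .
qed

section \<open>Power means and rounding of a frequency\<close>

lemma power_mean:
  fixes w a :: "'a \<Rightarrow> real"
  assumes "finite I" "\<And>i. i \<in> I \<Longrightarrow> 0 \<le> w i" "\<And>i. i \<in> I \<Longrightarrow> 0 \<le> a i" "r \<ge> 1"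
  shows "(\<Sum>i\<in>I. w i * a i) ^ r \<le> (\<Sum>i\<in>I. w i) ^ (r - 1) * (\<Sum>i\<in>I. w i * a i ^ r)"
proof (cases "(\<Sum>i\<in>I. w i) = 0")
  case True
  then have "\<forall>i\<in>I. w i = 0" using assms sum_nonneg_eq_0_iff by blast
  then show ?thesis using assms(4) by (simp add: power_0_left)
next
  case False
  define W where "W = (\<Sum>i\<in>I. w i)"
  have W: "W > 0" using False assms(1,2) by (metis W_def less_eq_real_def sum_nonneg)
  have conv: "convex_on {0..} (\<lambda>x::real. x ^ r)"
    using convex_power_even[of r] convex_power_odd[of r] convex_on_subset by (cases "even r") blast+
  have "(\<Sum>i\<in>I. (w i / W) *\<^sub>R a i) ^ r \<le> (\<Sum>i\<in>I. (w i / W) * a i ^ r)"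
    using assms W False by (intro convex_on_sum[OF _ _ conv]) (auto simp: W_def simp flip: sum_divide_distrib)
  then have "((\<Sum>i\<in>I. w i * a i) / W) ^ r \<le> (\<Sum>i\<in>I. w i * a i ^ r) / W"
    by (simp add: sum_divide_distrib)
  then have "(\<Sum>i\<in>I. w i * a i) ^ r \<le> W ^ r * ((\<Sum>i\<in>I. w i * a i ^ r) / W)"
    using W by (simp add: power_divide divide_le_eq field_simps)
  also have "W ^ r = W ^ (r - 1) * W" using assms(4) by (metis Suc_diff_le diff_Suc_1 power_Suc2 One_nat_def)
  finally show ?thesis using W by (simp add: W_def)
qed

text \<open>\<open>W\<close> need only bound the cardinality, which spares exact counts of index
  sets later on.\<close>

lemma power_mean_unweighted:
  fixes a :: "'a \<Rightarrow> real"
  assumes "finite I" "\<And>i. i \<in> I \<Longrightarrow> 0 \<le> a i" "r \<ge> 1" "real (card I) \<le> W"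
  shows "(\<Sum>i\<in>I. a i) ^ r \<le> W ^ (r - 1) * (\<Sum>i\<in>I. a i ^ r)"
proof -
  have "(\<Sum>i\<in>I. a i) ^ r \<le> real (card I) ^ (r - 1) * (\<Sum>i\<in>I. a i ^ r)"
    using power_mean[of I "\<lambda>_. 1" a r] assms by simp
  also have "\<dots> \<le> W ^ (r - 1) * (\<Sum>i\<in>I. a i ^ r)"
    using assms by (intro mult_right_mono power_mono sum_nonneg) auto
  finally show ?thesis .
qed

text \<open>As \<open>t\<close> is an integer, only the fractional part of \<Theta> matters, and the
  grid point below it is at distance at most 1/L. Each of the T terms then moves by at most 2 pi T /
  L.\<close>

lemma grid_approx:
  fixes z :: "nat \<Rightarrow> complex" and \<Theta> :: real
  assumes "L \<ge> 1" "\<And>t. t < T \<Longrightarrow> norm (z t) \<le> 1"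
  shows "\<exists>j<L. norm (\<Sum>t<T. z t * E (\<Theta> * real t))
            \<le> norm (\<Sum>t<T. z t * E (real j / real L * real t)) + 2 * pi * real T ^ 2 / real L"
proof -
  define j where "j = nat \<lfloor>frac \<Theta> * real L\<rfloor>"
  have fr: "0 \<le> frac \<Theta>" "frac \<Theta> < 1" by (auto simp: frac_lt_1)
  have L0: "real L > 0" using assms(1) by simp
  have j1: "real j \<le> frac \<Theta> * real L" "frac \<Theta> * real L < real j + 1"
  proof -
    have "0 \<le> frac \<Theta> * real L" using fr L0 by simp
    then have "real j = of_int \<lfloor>frac \<Theta> * real L\<rfloor>" unfolding j_def by simp
    then show "real j \<le> frac \<Theta> * real L" "frac \<Theta> * real L < real j + 1" by linarith+
  qed
  have "frac \<Theta> * real L < 1 * real L"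
    using fr L0 by (intro mult_strict_right_mono) auto
  with j1 have "real j < real L" by linarith
  then have jL: "j < L" by simp
  have near: "\<bar>frac \<Theta> - real j / real L\<bar> \<le> 1 / real L"
  proof -
    have "real j / real L \<le> frac \<Theta>" "frac \<Theta> < (real j + 1) / real L"
      using j1 L0 by (simp_all add: pos_divide_le_eq pos_less_divide_eq)
    then show ?thesis by (simp add: add_divide_distrib abs_le_iff)
  qed
  have per: "E (\<Theta> * real t) = E (frac \<Theta> * real t)" for t
  proof -
    have "\<Theta> * real t = frac \<Theta> * real t + of_int (\<lfloor>\<Theta>\<rfloor> * int t)"
      unfolding of_int_mult of_int_of_nat_eq distrib_right[symmetric] frac_def by simp
    then show ?thesis by (simp only: E_frac)
  qed
  have "norm (\<Sum>t<T. z t * E (\<Theta> * real t)) - norm (\<Sum>t<T. z t * E (real j / real L * real t))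
     \<le> norm ((\<Sum>t<T. z t * E (\<Theta> * real t)) - (\<Sum>t<T. z t * E (real j / real L * real t)))"
    by (rule norm_triangle_ineq2)
  also have "\<dots> = norm (\<Sum>t<T. z t * (E (frac \<Theta> * real t) - E (real j / real L * real t)))"
    by (simp add: per sum_subtractf right_diff_distrib)
  also have "\<dots> \<le> (\<Sum>t<T. 2 * pi * real T / real L)"
  proof (rule sum_norm_le)
    fix t assume t: "t \<in> {..<T}"
    have "norm (z t * (E (frac \<Theta> * real t) - E (real j / real L * real t)))
       \<le> 1 * (2 * pi * \<bar>frac \<Theta> * real t - real j / real L * real t\<bar>)"
      unfolding norm_mult using t assms(2) by (intro mult_mono norm_E_diff) auto
    also have "\<bar>frac \<Theta> * real t - real j / real L * real t\<bar> = \<bar>frac \<Theta> - real j / real L\<bar> * real t"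
      unfolding left_diff_distrib[symmetric] abs_mult by simp
    also have "\<dots> \<le> 1 / real L * real T"
      using near t by (intro mult_mono) auto
    finally show "norm (z t * (E (frac \<Theta> * real t) - E (real j / real L * real t))) \<le> 2 * pi * real T / real L"
      by (simp add: mult_left_mono)
  qed
  also have "\<dots> = 2 * pi * real T ^ 2 / real L" by (simp add: power2_eq_square)
  finally show ?thesis using jL by force
qed

subsection \<open>Bilinear forms with a linear twist\<close>

definition twisted :: "nat \<Rightarrow> nat \<Rightarrow> (nat \<Rightarrow> int) \<Rightarrow> int \<Rightarrow> real \<Rightarrow> complex" where
  "twisted q T l \<kappa> \<Theta> = (\<Sum>t<T. eq (int q) (\<kappa> * l t) * E (\<Theta> * real t))"

text \<open>An envelope over all grid frequencies at once. It is meaningful for \<open>L\<close> at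
  least 1, since \<open>Max\<close> needs a nonempty set.\<close>

definition peak :: "nat \<Rightarrow> nat \<Rightarrow> nat \<Rightarrow> (nat \<Rightarrow> int) \<Rightarrow> int \<Rightarrow> real" where
  "peak q L T l \<kappa> = Max ((\<lambda>j. norm (twisted q T l \<kappa> (real j / real L))) ` {..<L})"

lemma twisted_cong:
  assumes "[\<kappa> = \<kappa>'] (mod int q)"
  shows "twisted q T l \<kappa> \<Theta> = twisted q T l \<kappa>' \<Theta>"
  unfolding twisted_def
  by (intro sum.cong refl arg_cong2[of _ _ _ _ "(*)"] eq_cong cong_scalar_right assms)

lemma norm_twisted_le:
  assumes "L \<ge> 1"
  shows "norm (twisted q T l \<kappa> \<Theta>) \<le> peak q L T l \<kappa> + 2 * pi * real T ^ 2 / real L"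
proof -
  obtain j where "j < L" and j: "norm (twisted q T l \<kappa> \<Theta>)
      \<le> norm (twisted q T l \<kappa> (real j / real L)) + 2 * pi * real T ^ 2 / real L"
    using grid_approx[OF assms, of T "\<lambda>t. eq (int q) (\<kappa> * l t)" \<Theta>] by (auto simp: twisted_def)
  have "norm (twisted q T l \<kappa> (real j / real L)) \<le> peak q L T l \<kappa>"
    unfolding peak_def using \<open>j < L\<close> by (intro Max_ge) auto
  with j show ?thesis by linarith
qed

lemma peak_nonneg:
  assumes "L \<ge> 1"
  shows "0 \<le> peak q L T l \<kappa>"
proof -
  have "norm (twisted q T l \<kappa> (real 0 / real L)) \<le> peak q L T l \<kappa>"
    unfolding peak_def using assms by (intro Max_ge finite_imageI imageI) auto
  then show ?thesis using norm_ge_zero order_trans by blast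
qed

lemma peak_cong:
  assumes "[\<kappa> = \<kappa>'] (mod int q)"
  shows "peak q L T l \<kappa> = peak q L T l \<kappa>'"
  unfolding peak_def twisted_cong[OF assms] ..

text \<open>A maximum of L nonnegative numbers is at most their sum. At each grid point the twist is
  a coefficient of modulus 1, so the moment bound is the same for all of them.\<close>

lemma sum_peak_power_le:
  assumes "q > 0" "L \<ge> 1"
  shows "(\<Sum>\<kappa><q. peak q L T l (int \<kappa>) ^ (2 * r)) \<le> real L * real q * real (Jcount q r l T)"
proof -
  have "peak q L T l (int \<kappa>) ^ (2 * r) \<le> (\<Sum>j<L. norm (twisted q T l (int \<kappa>) (real j / real L)) ^ (2 * r))" for \<kappa>
  proof -
    have "peak q L T l (int \<kappa>) \<in> (\<lambda>j. norm (twisted q T l (int \<kappa>) (real j / real L))) ` {..<L}"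
      unfolding peak_def using assms by (intro Max_in) (auto simp: lessThan_empty_iff)
    then obtain j where j: "j < L" "peak q L T l (int \<kappa>) = norm (twisted q T l (int \<kappa>) (real j / real L))"
      by auto
    show ?thesis unfolding j(2)
      using j(1) by (intro member_le_sum[of j "{..<L}" "\<lambda>j. norm (twisted q T l (int \<kappa>) (real j / real L)) ^ (2 * r)"]) auto
  qed
  then have "(\<Sum>\<kappa><q. peak q L T l (int \<kappa>) ^ (2 * r))
      \<le> (\<Sum>\<kappa><q. \<Sum>j<L. norm (twisted q T l (int \<kappa>) (real j / real L)) ^ (2 * r))"
    by (intro sum_mono)
  also have "\<dots> = (\<Sum>j<L. \<Sum>\<kappa><q. norm (twisted q T l (int \<kappa>) (real j / real L)) ^ (2 * r))"
    by (rule sum.swap)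
  also have "\<dots> \<le> (\<Sum>j<L. real q * real (Jcount q r l T))"
  proof (intro sum_mono)
    fix j
    show "(\<Sum>\<kappa><q. norm (twisted q T l (int \<kappa>) (real j / real L)) ^ (2 * r)) \<le> real q * real (Jcount q r l T)"
      using even_moment_le[of q T "\<lambda>t. E (real j / real L * real t)" l r] assms
      by (simp add: twisted_def mult.commute)
  qed
  finally show ?thesis by simp
qed

text \<open>Written with differences because it arises from pairs (m, m') after opening a square;
  moving terms across turns it into a count of equal sums.\<close>

definition energy :: "nat \<Rightarrow> nat set \<Rightarrow> (nat \<Rightarrow> int) \<Rightarrow> nat" where
  "energy q A x = card {((m1, m2), (m3, m4)) \<in> (A \<times> A) \<times> (A \<times> A). [x m1 - x m2 = x m3 - x m4] (mod int q)}"

lemma energy_mono: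
  assumes "finite B" "A \<subseteq> B"
  shows "energy q A x \<le> energy q B x"
  unfolding energy_def using assms
  by (intro card_mono) (auto intro: finite_subset[where B = "(B \<times> B) \<times> (B \<times> B)"])

text \<open>Rounding the frequency to the grid \<open>j / L\<close> turns the twist into a loss of only a factor \<open>L\<close> inside the
  \<open>2 r\<close>-th moment.\<close>

lemma sum_pairs_twisted_le:
  fixes q :: nat and x :: "nat \<Rightarrow> int" and \<theta> :: "nat \<Rightarrow> real"
  assumes q: "q > 0" and L: "L \<ge> 1" and r: "r \<ge> 1" and A: "finite A"
  shows "\<exists>Z\<ge>0. (\<Sum>(m, m')\<in>A \<times> A. norm (twisted q T l (x m - x m') (\<theta> m - \<theta> m')))
            \<le> real (card A) ^ 2 * (2 * pi * real T ^ 2 / real L) + Z \<and>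
          Z ^ (2 * r) \<le> real (card A) ^ (4 * r - 4) * real (energy q A x) * (real L * real q * real (Jcount q r l T))"
proof -
  let ?Q = "\<lambda>\<kappa>. peak q L T l (int \<kappa>)"
  define k where "k = (\<lambda>p. nat ((x (fst p) - x (snd p)) mod int q))"
  \<comment> \<open>The number of pairs whose difference lies in the class \<kappa>. Its total is
    the square of the size of \<open>A\<close>, and its sum of squares is the energy.\<close>
  define \<rho> where "\<rho> = (\<lambda>\<kappa>. real (card {p \<in> A \<times> A. k p = \<kappa>}))"
  define Z where "Z = (\<Sum>\<kappa><q. \<rho> \<kappa> * ?Q \<kappa>)"
  have k_less: "k p < q" for p
    using q by (simp add: k_def nat_less_iff)
  have k_cong: "[int (k p) = x (fst p) - x (snd p)] (mod int q)" for p
    using q by (simp add: k_def)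
  have k_eq: "k p = k p' \<longleftrightarrow> [x (fst p) - x (snd p) = x (fst p') - x (snd p')] (mod int q)" for p p'
    using q by (simp add: k_def cong_def eq_nat_nat_iff)
  have Q0: "0 \<le> ?Q \<kappa>" for \<kappa> by (rule peak_nonneg[OF L])
  have \<rho>0: "0 \<le> \<rho> \<kappa>" for \<kappa> by (simp add: \<rho>_def)
  have finA2: "finite (A \<times> A)" using A by simp
  have fibre: "(\<Sum>p\<in>A \<times> A. g (k p)) = (\<Sum>\<kappa><q. \<rho> \<kappa> * g \<kappa>)" for g :: "nat \<Rightarrow> real"
  proof -
    have "(\<Sum>p\<in>A \<times> A. g (k p)) = (\<Sum>\<kappa><q. \<Sum>p\<in>{p \<in> A \<times> A. k p = \<kappa>}. g (k p))"
      using finA2 k_less by (intro sum.group[symmetric]) auto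
    also have "\<dots> = (\<Sum>\<kappa><q. \<rho> \<kappa> * g \<kappa>)" by (simp add: \<rho>_def)
    finally show ?thesis .
  qed
  have "(\<Sum>(m, m')\<in>A \<times> A. norm (twisted q T l (x m - x m') (\<theta> m - \<theta> m')))
      \<le> (\<Sum>p\<in>A \<times> A. ?Q (k p) + 2 * pi * real T ^ 2 / real L)"
  proof (rule sum_mono)
    fix p assume "p \<in> A \<times> A"
    obtain m m' where p: "p = (m, m')" by (cases p)
    have "?Q (k p) = peak q L T l (x m - x m')"
      using peak_cong[OF k_cong[of p]] by (simp add: p)
    with norm_twisted_le[OF L, of q T l "x m - x m'" "\<theta> m - \<theta> m'"]
    show "(case p of (m, m') \<Rightarrow> norm (twisted q T l (x m - x m') (\<theta> m - \<theta> m')))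
       \<le> ?Q (k p) + 2 * pi * real T ^ 2 / real L" by (simp add: p)
  qed
  also have "\<dots> = (\<Sum>p\<in>A \<times> A. ?Q (k p)) + real (card A) ^ 2 * (2 * pi * real T ^ 2 / real L)"
    by (simp add: sum.distrib card_cartesian_product power2_eq_square)
  also have "(\<Sum>p\<in>A \<times> A. ?Q (k p)) = Z"
    unfolding Z_def by (rule fibre)
  finally have 1: "(\<Sum>(m, m')\<in>A \<times> A. norm (twisted q T l (x m - x m') (\<theta> m - \<theta> m')))
      \<le> real (card A) ^ 2 * (2 * pi * real T ^ 2 / real L) + Z" by simp
  have Z0: "Z \<ge> 0" unfolding Z_def by (intro sum_nonneg mult_nonneg_nonneg Q0 \<rho>0)
  have sum_\<rho>: "(\<Sum>\<kappa><q. \<rho> \<kappa>) = real (card A) ^ 2"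
    using fibre[of "\<lambda>_. 1"] by (simp add: card_cartesian_product power2_eq_square)
  have sum_\<rho>2: "(\<Sum>\<kappa><q. \<rho> \<kappa> ^ 2) = real (energy q A x)"
  proof -
    have "real (energy q A x) = real (card (Sigma (A \<times> A) (\<lambda>p. {p' \<in> A \<times> A. k p' = k p})))"
      unfolding energy_def k_eq
      by (intro arg_cong[of _ _ real] arg_cong[of _ _ card]) (auto simp: cong_sym_eq)
    also have "\<dots> = (\<Sum>p\<in>A \<times> A. \<rho> (k p))"
      using finA2 by (simp add: \<rho>_def card_SigmaI)
    also have "\<dots> = (\<Sum>\<kappa><q. \<rho> \<kappa> * \<rho> \<kappa>)" by (rule fibre)
    finally show ?thesis by (simp add: power2_eq_square)
  qed
  \<comment> \<open>The power mean with weights \<rho> brings in the r-th powers of the peaks.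
    Cauchy-Schwarz then separates the energy from the 2r-th moment, which is where the exponent 2r
    comes from.\<close>
  have "Z ^ (2 * r) = (Z ^ r) ^ 2" by (simp add: power_mult[symmetric] mult.commute)
  also have "\<dots> \<le> ((\<Sum>\<kappa><q. \<rho> \<kappa>) ^ (r - 1) * (\<Sum>\<kappa><q. \<rho> \<kappa> * ?Q \<kappa> ^ r)) ^ 2"
    unfolding Z_def using Q0 \<rho>0 r Z0
    by (intro power_mono power_mean zero_le_power) (auto simp: Z_def)
  also have "\<dots> = (real (card A) ^ (2 * (r - 1))) ^ 2 * (\<Sum>\<kappa><q. \<rho> \<kappa> * ?Q \<kappa> ^ r) ^ 2"
    by (simp add: sum_\<rho> power_mult_distrib power_mult)
  also have "(real (card A) ^ (2 * (r - 1))) ^ 2 = real (card A) ^ (4 * r - 4)"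
    by (simp add: power_mult[symmetric] mult.commute right_diff_distrib')
  also have "(\<Sum>\<kappa><q. \<rho> \<kappa> * ?Q \<kappa> ^ r) ^ 2 \<le> (\<Sum>\<kappa><q. \<rho> \<kappa> ^ 2) * (\<Sum>\<kappa><q. (?Q \<kappa> ^ r) ^ 2)"
    by (rule Cauchy_Schwarz_ineq_sum)
  also have "(\<Sum>\<kappa><q. (?Q \<kappa> ^ r) ^ 2) = (\<Sum>\<kappa><q. ?Q \<kappa> ^ (2 * r))"
    by (simp add: power_mult[symmetric] mult.commute)
  also have "\<dots> \<le> real L * real q * real (Jcount q r l T)"
    by (rule sum_peak_power_le[OF q L])
  finally have "Z ^ (2 * r) \<le> real (card A) ^ (4 * r - 4) * (real (energy q A x) * (real L * real q * real (Jcount q r l T)))"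
    by (simp add: sum_\<rho>2 mult_left_mono)
  with 1 Z0 show ?thesis by (auto simp: mult.assoc)
qed

text \<open>Cauchy-Schwarz in \<open>t\<close> discards the dependence of the coefficients on
  \<open>m\<close>: the product of one twisted term with the conjugate of another is again a twisted
  term, with the differences of both data. Since \<open>R\<close> is only an upper bound for the
  size of \<open>A\<close>, one normalisation serves all subsets of {1..R}.\<close>

lemma bilinear_le:
  fixes q :: nat and x :: "nat \<Rightarrow> int" and \<theta> :: "nat \<Rightarrow> real" and c :: "nat \<Rightarrow> complex"
  assumes q: "q > 0" and L: "L \<ge> 1" and r: "r \<ge> 1" and A: "finite A" "real (card A) \<le> R" "R > 0"
    and c: "\<And>m. m \<in> A \<Longrightarrow> norm (c m) \<le> G" and G: "G \<ge> 0" and T: "T \<ge> 1"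
  shows "norm (\<Sum>m\<in>A. c m * twisted q T l (x m) (\<theta> m))
     \<le> G * R * real T * (sqrt (2 * pi * real T / real L) +
          root (4 * r) (real (energy q A x) / R ^ 4 * (real L * real q * real (Jcount q r l T)) / real T ^ (2 * r)))"
proof -
  let ?a = "\<lambda>m t. eq (int q) (x m * l t) * E (\<theta> m * real t)"
  let ?D = "\<Sum>m\<in>A. c m * twisted q T l (x m) (\<theta> m)"
  let ?V = "real (energy q A x) / R ^ 4 * (real L * real q * real (Jcount q r l T)) / real T ^ (2 * r)"
  obtain Z where Z0: "Z \<ge> 0"
    and Z1: "(\<Sum>(m, m')\<in>A \<times> A. norm (twisted q T l (x m - x m') (\<theta> m - \<theta> m')))
            \<le> real (card A) ^ 2 * (2 * pi * real T ^ 2 / real L) + Z"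
    and Z2: "Z ^ (2 * r) \<le> real (card A) ^ (4 * r - 4) * real (energy q A x) * (real L * real q * real (Jcount q r l T))"
    using sum_pairs_twisted_le[OF q L r A(1), of T l x \<theta>] by blast
  have "norm ?D ^ 2 = norm (\<Sum>t<T. \<Sum>m\<in>A. c m * ?a m t) ^ 2"
    by (subst sum.swap) (simp add: twisted_def sum_distrib_left)
  also have "\<dots> \<le> (\<Sum>t<T. norm (\<Sum>m\<in>A. c m * ?a m t)) ^ 2"
    by (intro power_mono norm_sum) auto
  also have "\<dots> \<le> real T ^ (2 - 1) * (\<Sum>t<T. norm (\<Sum>m\<in>A. c m * ?a m t) ^ 2)"
    by (rule power_mean_unweighted) auto
  also have "(\<Sum>t<T. norm (\<Sum>m\<in>A. c m * ?a m t) ^ 2)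
      \<le> (\<Sum>(m, m')\<in>A \<times> A. G ^ 2 * norm (twisted q T l (x m - x m') (\<theta> m - \<theta> m')))"
  proof -
    have "complex_of_real (\<Sum>t<T. norm (\<Sum>m\<in>A. c m * ?a m t) ^ 2)
        = (\<Sum>t<T. \<Sum>(m, m')\<in>A \<times> A. c m * cnj (c m') * (?a m t * cnj (?a m' t)))"
      unfolding of_real_sum
    proof (intro sum.cong refl)
      fix t
      have "complex_of_real (norm (\<Sum>m\<in>A. c m * ?a m t) ^ 2)
          = (\<Sum>m\<in>A. c m * ?a m t) * cnj (\<Sum>m'\<in>A. c m' * ?a m' t)" by (rule complex_norm_square)
      also have "\<dots> = (\<Sum>m\<in>A. \<Sum>m'\<in>A. c m * ?a m t * cnj (c m' * ?a m' t))"
        by (simp only: cnj_sum sum_product)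
      finally show "complex_of_real (norm (\<Sum>m\<in>A. c m * ?a m t) ^ 2)
          = (\<Sum>(m, m')\<in>A \<times> A. c m * cnj (c m') * (?a m t * cnj (?a m' t)))"
        by (simp add: sum.cartesian_product mult_ac)
    qed
    also have "\<dots> = (\<Sum>(m, m')\<in>A \<times> A. c m * cnj (c m') * (\<Sum>t<T. ?a m t * cnj (?a m' t)))"
      by (subst sum.swap) (simp add: case_prod_beta sum_distrib_left)
    also have "\<dots> = (\<Sum>(m, m')\<in>A \<times> A. c m * cnj (c m') * twisted q T l (x m - x m') (\<theta> m - \<theta> m'))"
    proof -
      have "(\<Sum>t<T. ?a m t * cnj (?a m' t)) = twisted q T l (x m - x m') (\<theta> m - \<theta> m')" for m m'
        unfolding twisted_def left_diff_distrib eq_diff E_diff complex_cnj_mult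
        by (intro sum.cong refl) (simp only: mult_ac)
      then show ?thesis by simp
    qed
    finally have "(\<Sum>t<T. norm (\<Sum>m\<in>A. c m * ?a m t) ^ 2)
        = norm (\<Sum>(m, m')\<in>A \<times> A. c m * cnj (c m') * twisted q T l (x m - x m') (\<theta> m - \<theta> m'))"
      by (metis (no_types, lifting) abs_of_nonneg norm_of_real sum_nonneg zero_le_power2)
    also have "\<dots> \<le> (\<Sum>(m, m')\<in>A \<times> A. G ^ 2 * norm (twisted q T l (x m - x m') (\<theta> m - \<theta> m')))"
    proof (rule sum_norm_le)
      fix p assume "p \<in> A \<times> A"
      then obtain m m' where p: "p = (m, m')" "m \<in> A" "m' \<in> A" by auto
      have "norm (c m) * norm (c m') \<le> G ^ 2"
        unfolding power2_eq_square using p c G by (intro mult_mono) auto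
      then show "norm (case p of (m, m') \<Rightarrow> c m * cnj (c m') * twisted q T l (x m - x m') (\<theta> m - \<theta> m'))
        \<le> (case p of (m, m') \<Rightarrow> G ^ 2 * norm (twisted q T l (x m - x m') (\<theta> m - \<theta> m')))"
        by (simp add: p norm_mult mult_right_mono)
    qed
    finally show ?thesis .
  qed
  also have "\<dots> = G ^ 2 * (\<Sum>(m, m')\<in>A \<times> A. norm (twisted q T l (x m - x m') (\<theta> m - \<theta> m')))"
    by (simp add: sum_distrib_left case_prod_beta)
  also have "\<dots> \<le> G ^ 2 * (real (card A) ^ 2 * (2 * pi * real T ^ 2 / real L) + Z)"
    using Z1 by (intro mult_left_mono) auto
  also have "\<dots> \<le> G ^ 2 * (R ^ 2 * (2 * pi * real T ^ 2 / real L) + Z)"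
    using A by (intro mult_left_mono add_right_mono mult_right_mono power_mono) auto
  finally have D2: "norm ?D ^ 2 \<le> real T * (G ^ 2 * (R ^ 2 * (2 * pi * real T ^ 2 / real L) + Z))"
    by (simp add: mult_left_mono)
  have T0: "real T > 0" using T by simp
  \<comment> \<open>Scaled so that \<open>Z\<close> contributes exactly (G R T)^2 y^2 to the square
    of the bilinear sum; its 4r-th power is at most \<open>?V\<close>.\<close>
  define y where "y = sqrt (Z / (real T * R ^ 2))"
  have y0: "y \<ge> 0" using Z0 A T by (simp add: y_def)
  have y2: "y ^ 2 = Z / (real T * R ^ 2)" using Z0 A T by (simp add: y_def)
  have "y ^ (4 * r) = (y ^ 2) ^ (2 * r)" by (simp add: power_mult[symmetric])
  also have "\<dots> = Z ^ (2 * r) / (real T ^ (2 * r) * R ^ (4 * r))"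
    unfolding y2 by (simp add: power_divide power_mult_distrib power_mult[symmetric])
  also have "\<dots> \<le> (R ^ (4 * r - 4) * real (energy q A x) * (real L * real q * real (Jcount q r l T))) / (real T ^ (2 * r) * R ^ (4 * r))"
  proof (intro divide_right_mono order.trans[OF Z2] mult_right_mono power_mono)
  qed (use A in auto)
  also have "R ^ (4 * r) = R ^ (4 * r - 4) * R ^ 4"
    using r by (simp flip: power_add)
  also have "(R ^ (4 * r - 4) * real (energy q A x) * (real L * real q * real (Jcount q r l T))) / (real T ^ (2 * r) * (R ^ (4 * r - 4) * R ^ 4)) = ?V"
    using A by (simp add: field_simps)
  finally have "y ^ (4 * r) \<le> ?V" .
  then have "root (4 * r) (y ^ (4 * r)) \<le> root (4 * r) ?V"
    using r by (intro real_root_le_mono) auto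
  then have yV: "y \<le> root (4 * r) ?V"
    using r y0 by (simp add: real_root_power_cancel)
  define s where "s = sqrt (2 * pi * real T / real L)"
  have s2: "s ^ 2 = 2 * pi * real T / real L" by (simp add: s_def)
  have "norm ?D ^ 2 \<le> (G * R * real T) ^ 2 * (s ^ 2 + y ^ 2)"
  proof (rule order.trans[OF D2])
    have "(G * R * real T) ^ 2 * y ^ 2 = real T * G ^ 2 * Z"
      unfolding y2 using A T0 by (simp add: field_simps power2_eq_square)
    moreover have "(G * R * real T) ^ 2 * s ^ 2 = real T * G ^ 2 * (R ^ 2 * (2 * pi * real T ^ 2 / real L))"
      unfolding s2 by (simp add: power2_eq_square)
    ultimately show "real T * (G ^ 2 * (R ^ 2 * (2 * pi * real T ^ 2 / real L) + Z)) \<le> (G * R * real T) ^ 2 * (s ^ 2 + y ^ 2)"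
      by (simp add: distrib_left)
  qed
  also have "\<dots> \<le> (G * R * real T) ^ 2 * (s + y) ^ 2"
    using y0 by (intro mult_left_mono) (auto simp: power2_sum s_def)
  finally have "norm ?D ^ 2 \<le> (G * R * real T * (s + y)) ^ 2" by (simp add: power_mult_distrib)
  then have "norm ?D \<le> G * R * real T * (s + y)"
  proof (rule power2_le_imp_le)
    show "0 \<le> G * R * real T * (s + y)"
      using G A(3) y0 T0 by (intro mult_nonneg_nonneg add_nonneg_nonneg) (simp_all add: s_def)
  qed
  also have "\<dots> \<le> G * R * real T * (s + root (4 * r) ?V)"
    using yV G A by (intro mult_left_mono) auto
  finally show ?thesis unfolding s_def .
qed

subsection \<open>The divisor bound\<close>

definition ndiv :: "nat \<Rightarrow> nat" where
  "ndiv n = card {d. d dvd n}"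

lemma ndiv_pos: "n > 0 \<Longrightarrow> ndiv n > 0"
  by (auto simp: ndiv_def card_gt_0_iff)

lemma ndiv_mult_le:
  assumes "a > 0" "b > 0"
  shows "ndiv (a * b) \<le> ndiv a * ndiv b"
proof -
  have "{d. d dvd a * b} \<subseteq> (\<lambda>(x, y). x * y) ` ({d. d dvd a} \<times> {d. d dvd b})"
    by (auto elim!: dvd_productE)
  then have "card {d. d dvd a * b} \<le> card ({d. d dvd a} \<times> {d. d dvd b})"
    using assms by (intro surj_card_le) auto
  then show ?thesis by (simp add: ndiv_def card_cartesian_product)
qed

lemma ndiv_prime_power:
  assumes "prime p"
  shows "ndiv (p ^ e) \<le> e + 1"
proof -
  have "{d. d dvd p ^ e} \<subseteq> (\<lambda>i. p ^ i) ` {..e}"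
    using assms by (auto simp: divides_primepow_nat)
  then have "card {d. d dvd p ^ e} \<le> card {..e}"
    by (intro surj_card_le) auto
  then show ?thesis by (simp add: ndiv_def)
qed

text \<open>Submultiplicativity reduces the claim to e + 1 against p^(\<delta> e). Once p^\<delta>
  is at least 2, the inequality e + 1 \<le> 2^e suffices with constant 1. Only the finitely many
  smaller primes cost a factor \<open>c\<close>, whence the constant
  \<open>c ^ card S\<close>.\<close>

lemma divisor_bound:
  fixes \<delta> :: real
  assumes \<delta>: "\<delta> > 0"
  shows "\<exists>C\<ge>1. \<forall>n>0. real (ndiv n) \<le> C * real n powr \<delta>"
proof -
  \<comment> \<open>With c \<delta> ln 2 \<ge> 1, the bound 1 + \<delta> e ln 2 \<le> p^(\<delta> e)
    yields e + 1 \<le> c p^(\<delta> e).\<close>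
  define c where "c = max 1 (1 / (\<delta> * ln 2))"
  define P where "P = 2 powr (1 / \<delta>)"
  define S where "S = {p::nat. prime p \<and> real p \<le> P}"
  have finS: "finite S"
    unfolding S_def by (rule finite_subset[of _ "{..nat \<lfloor>P\<rfloor>}"]) (auto simp: le_nat_floor)
  have c1: "c \<ge> 1" by (simp add: c_def)
  have small: "real (e + 1) \<le> c * real p powr (\<delta> * real e)" if "prime p" for p e :: nat
  proof -
    have p2: "real p \<ge> 2" using prime_ge_2_nat[OF that] by simp
    have "1 + \<delta> * real e * ln 2 \<le> exp (\<delta> * real e * ln 2)" by (rule exp_ge_add_one_self)
    also have "\<dots> = 2 powr (\<delta> * real e)" by (simp add: powr_def)
    also have "\<dots> \<le> real p powr (\<delta> * real e)"
      using p2 \<delta> by (intro powr_mono2) auto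
    finally have *: "1 + \<delta> * real e * ln 2 \<le> real p powr (\<delta> * real e)" .
    have d: "\<delta> * ln 2 > 0" using \<delta> by simp
    have "1 \<le> c * (\<delta> * ln 2)"
      using d by (auto simp: c_def max_def field_simps)
    then have "real e \<le> c * (\<delta> * real e * ln 2)"
      using mult_right_mono[of 1 "c * (\<delta> * ln 2)" "real e"] by (simp add: mult_ac)
    with c1 have "real (e + 1) \<le> c * (1 + \<delta> * real e * ln 2)" by (simp add: distrib_left)
    also have "\<dots> \<le> c * real p powr (\<delta> * real e)" using * c1 by (intro mult_left_mono) auto
    finally show ?thesis .
  qed
  have large: "real (e + 1) \<le> real p powr (\<delta> * real e)" if "prime p" "p \<notin> S" for p e :: nat
  proof -
    have "P \<le> real p" using that by (auto simp: S_def)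
    then have "P powr (\<delta> * real e) \<le> real p powr (\<delta> * real e)"
      using \<delta> by (intro powr_mono2) (auto simp: P_def)
    moreover have "P powr (\<delta> * real e) = 2 ^ e"
      using \<delta> by (simp add: P_def powr_powr powr_realpow)
    moreover have "e + 1 \<le> 2 ^ e" by (induction e) auto
    then have "real (e + 1) \<le> 2 ^ e" by (metis of_nat_le_iff of_nat_numeral of_nat_power)
    ultimately show ?thesis by linarith
  qed
  have main: "n > 0 \<Longrightarrow> real (ndiv n) \<le> c ^ card {p\<in>S. p dvd n} * real n powr \<delta>" for n
  proof (induction n rule: less_induct)
    case (less n)
    show ?case
    proof (cases "n = 1")
      case True then show ?thesis using c1 by (simp add: ndiv_def)
    next
      case False
      then obtain p where p: "prime p" "p dvd n" using prime_factor_nat by blast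
      define e where "e = multiplicity p n"
      obtain m where m: "n = p ^ e * m" "\<not> p dvd m"
        using multiplicity_decompose'[of n p] less.prems p(1) unfolding e_def
        by (metis not_prime_unit not_gr_zero)
      have e1: "e \<ge> 1" using m p by (cases e) auto
      have m0: "m > 0" using m less.prems by (cases m) auto
      have "p ^ e > 1" using e1 p prime_gt_1_nat by (metis one_less_power not_one_le_zero gr_zeroI)
      then have mn: "m < n" using m m0 by simp
      have pe: "p ^ e > 0" using p prime_gt_0_nat by simp
      have npow: "real n powr \<delta> = real p powr (\<delta> * real e) * real m powr \<delta>"
      proof -
        have "real n = real p ^ e * real m" using m by simp
        also have "\<dots> = real p powr real e * real m" using p prime_gt_0_nat by (simp add: powr_realpow)
        finally show ?thesis by (simp add: powr_mult powr_powr mult.commute)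
      qed
      have split: "{p'\<in>S. p' dvd n} = {p'\<in>S. p' dvd m} \<union> (if p \<in> S then {p} else {})"
      proof -
        have "p' dvd n \<longleftrightarrow> p' = p \<or> p' dvd m" if "prime p'" for p'
          using that p m e1 by (metis dvd_mult2 dvd_triv_left dvd_power prime_dvd_mult_iff prime_dvd_power primes_dvd_imp_eq dvd_mult)
        then show ?thesis by (auto simp: S_def p(1))
      qed
      have cardS: "card {p'\<in>S. p' dvd n} = card {p'\<in>S. p' dvd m} + (if p \<in> S then 1 else 0)"
        unfolding split using m(2) finS by (simp add: card_Un_disjoint)
      have "real (ndiv n) \<le> real (ndiv (p ^ e)) * real (ndiv m)"
        using ndiv_mult_le[OF pe m0] m(1) by (metis of_nat_le_iff of_nat_mult)
      also have "\<dots> \<le> real (e + 1) * (c ^ card {p'\<in>S. p' dvd m} * real m powr \<delta>)"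
        using ndiv_prime_power[OF p(1), of e] less.IH[OF mn m0] by (intro mult_mono) auto
      also have "\<dots> \<le> ((if p \<in> S then c else 1) * real p powr (\<delta> * real e)) * (c ^ card {p'\<in>S. p' dvd m} * real m powr \<delta>)"
        using small[OF p(1), of e] large[OF p(1), of e] c1 by (intro mult_right_mono) auto
      also have "\<dots> = c ^ card {p'\<in>S. p' dvd n} * real n powr \<delta>"
        by (simp add: cardS npow)
      finally show ?thesis .
    qed
  qed
  show ?thesis
  proof (intro exI[of _ "c ^ card S"] conjI allI impI)
    show "1 \<le> c ^ card S" using c1 by simp
    fix n :: nat assume n: "n > 0"
    have "card {p\<in>S. p dvd n} \<le> card S" using finS by (intro card_mono) auto
    then have "c ^ card {p\<in>S. p dvd n} \<le> c ^ card S" using c1 by (intro power_increasing) auto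
    then show "real (ndiv n) \<le> c ^ card S * real n powr \<delta>"
      using main[OF n] by (meson mult_right_mono order_trans powr_ge_zero)
  qed
qed

text \<open>Every coordinate is a divisor of \<open>n\<close>.\<close>

lemma card_tuples_prod_le:
  assumes "finite I" "n > 0"
  shows "finite {f \<in> I \<rightarrow>\<^sub>E UNIV. (\<Prod>i\<in>I. f i) = n}"
    and "card {f \<in> I \<rightarrow>\<^sub>E UNIV. (\<Prod>i\<in>I. f i) = n} \<le> ndiv n ^ card I"
proof -
  have sub: "{f \<in> I \<rightarrow>\<^sub>E UNIV. (\<Prod>i\<in>I. f i) = n} \<subseteq> I \<rightarrow>\<^sub>E {d. d dvd n}"
    using assms by (auto simp: PiE_iff extensional_def)
  have fin: "finite (I \<rightarrow>\<^sub>E {d. d dvd n})" using assms by (intro finite_PiE) auto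
  show "finite {f \<in> I \<rightarrow>\<^sub>E UNIV. (\<Prod>i\<in>I. f i) = n}" using finite_subset[OF sub fin] .
  have "card (I \<rightarrow>\<^sub>E {d. d dvd n}) = ndiv n ^ card I"
    using assms by (simp add: card_PiE ndiv_def)
  then show "card {f \<in> I \<rightarrow>\<^sub>E UNIV. (\<Prod>i\<in>I. f i) = n} \<le> ndiv n ^ card I"
    using card_mono[OF fin sub] by simp
qed

subsection \<open>Additive energy of reciprocals\<close>

abbreviation rcp :: "nat \<Rightarrow> nat \<Rightarrow> int" where
  "rcp q n \<equiv> modinv (int q) (int n)"

abbreviation shrcp :: "nat \<Rightarrow> nat \<Rightarrow> nat \<Rightarrow> int" where
  "shrcp q w t \<equiv> modinv (int q) (int w + int t)"

lemma modinv_cong: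
  assumes "coprime n q"
  shows "[n * modinv q n = 1] (mod q)"
proof -
  have "\<exists>m. [n * m = 1] (mod q)" using assms by (rule cong_solve_coprime_int)
  then show ?thesis unfolding modinv_def by (rule someI_ex)
qed

text \<open>Dirichlet's approximation h/k of v/q gives s = k v - h q. It is nonzero because q
  divides neither k, which is positive and below q, nor v.\<close>

lemma dirichlet_residue:
  fixes q Q :: nat and v :: int
  assumes q: "prime q" and Q: "0 < Q" "Q < q" and v: "\<not> int q dvd v"
  obtains t s :: int where "0 < t" "t \<le> int Q" "[t * v = s] (mod int q)" "s \<noteq> 0"
    "real_of_int \<bar>s\<bar> \<le> real q / real Q"
proof -
  have q0: "real q > 0" using q prime_gt_0_nat by simp
  obtain h k where hk: "0 < k" "k \<le> int Q" "\<bar>of_int k * (real_of_int v / real q) - of_int h\<bar> < 1 / real Q"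
    using Dirichlet_approx[OF Q(1), of "real_of_int v / real q"] by blast
  define s where "s = k * v - h * int q"
  have s: "[k * v = s] (mod int q)" by (simp add: s_def cong_iff_dvd_diff)
  have "s \<noteq> 0"
  proof
    assume "s = 0"
    then have "int q dvd k * v" by (simp add: s_def)
    then have "int q dvd k" using q v by (simp add: prime_dvd_mult_iff)
    then show False using hk Q zdvd_imp_le by fastforce
  qed
  moreover have "real_of_int \<bar>s\<bar> \<le> real q / real Q"
  proof -
    have "real_of_int s = (of_int k * (real_of_int v / real q) - of_int h) * real q"
      using q0 by (simp add: s_def field_simps)
    then have "real_of_int \<bar>s\<bar> = \<bar>(of_int k * (real_of_int v / real q) - of_int h) * real q\<bar>"
      by simp
    also have "\<dots> = \<bar>of_int k * (real_of_int v / real q) - of_int h\<bar> * real q"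
      by (simp add: abs_mult)
    also have "\<dots> \<le> 1 / real Q * real q"
      using hk(3) q0 by (intro mult_right_mono) auto
    finally show ?thesis by simp
  qed
  ultimately show ?thesis using that[of k s] hk s by blast
qed

lemma card_int_divisors:
  assumes "V \<noteq> (0::int)"
  shows "finite {d. d dvd V}" "card {d. d dvd V} \<le> 2 * ndiv (nat \<bar>V\<bar>)"
proof -
  have sub: "{d. d dvd V} \<subseteq> (\<lambda>(b, d). if b then int d else - int d) ` (UNIV \<times> {d. d dvd nat \<bar>V\<bar>})"
  proof
    fix d assume "d \<in> {d. d dvd V}"
    then have "nat \<bar>d\<bar> dvd nat \<bar>V\<bar>" by (simp add: nat_abs_dvd_iff)
    then show "d \<in> (\<lambda>(b, d). if b then int d else - int d) ` (UNIV \<times> {d. d dvd nat \<bar>V\<bar>})"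
      by (intro image_eqI[of _ _ "(d \<ge> 0, nat \<bar>d\<bar>)"]) auto
  qed
  have fin: "finite ((UNIV :: bool set) \<times> {d. d dvd nat \<bar>V\<bar>})"
    using assms by (intro finite_cartesian_product finite_divisors_nat) auto
  then show "finite {d. d dvd V}" using sub finite_surj by blast
  have "card {d. d dvd V} \<le> card ((UNIV :: bool set) \<times> {d. d dvd nat \<bar>V\<bar>})"
    using sub fin surj_card_le by blast
  then show "card {d. d dvd V} \<le> 2 * ndiv (nat \<bar>V\<bar>)"
    by (simp add: card_cartesian_product ndiv_def)
qed

text \<open>With \<open>t v \<equiv> s\<close> for small \<open>t\<close> and \<open>s\<close>, a solution of \<open>m\<^sub>1\<^sup>* + m\<^sub>2\<^sup>* \<equiv> v\<close> gives an integer
  equation \<open>(s m\<^sub>1 - t) (s m\<^sub>2 - t) = t\<^sup>2 - s j q\<close> with few possible \<open>j\<close>.\<close>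

lemma card_sum_of_two_inverses_le:
  fixes q R :: nat and v :: int and B :: real
  assumes q: "prime q" and R: "0 < R" "2 * R < q" and v: "\<not> int q dvd v"
    and B: "\<And>n. 0 < n \<Longrightarrow> n \<le> q ^ 4 \<Longrightarrow> real (ndiv n) \<le> B"
  shows "real (card {(m1, m2) \<in> {1..R} \<times> {1..R}. [rcp q m1 + rcp q m2 = v] (mod int q)})
     \<le> 12 * B * (1 + real R * sqrt (real R / real q))"
proof -
  \<comment> \<open>The two contributions to the range of \<open>j\<close>, namely 2 Q R / q and R^2
    / Q, have the same order when Q is the square root of q R.\<close>
  define Q where "Q = nat \<lceil>sqrt (real q * real R)\<rceil>"
  have q0: "real q > 0" using q prime_gt_0_nat by simp
  have R0: "real R > 0" using R by simp
  have q2: "q \<ge> 2" using q prime_ge_2_nat by simp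
  have sq: "sqrt (real q * real R) > 0" using q0 R0 by simp
  have Q1: "sqrt (real q * real R) \<le> real Q" "real Q \<le> sqrt (real q * real R) + 1"
    using sq unfolding Q_def by simp_all
  have Q0: "0 < Q" using Q1 sq by (cases Q) auto
  have "Q < q"
  proof -
    \<comment> \<open>From 2 R < q: twice the left side is at most q (q - 1), and q \<le> 2 (q - 1).
      This forces Q < q strictly.\<close>
    have "q * R \<le> (q - 1) ^ 2"
    proof -
      obtain p where p: "q = p + 2" using q2 by (metis add.commute le_Suc_ex)
      have "2 * (q * R) \<le> q * (q - 1)" using R(2) q2 by (simp add: mult.left_commute)
      also have "\<dots> \<le> 2 * (q - 1) ^ 2" unfolding p by (simp add: power2_eq_square algebra_simps)
      finally show ?thesis by simp
    qed
    then have "real q * real R \<le> real (q - 1) ^ 2"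
      by (metis of_nat_le_iff of_nat_mult of_nat_power)
    then have "sqrt (real q * real R) \<le> real (q - 1)" by (rule real_le_lsqrt[rotated -1]) (use q0 R0 in auto)
    then have "Q \<le> q - 1" unfolding Q_def by (simp add: nat_le_iff ceiling_le_iff)
    then show ?thesis using q2 by simp
  qed
  obtain t s where ts: "0 < t" "t \<le> int Q" "[t * v = s] (mod int q)" "s \<noteq> 0"
    and s: "real_of_int \<bar>s\<bar> \<le> real q / real Q"
    using dirichlet_residue[OF q Q0 \<open>Q < q\<close> v] .
  \<comment> \<open>Bounds |j|: the integer j q = t (m1 + m2) - s m1 m2 is at most 2 Q R + (q / Q)
    R^2 in absolute value.\<close>
  define K where "K = \<lfloor>2 * real Q * real R / real q + real R ^ 2 / real Q\<rfloor>"
  define V where "V = (\<lambda>j. t ^ 2 - s * j * int q)"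
  define S where "S = {(m1, m2) \<in> {1..R} \<times> {1..R}. [rcp q m1 + rcp q m2 = v] (mod int q)}"
  \<comment> \<open>A solution is encoded by the quotient \<open>j\<close> and the first factor of
    \<open>V j\<close>.\<close>
  define \<Phi> where "\<Phi> = (\<lambda>(m1, m2). ((t * (int m1 + int m2) - s * int m1 * int m2) div int q, s * int m1 - t))"
  \<comment> \<open>Empty beyond q^4, where the divisor bound \<open>B\<close> says nothing. Actual
    solutions never get there, since both factors of \<open>V j\<close> are at most q^2.\<close>
  define D where "D = (\<lambda>j. if \<bar>V j\<bar> \<le> int q ^ 4 then {d. d dvd V j} else {})"
  have tq: "t < int q" using ts \<open>Q < q\<close> by simp
  \<comment> \<open>Modulo q this is t^2 with 0 < t < q. Being nonzero, \<open>V j\<close> has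
    finitely many divisors, and its second factor is determined by the first.\<close>
  have V0: "V j \<noteq> 0" for j
  proof
    assume "V j = 0"
    then have "int q dvd t ^ 2" by (simp add: V_def)
    then have "int q dvd t" using q prime_dvd_power by (metis prime_nat_int_transfer)
    then show False using ts(1) tq zdvd_not_zless by blast
  qed
  have s_le: "\<bar>s\<bar> \<le> int q"
  proof -
    have "real q / real Q \<le> real q" using Q0 q0 by (simp add: divide_le_eq)
    then show ?thesis using s by linarith
  qed
  have B0: "B \<ge> 0" using B[of 1] q2 by (simp add: ndiv_def)
  have key: "\<Phi> (m1, m2) = (j, d) \<Longrightarrow> \<bar>j\<bar> \<le> K \<and> d * (s * int m2 - t) = V j \<and> \<bar>V j\<bar> \<le> int q ^ 4"
    if "(m1, m2) \<in> S" for m1 m2 j d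
  proof -
    assume \<Phi>: "\<Phi> (m1, m2) = (j, d)"
    have m: "1 \<le> m1" "m1 \<le> R" "1 \<le> m2" "m2 \<le> R"
      and sol: "[rcp q m1 + rcp q m2 = v] (mod int q)"
      using that by (auto simp: S_def)
    have cop: "coprime (int m) (int q)" if "1 \<le> m" "m \<le> R" for m
    proof -
      have "\<not> q dvd m" using that R by (auto dest: dvd_imp_le)
      then have "coprime q m" using q by (intro prime_imp_coprime)
      then show ?thesis by (simp add: coprime_commute)
    qed
    note i1 = modinv_cong[OF cop[OF m(1,2)]] and i2 = modinv_cong[OF cop[OF m(3,4)]]
    define W where "W = t * (int m1 + int m2) - s * int m1 * int m2"
    have "[int m1 + int m2 = int m1 * int m2 * v] (mod int q)"
    proof -
      have "[int m2 * (int m1 * rcp q m1) + int m1 * (int m2 * rcp q m2)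
          = int m2 * 1 + int m1 * 1] (mod int q)"
        by (intro cong_add cong_scalar_left i1 i2)
      moreover have "[int m1 * int m2 * (rcp q m1 + rcp q m2) = int m1 * int m2 * v] (mod int q)"
        by (intro cong_scalar_left sol)
      ultimately show ?thesis
        by (simp add: algebra_simps) (metis (no_types, lifting) cong_sym cong_trans)
    qed
    then have "[t * (int m1 + int m2) = t * (int m1 * int m2 * v)] (mod int q)"
      by (rule cong_scalar_left)
    moreover have "[int m1 * int m2 * (t * v) = int m1 * int m2 * s] (mod int q)"
      by (intro cong_scalar_left ts(3))
    ultimately have "[t * (int m1 + int m2) = s * int m1 * int m2] (mod int q)"
      by (simp add: mult_ac) (metis (no_types, lifting) cong_trans)
    then have "int q dvd W" by (simp add: W_def cong_iff_dvd_diff)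
    moreover have "W div int q = j" using \<Phi> by (simp add: \<Phi>_def W_def)
    ultimately have W: "W = j * int q" by auto
    have d: "d = s * int m1 - t" using \<Phi> by (simp add: \<Phi>_def)
    have "d * (s * int m2 - t) = t ^ 2 - s * W"
      unfolding d W_def by (simp add: algebra_simps power2_eq_square)
    then have prod: "d * (s * int m2 - t) = V j" by (simp add: V_def W)
    have bnd: "\<bar>s * int m - t\<bar> \<le> int q ^ 2" if "m \<le> R" for m
    proof -
      have "\<bar>s * int m - t\<bar> \<le> \<bar>s\<bar> * int m + t"
        using ts(1) by (simp add: abs_mult abs_triangle_ineq4[THEN order_trans])
      also have "\<dots> \<le> int q * int R + int q"
        using s_le that tq by (intro add_mono mult_mono) auto
      also have "\<dots> = int q * (int R + 1)" by (simp add: algebra_simps)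
      also have "\<dots> \<le> int q * int q" using R by (intro mult_left_mono) auto
      finally show ?thesis by (simp add: power2_eq_square)
    qed
    have "\<bar>V j\<bar> = \<bar>s * int m1 - t\<bar> * \<bar>s * int m2 - t\<bar>"
      using prod by (simp add: d abs_mult flip: prod)
    also have "\<dots> \<le> int q ^ 2 * int q ^ 2" by (intro mult_mono bnd m) auto
    finally have Vq: "\<bar>V j\<bar> \<le> int q ^ 4" by (simp flip: power_add)
    have "real_of_int \<bar>W\<bar> \<le> real_of_int (t * (int m1 + int m2)) + real_of_int (\<bar>s\<bar> * int m1 * int m2)"
    proof -
      have "\<bar>W\<bar> \<le> \<bar>t * (int m1 + int m2)\<bar> + \<bar>s * int m1 * int m2\<bar>"
        unfolding W_def by (rule abs_triangle_ineq4)
      also have "\<dots> = t * (int m1 + int m2) + \<bar>s\<bar> * int m1 * int m2"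
        using ts(1) by (simp add: abs_mult)
      finally show ?thesis by linarith
    qed
    also have "\<dots> \<le> real Q * (2 * real R) + real q / real Q * real R * real R"
    proof (rule add_mono)
      have "real_of_int t \<le> real Q" using ts(2) by linarith
      then show "real_of_int (t * (int m1 + int m2)) \<le> real Q * (2 * real R)"
        using m ts(1) by (simp only: of_int_mult) (intro mult_mono, auto)
      show "real_of_int (\<bar>s\<bar> * int m1 * int m2) \<le> real q / real Q * real R * real R"
        using s m by (simp only: of_int_mult of_int_of_nat_eq) (intro mult_mono, auto)
    qed
    finally have "real_of_int \<bar>j\<bar> * real q \<le> real Q * (2 * real R) + real q / real Q * real R * real R"
      by (simp add: W abs_mult)
    then have "real_of_int \<bar>j\<bar> \<le> 2 * real Q * real R / real q + real R ^ 2 / real Q"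
      using q0 Q0 by (simp add: field_simps power2_eq_square)
    then have "\<bar>j\<bar> \<le> K" unfolding K_def by (simp add: le_floor_iff)
    then show ?thesis using prod Vq by simp
  qed
  \<comment> \<open>The component \<open>d\<close> gives m1, and the cofactor of the nonzero
    \<open>d\<close> in \<open>V j\<close> gives m2; both use that \<open>s\<close> is
    nonzero.\<close>
  have "inj_on \<Phi> S"
  proof (rule inj_onI)
    fix p p' assume p: "p \<in> S" "p' \<in> S" and eq: "\<Phi> p = \<Phi> p'"
    obtain m1 m2 m1' m2' j d where pp: "p = (m1, m2)" "p' = (m1', m2')" "\<Phi> p = (j, d)"
      by (cases p; cases p'; cases "\<Phi> p") auto
    have d1: "d * (s * int m2 - t) = V j" using key p(1) pp by blast
    have d2: "d * (s * int m2' - t) = V j" using key p(2) pp eq by simp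
    have "d \<noteq> 0" using d1 V0[of j] by auto
    then have "s * int m2 = s * int m2'" using d1 d2 by (metis diff_left_imp_eq mult_cancel_left diff_add_cancel)
    then have "m2 = m2'" using ts(4) by simp
    moreover have "s * int m1 - t = s * int m1' - t"
      using arg_cong[OF eq, of snd] by (simp add: pp(1,2) \<Phi>_def)
    then have "m1 = m1'" using ts(4) by simp
    ultimately show "p = p'" by (simp add: pp)
  qed
  have img: "\<Phi> ` S \<subseteq> Sigma {-K..K} D"
  proof
    fix y assume "y \<in> \<Phi> ` S"
    then obtain m1 m2 where y: "(m1, m2) \<in> S" "y = \<Phi> (m1, m2)" by auto
    obtain j d where jd: "\<Phi> (m1, m2) = (j, d)" by (cases "\<Phi> (m1, m2)")
    show "y \<in> Sigma {-K..K} D"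
      using key[OF y(1) jd] by (auto simp: y(2) jd D_def dvd_def abs_le_iff) (metis mult.commute)+
  qed
  have finD: "finite (D j)" for j using card_int_divisors(1)[OF V0] by (simp add: D_def)
  have cardD: "real (card (D j)) \<le> 2 * B" for j
  proof (cases "\<bar>V j\<bar> \<le> int q ^ 4")
    case True
    have "nat \<bar>V j\<bar> \<le> q ^ 4" using True by (simp add: nat_le_iff)
    then have "real (ndiv (nat \<bar>V j\<bar>)) \<le> B" using B[of "nat \<bar>V j\<bar>"] V0[of j] by simp
    then show ?thesis using card_int_divisors(2)[OF V0, of j] True by (simp add: D_def)
  qed (use B0 in \<open>simp add: D_def\<close>)
  have K0: "K \<ge> 0" using q0 by (simp add: K_def)
  have "card S = card (\<Phi> ` S)" using \<open>inj_on \<Phi> S\<close> by (simp add: card_image)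
  also have "\<dots> \<le> card (Sigma {-K..K} D)" using finD img by (intro card_mono) auto
  also have "\<dots> = (\<Sum>j\<in>{-K..K}. card (D j))" using finD by (simp add: card_SigmaI)
  finally have "real (card S) \<le> (\<Sum>j\<in>{-K..K}. real (card (D j)))" by (simp flip: of_nat_sum)
  also have "\<dots> \<le> (\<Sum>j\<in>{-K..K}. 2 * B)" by (intro sum_mono cardD)
  also have "\<dots> = (2 * real_of_int K + 1) * (2 * B)" using K0 by simp
  also have "\<dots> \<le> (6 * (1 + real R * sqrt (real R / real q))) * (2 * B)"
  proof (intro mult_right_mono)
    have "real_of_int K \<le> 2 * real Q * real R / real q + real R ^ 2 / real Q"
      unfolding K_def by linarith
    also have "\<dots> \<le> 2 * (sqrt (real q * real R) + 1) * real R / real q + real R ^ 2 / sqrt (real q * real R)"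
    proof (rule add_mono)
      show "2 * real Q * real R / real q \<le> 2 * (sqrt (real q * real R) + 1) * real R / real q"
        using Q1 by (intro divide_right_mono mult_right_mono mult_left_mono) auto
      show "real R ^ 2 / real Q \<le> real R ^ 2 / sqrt (real q * real R)"
        using Q1(1) sq by (intro frac_le) auto
    qed
    also have "\<dots> = 3 * (real R * sqrt (real R / real q)) + 2 * real R / real q"
    proof -
      define a where "a = sqrt (real q)"
      define b where "b = sqrt (real R)"
      have ab: "a > 0" "b > 0" "real q = a * a" "real R = b * b" using q0 R0 by (auto simp: a_def b_def)
      have e: "sqrt (real q * real R) = a * b" "sqrt (real R / real q) = b / a"
        by (auto simp: a_def b_def real_sqrt_mult real_sqrt_divide)
      show ?thesis unfolding e unfolding ab(3,4) using ab(1,2) by (simp add: field_simps power2_eq_square)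
    qed
    also have "2 * real R / real q \<le> 1" using R q0 by simp
    finally show "2 * real_of_int K + 1 \<le> 6 * (1 + real R * sqrt (real R / real q))" by simp
  qed (use B0 in simp)
  finally show ?thesis unfolding S_def by (simp add: mult_ac)
qed

text \<open>The unit \<open>a\<close> cancels. For fixed m2 and m3 the remaining pair (m1, m4) has a
  prescribed sum of reciprocals, so the count for two reciprocals applies R^2 times.\<close>

lemma energy_modinv_le:
  fixes q R :: nat and a :: int and B :: real
  assumes q: "prime q" and R: "0 < R" "2 * R < q" and a: "coprime a (int q)"
    and B: "\<And>n. 0 < n \<Longrightarrow> n \<le> q ^ 4 \<Longrightarrow> real (ndiv n) \<le> B"
  shows "real (energy q {1..R} (\<lambda>m. a * rcp q m)) \<le> 12 * B * (real R ^ 2 + real R ^ 3 * sqrt (real R / real q))"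
proof -
  let ?x = "\<lambda>m. rcp q m"
  let ?A = "{1..R}"
  define W where "W = (\<lambda>v. {(m1, m2) \<in> ?A \<times> ?A. [?x m1 + ?x m2 = v] (mod int q)})"
  have cop: "coprime (int m) (int q)" if "1 \<le> m" "m \<le> R" for m
  proof -
    have "\<not> q dvd m" using that R by (auto dest: dvd_imp_le)
    then have "coprime q m" using q by (intro prime_imp_coprime)
      then show ?thesis by (simp add: coprime_commute)
  qed
  \<comment> \<open>A vanishing sum of two reciprocals would force q to divide m2 + m3, which lies
    strictly between 0 and q because 2 R < q.\<close>
  have nz: "\<not> int q dvd ?x m2 + ?x m3" if m: "m2 \<in> ?A" "m3 \<in> ?A" for m2 m3
  proof
    assume "int q dvd ?x m2 + ?x m3"
    then have "[int m2 * int m3 * (?x m2 + ?x m3) = 0] (mod int q)" by (simp add: cong_0_iff)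
    moreover have "[int m3 * (int m2 * ?x m2) + int m2 * (int m3 * ?x m3) = int m3 * 1 + int m2 * 1] (mod int q)"
      using m by (intro cong_add cong_scalar_left modinv_cong cop) auto
    ultimately have "[int m3 + int m2 = 0] (mod int q)"
      by (simp add: algebra_simps) (metis (no_types, lifting) cong_sym cong_trans)
    then have "int q dvd int (m3 + m2)" by (simp add: cong_0_iff)
    then have "q dvd m3 + m2" by (simp only: int_dvd_int_iff)
    then show False using m R by (auto dest: dvd_imp_le)
  qed
  have fin: "finite (W v)" for v
    unfolding W_def by (rule finite_subset[of _ "?A \<times> ?A"]) auto
  have "energy q ?A (\<lambda>m. a * ?x m) \<le> card (Sigma (?A \<times> ?A) (\<lambda>(m2, m3). W (?x m3 + ?x m2)))"
    unfolding energy_def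
  proof (rule card_inj_on_le[where f = "\<lambda>((m1, m2), (m3, m4)). ((m2, m3), (m1, m4))"])
    show "inj_on (\<lambda>((m1, m2), (m3, m4)). ((m2, m3), (m1, m4)))
      {((m1, m2), (m3, m4)) \<in> (?A \<times> ?A) \<times> (?A \<times> ?A). [a * ?x m1 - a * ?x m2 = a * ?x m3 - a * ?x m4] (mod int q)}"
      by (auto simp: inj_on_def)
    have "[?x m1 + ?x m4 = ?x m3 + ?x m2] (mod int q)"
      if "[a * ?x m1 - a * ?x m2 = a * ?x m3 - a * ?x m4] (mod int q)" for m1 m2 m3 m4
    proof -
      have "[a * (?x m1 - ?x m2) = a * (?x m3 - ?x m4)] (mod int q)"
        using that by (simp add: right_diff_distrib)
      then have "[?x m1 - ?x m2 = ?x m3 - ?x m4] (mod int q)"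
        using a cong_mult_lcancel by blast
      then show ?thesis by (simp add: cong_iff_dvd_diff algebra_simps)
    qed
    then show "(\<lambda>((m1, m2), (m3, m4)). ((m2, m3), (m1, m4))) `
      {((m1, m2), (m3, m4)) \<in> (?A \<times> ?A) \<times> (?A \<times> ?A). [a * ?x m1 - a * ?x m2 = a * ?x m3 - a * ?x m4] (mod int q)}
      \<subseteq> Sigma (?A \<times> ?A) (\<lambda>(m2, m3). W (?x m3 + ?x m2))"
      by (auto simp: W_def)
  qed (use fin in auto)
  also have "\<dots> = (\<Sum>(m2, m3)\<in>?A \<times> ?A. card (W (?x m3 + ?x m2)))"
    using fin by (simp add: card_SigmaI case_prod_beta)
  finally have "real (energy q ?A (\<lambda>m. a * ?x m)) \<le> (\<Sum>(m2, m3)\<in>?A \<times> ?A. real (card (W (?x m3 + ?x m2))))"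
    by (simp add: case_prod_beta flip: of_nat_sum)
  also have "\<dots> \<le> (\<Sum>(m2, m3)\<in>?A \<times> ?A. 12 * B * (1 + real R * sqrt (real R / real q)))"
  proof (intro sum_mono)
    fix p assume "p \<in> ?A \<times> ?A"
    then obtain m2 m3 where p: "p = (m2, m3)" "m2 \<in> ?A" "m3 \<in> ?A" by auto
    show "(case p of (m2, m3) \<Rightarrow> real (card (W (?x m3 + ?x m2))))
      \<le> (case p of (m2, m3) \<Rightarrow> 12 * B * (1 + real R * sqrt (real R / real q)))"
      using card_sum_of_two_inverses_le[OF q R nz[OF p(3,2)] B] by (simp add: p W_def)
  qed
  also have "\<dots> = 12 * B * (real R ^ 2 + real R ^ 3 * sqrt (real R / real q))"
    by (simp add: card_cartesian_product power2_eq_square power3_eq_cube algebra_simps)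
  finally show ?thesis .
qed

subsection \<open>Higher additive energies of reciprocals in a dyadic interval\<close>

definition reps :: "nat \<Rightarrow> nat \<Rightarrow> nat \<Rightarrow> (nat \<Rightarrow> nat) set" where
  "reps r a b = {..<r} \<rightarrow>\<^sub>E {a..<b}"

definition invJ :: "nat \<Rightarrow> nat \<Rightarrow> nat \<Rightarrow> nat" where
  "invJ q r N = card {(f, g) \<in> reps r N (2 * N) \<times> reps r N (2 * N).
     [(\<Sum>i<r. rcp q (f i)) = (\<Sum>i<r. rcp q (g i))] (mod int q)}"

abbreviation tprod :: "nat \<Rightarrow> (nat \<Rightarrow> nat) \<Rightarrow> nat" where
  "tprod r f \<equiv> \<Prod>i<r. f i"

text \<open>The numerator of the sum of 1/f_i over the common denominator \<open>tprod r f\<close>: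
  the elementary symmetric polynomial of degree r - 1.\<close>

definition tnum :: "nat \<Rightarrow> (nat \<Rightarrow> nat) \<Rightarrow> nat" where
  "tnum r f = (\<Sum>i<r. \<Prod>j\<in>{..<r} - {i}. f j)"

lemma finite_reps [simp]: "finite (reps r a b)"
  by (simp add: reps_def finite_PiE)

lemma card_reps: "card (reps r a b) = (b - a) ^ r"
  by (simp add: reps_def card_PiE)

lemma sum_modinv_cong:
  assumes "\<And>i. i < r \<Longrightarrow> coprime (int (f i)) (int q)"
  shows "[int (tprod r f) * (\<Sum>i<r. rcp q (f i)) = int (tnum r f)] (mod int q)"
proof -
  have "int (tprod r f) * rcp q (f i) = (\<Prod>j\<in>{..<r} - {i}. int (f j)) * (int (f i) * rcp q (f i))"
    if "i < r" for i
    using that prod.remove[of "{..<r}" i "\<lambda>j. int (f j)"] by (simp add: mult_ac)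
  then have "int (tprod r f) * (\<Sum>i<r. rcp q (f i))
     = (\<Sum>i<r. (\<Prod>j\<in>{..<r} - {i}. int (f j)) * (int (f i) * rcp q (f i)))"
    unfolding sum_distrib_left by (intro sum.cong refl) simp
  also have "[\<dots> = (\<Sum>i<r. (\<Prod>j\<in>{..<r} - {i}. int (f j)) * 1)] (mod int q)"
    using assms by (intro cong_sum cong_scalar_left modinv_cong) auto
  finally show ?thesis by (simp add: tnum_def)
qed

lemma tprod_bounds:
  assumes "f \<in> reps r N (2 * N)"
  shows "N ^ r \<le> tprod r f" "tprod r f \<le> (2 * N) ^ r"
proof -
  have f: "N \<le> f i" "f i \<le> 2 * N" if "i < r" for i using assms that by (force simp: reps_def PiE_iff)+
  have "(\<Prod>i<r. N) \<le> tprod r f" using f by (intro prod_mono) auto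
  then show "N ^ r \<le> tprod r f" by simp
  have "tprod r f \<le> (\<Prod>i<r. 2 * N)" using f by (intro prod_mono) auto
  then show "tprod r f \<le> (2 * N) ^ r" by simp
qed

lemma tnum_bound:
  assumes "f \<in> reps r N (2 * N)"
  shows "tnum r f \<le> r * (2 * N) ^ (r - 1)"
proof -
  have f: "f i \<le> 2 * N" if "i < r" for i using assms that by (force simp: reps_def PiE_iff)
  have "(\<Prod>j\<in>{..<r} - {i}. f j) \<le> (2 * N) ^ (r - 1)" if "i < r" for i
  proof -
    have "(\<Prod>j\<in>{..<r} - {i}. f j) \<le> (\<Prod>j\<in>{..<r} - {i}. 2 * N)" using f by (intro prod_mono) auto
    then show ?thesis using that by simp
  qed
  then have "tnum r f \<le> (\<Sum>i<r. (2 * N) ^ (r - 1))" unfolding tnum_def by (intro sum_mono) auto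
  then show ?thesis by simp
qed

lemma card_reps_tprod_le:
  assumes "v > 0"
  shows "card {f \<in> reps r a b. tprod r f = v} \<le> ndiv v ^ r"
proof -
  have "card {f \<in> reps r a b. tprod r f = v} \<le> card {f \<in> {..<r} \<rightarrow>\<^sub>E UNIV. (\<Prod>i<r. f i) = v}"
    using card_tuples_prod_le(1)[of "{..<r}" v] assms
    by (intro card_mono) (auto simp: reps_def PiE_iff)
  then show ?thesis using card_tuples_prod_le(2)[of "{..<r}" v] assms by simp
qed

text \<open>If p occurred only once in the product of both denominators, a single term 1/f_i would
  carry p in its denominator. Then the left fraction would have p in its reduced denominator and the
  right one would not.\<close>

lemma powerful_of_equal_fractions:
  assumes pos: "\<And>i. i < r \<Longrightarrow> f i > 0"
    and eq: "tnum r f * tprod r g = tnum r g * tprod r f"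
    and p: "prime p" "p dvd tprod r f"
  shows "p ^ 2 dvd tprod r f * tprod r g"
proof (rule ccontr)
  assume no: "\<not> p ^ 2 dvd tprod r f * tprod r g"
  obtain i where i: "i < r" "p dvd f i"
    using p by (auto simp: prime_dvd_prod_iff)
  have split: "tprod r f = f i * (\<Prod>j\<in>{..<r} - {i}. f j)"
    using i by (simp add: prod.remove[of "{..<r}" i])
  have 1: "\<not> p dvd (\<Prod>j\<in>{..<r} - {i}. f j)"
  proof
    assume "p dvd (\<Prod>j\<in>{..<r} - {i}. f j)"
    then have "p * p dvd tprod r f" unfolding split using i by (intro mult_dvd_mono)
    then show False using no by (simp add: power2_eq_square)
  qed
  have 2: "\<not> p dvd tprod r g"
  proof
    assume "p dvd tprod r g"
    then have "p * p dvd tprod r f * tprod r g" using p by (intro mult_dvd_mono)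
    then show False using no by (simp add: power2_eq_square)
  qed
  have "tnum r f = (\<Prod>j\<in>{..<r} - {i}. f j) + (\<Sum>i'\<in>{..<r} - {i}. \<Prod>j\<in>{..<r} - {i'}. f j)"
    unfolding tnum_def using i by (simp add: sum.remove[of "{..<r}" i])
  moreover have "p dvd (\<Sum>i'\<in>{..<r} - {i}. \<Prod>j\<in>{..<r} - {i'}. f j)"
  proof (rule dvd_sum)
    fix i' assume "i' \<in> {..<r} - {i}"
    then have "f i dvd (\<Prod>j\<in>{..<r} - {i'}. f j)" using i by (intro dvd_prodI) auto
    then show "p dvd (\<Prod>j\<in>{..<r} - {i'}. f j)" using i dvd_trans by blast
  qed
  ultimately have "\<not> p dvd tnum r f" using 1 by (simp add: dvd_add_left_iff)
  moreover have "p dvd tnum r f * tprod r g" unfolding eq using p(2) by simp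
  ultimately show False using 2 p(1) by (simp add: prime_dvd_mult_iff)
qed

text \<open>Write n = s^2 t with t squarefree. A prime dividing t divides t once and n at least
  twice, so it divides s. Hence t divides s \<le> Y, and summing the number of divisors over s gives
  the bound.\<close>

lemma card_powerful_le:
  fixes Y :: nat
  assumes B: "\<And>n. 0 < n \<Longrightarrow> n \<le> Y \<Longrightarrow> real (ndiv n) \<le> B"
  shows "real (card {n \<in> {1..Y ^ 2}. \<forall>p. prime p \<longrightarrow> p dvd n \<longrightarrow> p ^ 2 dvd n}) \<le> real Y * B"
proof -
  let ?P = "{n \<in> {1..Y ^ 2}. \<forall>p. prime p \<longrightarrow> p dvd n \<longrightarrow> p ^ 2 dvd n}"
  have "?P \<subseteq> (\<lambda>(s, t). s ^ 2 * t) ` Sigma {1..Y} (\<lambda>s. {t. t dvd s})"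
  proof
    fix n assume n: "n \<in> ?P"
    define s where "s = square_part n"
    define t where "t = squarefree_part n"
    have n0: "n \<noteq> 0" using n by auto
    have nst: "n = s ^ 2 * t" unfolding s_def t_def by (simp add: squarefree_decompose[symmetric] mult.commute)
    have s0: "s > 0" "t > 0" using nst n0 by (auto intro: Nat.gr0I)
    have sft: "squarefree t" unfolding t_def by (rule squarefree_squarefree_part)
    have "t dvd s"
    proof (rule multiplicity_le_imp_dvd)
      fix p :: nat assume p: "prime p"
      have le1: "multiplicity p t \<le> 1" using sft p s0 by (simp add: squarefree_factorial_semiring'')
      show "multiplicity p t \<le> multiplicity p s"
      proof (cases "p dvd t")
        case True
        have "p dvd s"
        proof (rule ccontr)
          assume "\<not> p dvd s"
          have "p ^ 2 dvd n" using n p True nst by auto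
          then have "2 \<le> multiplicity p n" using n0 p by (intro multiplicity_geI) (auto dest: prime_nat_iff[THEN iffD1])
          also have "multiplicity p n = 2 * multiplicity p s + multiplicity p t"
            unfolding nst using p s0 by (simp add: prime_elem_multiplicity_mult_distrib prime_elem_multiplicity_power_distrib)
          also have "multiplicity p s = 0" using \<open>\<not> p dvd s\<close> by (rule not_dvd_imp_multiplicity_0)
          finally show False using le1 by simp
        qed
        then have "multiplicity p s \<ge> 1" using s0 p by (intro multiplicity_geI) (auto dest: prime_nat_iff[THEN iffD1])
        then show ?thesis using le1 by linarith
      qed (simp add: not_dvd_imp_multiplicity_0)
    qed (use s0 in auto)
    moreover have "s \<le> Y"
    proof -
      have "s ^ 2 \<le> n" using nst s0 by simp
      moreover have "n \<le> Y ^ 2" using n by simp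
      ultimately have "s ^ 2 \<le> Y ^ 2" by (rule order_trans)
      then show ?thesis by (rule power2_le_imp_le) simp
    qed
    ultimately show "n \<in> (\<lambda>(s, t). s ^ 2 * t) ` Sigma {1..Y} (\<lambda>s. {t. t dvd s})"
      using nst s0 by (intro image_eqI[of _ _ "(s, t)"]) auto
  qed
  then have "card ?P \<le> card (Sigma {1..Y} (\<lambda>s. {t. t dvd s}))"
    by (intro surj_card_le) auto
  also have "\<dots> = (\<Sum>s\<in>{1..Y}. ndiv s)" by (simp add: ndiv_def)
  finally have "real (card ?P) \<le> (\<Sum>s\<in>{1..Y}. real (ndiv s))" by (simp flip: of_nat_sum)
  also have "\<dots> \<le> (\<Sum>s\<in>{1..Y}. B)" by (intro sum_mono B) auto
  finally show ?thesis by simp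
qed

text \<open>Since \<open>a\<close> is invertible, \<open>v\<close> lies in one residue class, where
  it is determined by its quotient by \<open>m\<close>.\<close>

lemma card_linear_congruence_le:
  fixes a b m :: int and Y :: nat
  assumes m: "m > 0" and a: "coprime a m"
  shows "card {v \<in> {1..Y}. [a * int v = b] (mod m)} \<le> Y div nat m + 1"
proof -
  have "card {v \<in> {1..Y}. [a * int v = b] (mod m)} \<le> card {0..Y div nat m}"
  proof (rule card_inj_on_le[where f = "\<lambda>v. v div nat m"])
    show "inj_on (\<lambda>v. v div nat m) {v \<in> {1..Y}. [a * int v = b] (mod m)}"
    proof (rule inj_onI)
      fix v w assume v: "v \<in> {v \<in> {1..Y}. [a * int v = b] (mod m)}" "w \<in> {v \<in> {1..Y}. [a * int v = b] (mod m)}"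
        and div: "v div nat m = w div nat m"
      have "[a * int v = a * int w] (mod m)" using v by (auto intro: cong_trans cong_sym)
      then have "[int v = int w] (mod m)" using a cong_mult_lcancel by blast
      then have "int v mod m = int w mod m" by (simp add: cong_def)
      then have "v mod nat m = w mod nat m" using m by (metis int_nat_eq less_imp_le of_nat_eq_iff zmod_int)
      then show "v = w" using div by (metis div_mult_mod_eq)
    qed
  qed (auto intro: div_le_mono)
  then show ?thesis by simp
qed


text \<open>After clearing denominators, either the two fractions agree over the rationals or their
  cross difference is a nonzero multiple of q. The first case makes the product of all 2r variables
  powerful, hence rare; the second is counted for each fixed \<open>f\<close> through the possible
  multiples.\<close>

lemma invJ_le:
  fixes q r N :: nat and B :: real
  assumes q: "prime q" and N: "N \<ge> 1" "2 * N \<le> q" and r: "r \<ge> 1"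
    and B: "\<And>n. 0 < n \<Longrightarrow> n \<le> (2 * N) ^ (2 * r) \<Longrightarrow> real (ndiv n) \<le> B"
  shows "real (invJ q r N) \<le> (2 * real N) ^ r * B ^ (2 * r + 1)
      + real N ^ r * (2 ^ (r + 2) * (real r * (2 * real N) ^ (2 * r - 1) / real q) * B ^ r)"
proof -
  define F where "F = reps r N (2 * N)"
  define Y where "Y = (2 * N) ^ r"
  let ?P = "tprod r" and ?A = "tnum r"
  have finF: "finite F" by (simp add: F_def)
  have B1: "B \<ge> 1" using B[of 1] N by (simp add: ndiv_def)
  have q0: "real q > 0" using q prime_gt_0_nat by simp
  have Y2: "Y ^ 2 = (2 * N) ^ (2 * r)" unfolding Y_def power_mult[symmetric] by (simp only: mult.commute)
  have BY: "real (ndiv n) \<le> B" if "0 < n" "n \<le> Y ^ 2" for n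
    using B[of n] that unfolding Y2 by blast
  have Y1: "Y \<ge> 1" using N by (simp add: Y_def)
  have YY: "Y \<le> Y ^ 2" using Y1 by (simp add: power2_eq_square)
  have fpos: "f i > 0" if "f \<in> F" "i < r" for f i
    using that N by (force simp: F_def reps_def PiE_iff)
  have fcop: "coprime (f i) q" if "f \<in> F" "i < r" for f i
  proof -
    have "f i < q" using that N by (force simp: F_def reps_def PiE_iff)
    then have "\<not> q dvd f i" using fpos[OF that] by (auto dest: dvd_imp_le)
    then have "coprime q (f i)" using q by (intro prime_imp_coprime)
    then show ?thesis by (simp add: coprime_commute)
  qed
  have Ppos: "?P f > 0" if "f \<in> F" for f using fpos[OF that] by simp
  have PY: "?P f \<le> Y" if "f \<in> F" for f
    using tprod_bounds(2) that by (simp add: F_def Y_def)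
  define C where "C = (\<lambda>f g. [int (?A f) * int (?P g) = int (?A g) * int (?P f)] (mod int q))"
  \<comment> \<open>The solutions over the rationals; those that hold only modulo q go to
    \<open>G\<close>.\<close>
  define S0 where "S0 = {(f, g) \<in> F \<times> F. ?A f * ?P g = ?A g * ?P f}"
  define G where "G = (\<lambda>f. {g \<in> F. C f g \<and> ?A f * ?P g \<noteq> ?A g * ?P f})"
  have "invJ q r N \<le> card (S0 \<union> Sigma F G)"
    unfolding invJ_def F_def[symmetric]
  proof (intro card_mono)
    show "finite (S0 \<union> Sigma F G)" using finF
      by (intro finite_UnI finite_SigmaI) (auto simp: S0_def G_def intro: finite_subset[of _ "F \<times> F"])
    show "{(f, g) \<in> F \<times> F. [(\<Sum>i<r. rcp q (f i)) = (\<Sum>i<r. rcp q (g i))] (mod int q)} \<subseteq> S0 \<union> Sigma F G"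
    proof (rule subsetI)
      fix z assume "z \<in> {(f, g) \<in> F \<times> F. [(\<Sum>i<r. rcp q (f i)) = (\<Sum>i<r. rcp q (g i))] (mod int q)}"
      then obtain f g where z: "z = (f, g)" and f: "f \<in> F" and g: "g \<in> F"
        and eq: "[(\<Sum>i<r. rcp q (f i)) = (\<Sum>i<r. rcp q (g i))] (mod int q)"
        by auto
      have 1: "[int (?P f) * (\<Sum>i<r. rcp q (f i)) = int (?A f)] (mod int q)"
        using fcop[OF f] by (intro sum_modinv_cong) simp
      have 2: "[int (?P g) * (\<Sum>i<r. rcp q (g i)) = int (?A g)] (mod int q)"
        using fcop[OF g] by (intro sum_modinv_cong) simp
      let ?s = "\<lambda>h. \<Sum>i<r. rcp q (h i)"
      have c1: "[int (?A f) * int (?P g) = int (?P f) * ?s f * int (?P g)] (mod int q)"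
        by (intro cong_scalar_right cong_sym[OF 1])
      have c2: "[int (?P f) * ?s f * int (?P g) = int (?P f) * ?s g * int (?P g)] (mod int q)"
        by (intro cong_scalar_right cong_scalar_left eq)
      have c3: "[int (?P g) * ?s g * int (?P f) = int (?A g) * int (?P f)] (mod int q)"
        by (intro cong_scalar_right 2)
      have e: "int (?P f) * ?s g * int (?P g) = int (?P g) * ?s g * int (?P f)" by (simp only: mult_ac)
      have "C f g" unfolding C_def by (rule cong_trans[OF cong_trans[OF c1 c2[unfolded e]] c3])
      then show "z \<in> S0 \<union> Sigma F G" using f g by (auto simp: z S0_def G_def)
    qed
  qed
  also have "\<dots> \<le> card S0 + card (Sigma F G)" by (rule card_Un_le)
  finally have split: "real (invJ q r N) \<le> real (card S0) + real (card (Sigma F G))" by linarith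
  have S0: "real (card S0) \<le> (2 * real N) ^ r * B ^ (2 * r + 1)"
  proof -
    let ?Pw = "{n \<in> {1..Y ^ 2}. \<forall>p. prime p \<longrightarrow> p dvd n \<longrightarrow> p ^ 2 dvd n}"
    \<comment> \<open>Once the powerful number n = P(f) P(g) is known, both tuples lie in
      \<open>Z n\<close>, which has at most \<open>B ^ r\<close> elements as every coordinate
      divides n.\<close>
    define Z where "Z = (\<lambda>n. {f \<in> F. ?P f dvd n})"
    have finZ: "finite (Z n)" for n using finF by (simp add: Z_def)
    have cardZ: "real (card (Z n)) \<le> B ^ r" if n: "n \<in> ?Pw" for n
    proof -
      have "Z n \<subseteq> {..<r} \<rightarrow>\<^sub>E {d. d dvd n}"
      proof
        fix f assume f: "f \<in> Z n"
        have "f i dvd n" if "i < r" for i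
        proof -
          have "f i dvd ?P f" using that by (intro dvd_prodI) auto
          then show ?thesis using f by (auto simp: Z_def intro: dvd_trans)
        qed
        then show "f \<in> {..<r} \<rightarrow>\<^sub>E {d. d dvd n}" using f by (auto simp: Z_def F_def reps_def PiE_iff)
      qed
      then have "card (Z n) \<le> card ({..<r} \<rightarrow>\<^sub>E {d. d dvd n})"
        using n by (intro card_mono finite_PiE) auto
      also have "\<dots> = ndiv n ^ r" by (simp add: card_PiE ndiv_def)
      finally have "real (card (Z n)) \<le> real (ndiv n) ^ r" by (metis of_nat_le_iff of_nat_power)
      also have "\<dots> \<le> B ^ r" using n BY by (intro power_mono) auto
      finally show ?thesis .
    qed
    have "card S0 \<le> card (Sigma ?Pw (\<lambda>n. Z n \<times> Z n))"
    proof (rule card_inj_on_le[where f = "\<lambda>(f, g). (?P f * ?P g, (f, g))"])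
      show "(\<lambda>(f, g). (?P f * ?P g, (f, g))) ` S0 \<subseteq> Sigma ?Pw (\<lambda>n. Z n \<times> Z n)"
      proof (rule image_subsetI)
        fix z assume "z \<in> S0"
        then obtain f g where z: "z = (f, g)" and f: "f \<in> F" and g: "g \<in> F"
          and eq: "?A f * ?P g = ?A g * ?P f" by (auto simp: S0_def)
        have "?P f * ?P g \<in> {1..Y ^ 2}"
          using Ppos[OF f] Ppos[OF g] PY[OF f] PY[OF g]
          by (auto simp: power2_eq_square Suc_le_eq intro: mult_mono)
        moreover have "p ^ 2 dvd ?P f * ?P g" if p: "prime p" "p dvd ?P f * ?P g" for p
        proof (cases "p dvd ?P f")
          case True
          show ?thesis by (rule powerful_of_equal_fractions[OF fpos[OF f] eq p(1) True])
        next
          case False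
          then have "p dvd ?P g" using p by (simp add: prime_dvd_mult_iff)
          from powerful_of_equal_fractions[OF fpos[OF g] eq[symmetric] p(1) this]
          show ?thesis by (simp add: mult.commute)
        qed
        ultimately show "(\<lambda>(f, g). (?P f * ?P g, (f, g))) z \<in> Sigma ?Pw (\<lambda>n. Z n \<times> Z n)"
          using f g by (simp add: z Z_def)
      qed
    qed (use finZ in \<open>auto simp: inj_on_def\<close>)
    also have "\<dots> = (\<Sum>n\<in>?Pw. card (Z n) * card (Z n))"
      using finZ by (subst card_SigmaI) (auto simp: card_cartesian_product)
    finally have "real (card S0) \<le> (\<Sum>n\<in>?Pw. real (card (Z n)) * real (card (Z n)))"
      by (simp flip: of_nat_sum of_nat_mult)
    also have "\<dots> \<le> (\<Sum>n\<in>?Pw. B ^ r * B ^ r)"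
      using B1 by (intro sum_mono mult_mono cardZ) auto
    also have "\<dots> = real (card ?Pw) * (B ^ r * B ^ r)" by simp
    also have "\<dots> \<le> (real Y * B) * (B ^ r * B ^ r)"
      using B1 YY by (intro mult_right_mono card_powerful_le BY) auto
    also have "\<dots> = (2 * real N) ^ r * B ^ (2 * r + 1)"
    proof -
      have "B * (B ^ r * B ^ r) = B ^ (2 * r + 1)" by (simp add: mult_2 power_add)
      moreover have "real Y = (2 * real N) ^ r" by (simp add: Y_def)
      ultimately show ?thesis by (simp only: mult.assoc)
    qed
    finally show ?thesis .
  qed
  \<comment> \<open>Each of A(f) P(g) and A(g) P(f) is at most r (2N)^(2r-1), so the cross
    difference is at most \<open>K\<close> times q in absolute value.\<close>
  define K where "K = real r * (2 * real N) ^ (2 * r - 1) / real q"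
  have K0: "K \<ge> 0" by (simp add: K_def)
  have Gf: "real (card (G f)) \<le> 2 ^ (r + 2) * K * B ^ r" if f: "f \<in> F" for f
  proof -
    \<comment> \<open>A(f) need not be invertible modulo P(f), so the common factor must be removed.
      Doing so lengthens the list of values in a residue class by a factor \<open>d\<close>, but
      also divides the number of multiples by \<open>d\<close>, so nothing is lost.\<close>
    define d where "d = gcd (?A f) (?P f)"
    have d0: "d > 0" using Ppos[OF f] by (simp add: d_def)
    obtain A' where A': "?A f = d * A'" using gcd_dvd1[of "?A f" "?P f"] unfolding d_def dvd_def by blast
    obtain P' where P': "?P f = d * P'" using gcd_dvd2[of "?A f" "?P f"] unfolding d_def dvd_def by blast
    have P'0: "P' > 0" using Ppos[OF f] P' by (cases P') auto
    have copAP: "coprime A' P'"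
    proof -
      have "d * gcd A' P' = d" using A' P' d_def by (metis gcd_mult_distrib_nat)
      then have "d * gcd A' P' = d * 1" by (simp only: mult.right_neutral)
      then have "gcd A' P' = 1" using d0 unfolding mult_cancel1 by blast
      then show ?thesis unfolding coprime_iff_gcd_eq_1 .
    qed
    have copdq: "coprime (int q) (int d)"
    proof -
      have "coprime (?P f) q" using fcop[OF f] by (intro prod_coprime_left) auto
      then have "coprime d q" using P' by simp
      then show ?thesis by (simp add: coprime_commute)
    qed
    define Kd where "Kd = \<lfloor>K / real d\<rfloor>"
    \<comment> \<open>Zero belongs to \<open>S0\<close>. Without it the number of multiples is at
      most 2 K / d with no additive 1, so the bound stays proportional to \<open>K\<close> even when
      \<open>K\<close> is below 1.\<close>
    define Ks where "Ks = {-Kd..Kd} - {0}"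
    define V where "V = (\<lambda>k'. {v \<in> {1..Y}. [int A' * int v = k' * int q] (mod int P')})"
    have VB: "card (V k') \<le> Y div P' + 1" for k'
      unfolding V_def using card_linear_congruence_le[of "int P'" "int A'" Y "k' * int q"] P'0 copAP by simp
    have rel: "\<exists>k'\<in>Ks. ?P g \<in> V k'" if g: "g \<in> G f" for g
    proof -
      have gF: "g \<in> F" using g by (simp add: G_def)
      have "int q dvd int (?A f) * int (?P g) - int (?A g) * int (?P f)"
        using g by (simp add: G_def C_def cong_iff_dvd_diff)
      moreover have eqd: "int (?A f) * int (?P g) - int (?A g) * int (?P f) = int d * (int A' * int (?P g) - int (?A g) * int P')"
        unfolding A' P' by (simp add: algebra_simps)
      ultimately have "int q dvd int A' * int (?P g) - int (?A g) * int P'"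
        using copdq coprime_dvd_mult_right_iff by metis
      then obtain k' where k'0: "int A' * int (?P g) - int (?A g) * int P' = int q * k'"
        unfolding dvd_def by blast
      note k' = k'0[unfolded mult.commute[of "int q"]]
      have "k' \<noteq> 0"
      proof
        assume "k' = 0"
        then have "int (?A f) * int (?P g) = int (?A g) * int (?P f)" using eqd k' by simp
        then have "?A f * ?P g = ?A g * ?P f" by (metis of_nat_eq_iff of_nat_mult)
        then show False using g by (simp add: G_def)
      qed
      moreover have "\<bar>k'\<bar> \<le> Kd"
      proof -
        have bnd: "real (?A h) * real (?P h') \<le> real r * (2 * real N) ^ (2 * r - 1)" if "h \<in> F" "h' \<in> F" for h h'
        proof -
          have "real (?A h) \<le> real (r * (2 * N) ^ (r - 1))"
            using tnum_bound that(1) unfolding F_def of_nat_le_iff by blast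
          moreover have "real (?P h') \<le> real ((2 * N) ^ r)"
            using PY[OF that(2)] unfolding Y_def of_nat_le_iff .
          ultimately have "real (?A h) * real (?P h') \<le> real (r * (2 * N) ^ (r - 1)) * real ((2 * N) ^ r)"
            by (rule mult_mono) (rule of_nat_0_le_iff)+
          also have "\<dots> = real r * ((2 * real N) ^ (r - 1) * (2 * real N) ^ r)" by simp
          also have "(2 * real N) ^ (r - 1) * (2 * real N) ^ r = (2 * real N) ^ (2 * r - 1)"
          proof -
            have e: "r - 1 + r = 2 * r - 1" using r by simp
            show ?thesis unfolding power_add[symmetric] e ..
          qed
          finally show ?thesis .
        qed
        have "real d * real_of_int \<bar>k'\<bar> * real q = \<bar>real_of_int (int d * (k' * int q))\<bar>"
          by (simp add: abs_mult)
        also have "\<dots> = \<bar>real (?A f) * real (?P g) - real (?A g) * real (?P f)\<bar>"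
          unfolding k'[symmetric] eqd[symmetric] by simp
        also have "\<dots> \<le> real r * (2 * real N) ^ (2 * r - 1)"
          using bnd[OF f gF] bnd[OF gF f] mult_nonneg_nonneg[of "real (?A f)" "real (?P g)"] mult_nonneg_nonneg[of "real (?A g)" "real (?P f)"]
          unfolding abs_le_iff by linarith
        finally have "real_of_int \<bar>k'\<bar> \<le> K / real d"
          using q0 d0 by (simp add: K_def field_simps)
        then show ?thesis by (simp add: Kd_def le_floor_iff)
      qed
      moreover have "?P g \<in> V k'"
      proof -
        have "int A' * int (?P g) - k' * int q = int (?A g) * int P'" using k' by simp
        then have "[int A' * int (?P g) = k' * int q] (mod int P')" by (simp add: cong_iff_dvd_diff)
        then show ?thesis using Ppos[OF gF] PY[OF gF] by (simp add: V_def Suc_le_eq)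
      qed
      ultimately show ?thesis by (intro bexI[of _ k']) (auto simp: Ks_def abs_le_iff)
    qed
    have finV: "finite (V k')" for k' by (simp add: V_def)
    define W where "W = (\<Union>k'\<in>Ks. V k')"
    have finW: "finite W" using finV by (auto simp: W_def Ks_def)
    have "card (G f) \<le> card (Sigma W (\<lambda>v. {g \<in> F. ?P g = v}))"
    proof (rule card_inj_on_le[where f = "\<lambda>g. (?P g, g)"])
      show "(\<lambda>g. (?P g, g)) ` G f \<subseteq> Sigma W (\<lambda>v. {g \<in> F. ?P g = v})"
        using rel by (auto simp: W_def G_def)
    qed (use finF finW in \<open>auto simp: inj_on_def\<close>)
    also have "\<dots> = (\<Sum>v\<in>W. card {g \<in> F. ?P g = v})" using finF finW by (intro card_SigmaI) auto
    finally have "real (card (G f)) \<le> (\<Sum>v\<in>W. real (card {g \<in> F. ?P g = v}))" by (simp flip: of_nat_sum)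
    also have "\<dots> \<le> (\<Sum>v\<in>W. B ^ r)"
    proof (rule sum_mono)
      fix v assume "v \<in> W"
      then have v: "0 < v" "v \<le> Y" by (auto simp: W_def V_def)
      have "real (card {g \<in> F. ?P g = v}) \<le> real (ndiv v) ^ r"
        using card_reps_tprod_le[OF v(1), of r N "2 * N"] unfolding F_def of_nat_power[symmetric] of_nat_le_iff .
      also have "\<dots> \<le> B ^ r" using v YY by (intro power_mono BY) auto
      finally show "real (card {g \<in> F. ?P g = v}) \<le> B ^ r" .
    qed
    also have "\<dots> = real (card W) * B ^ r" by simp
    also have "\<dots> \<le> (2 ^ (r + 2) * K) * B ^ r"
    proof (intro mult_right_mono)
      have "card W \<le> (\<Sum>k'\<in>Ks. card (V k'))" unfolding W_def by (intro card_UN_le) (auto simp: Ks_def)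
      also have "\<dots> \<le> (\<Sum>k'\<in>Ks. Y div P' + 1)" by (intro sum_mono VB)
      finally have "card W \<le> card Ks * (Y div P' + 1)" by simp
      then have "real (card W) \<le> real (card Ks) * real (Y div P' + 1)" by (metis of_nat_le_iff of_nat_mult)
      also have "\<dots> \<le> (2 * (K / real d)) * (2 ^ (r + 1) * real d)"
      proof (rule mult_mono)
        have Kd0: "Kd \<ge> 0" using K0 d0 by (simp add: Kd_def)
        then have "card Ks = nat (2 * Kd)" unfolding Ks_def by (subst card_Diff_subset) auto
        then have "real (card Ks) = 2 * real_of_int Kd" using Kd0 by simp
        also have "real_of_int Kd \<le> K / real d" by (simp add: Kd_def)
        finally show "real (card Ks) \<le> 2 * (K / real d)" by simp
        \<comment> \<open>Here the dyadic range enters: every coordinate is at least N, so Y exceeds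
          d P' by a factor of at most 2^r and each residue class has at most 2^(r+1) d
          members.\<close>
        have "Y \<le> 2 ^ r * ?P f" using tprod_bounds(1)[of f r N] f by (simp add: F_def Y_def power_mult_distrib)
        then have "Y div P' \<le> (2 ^ r * d * P') div P'" unfolding P' by (intro div_le_mono) (simp add: mult_ac)
        then have "Y div P' \<le> 2 ^ r * d" using P'0 by simp
        moreover have "1 \<le> 2 ^ r * d" using d0 by (simp add: Suc_le_eq)
        ultimately have "Y div P' + 1 \<le> 2 ^ r * d + 2 ^ r * d" by (rule add_mono)
        also have "\<dots> = 2 ^ (r + 1) * d" by (simp add: algebra_simps)
        finally have "Y div P' + 1 \<le> 2 ^ (r + 1) * d" .
        then have "real (Y div P' + 1) \<le> real (2 ^ (r + 1) * d)" unfolding of_nat_le_iff .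
        then show "real (Y div P' + 1) \<le> 2 ^ (r + 1) * real d" by simp
      qed (use K0 in auto)
      also have "\<dots> = 2 ^ (r + 2) * K" using d0 by simp
      finally show "real (card W) \<le> 2 ^ (r + 2) * K" .
    qed (use B1 in auto)
    finally show ?thesis .
  qed
  have "real (card (Sigma F G)) = (\<Sum>f\<in>F. real (card (G f)))"
    using finF by (subst card_SigmaI) (auto simp: G_def)
  also have "\<dots> \<le> (\<Sum>f\<in>F. 2 ^ (r + 2) * K * B ^ r)" by (intro sum_mono Gf)
  also have "\<dots> = real N ^ r * (2 ^ (r + 2) * K * B ^ r)"
    by (simp add: F_def card_reps)
  finally show ?thesis using split S0 by (simp add: K_def)
qed

subsection \<open>Reciprocals in short progressions\<close>

text \<open>Lagrange's theorem, proved by splitting off linear factors. A single point of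
  nonvanishing replaces the condition that p is nonzero modulo q, and the induction runs over the
  integral degree, so the leading coefficient may vanish modulo q.\<close>

lemma card_poly_roots_mod_le:
  fixes q :: nat and p :: "int poly"
  assumes q: "prime q" and nz: "\<not> int q dvd poly p x0"
  shows "card {w \<in> {..<q}. int q dvd poly p (int w)} \<le> degree p"
  using nz
proof (induction "degree p" arbitrary: p)
  case 0
  then obtain c where c: "p = [:c:]" by (metis degree_eq_zeroE)
  then have "\<not> int q dvd c" using 0 by simp
  then show ?case by (simp add: c)
next
  case (Suc n)
  show ?case
  proof (cases "\<exists>a<q. int q dvd poly p (int a)")
    case False
    then have "{w \<in> {..<q}. int q dvd poly p (int w)} = {}" by auto
    then show ?thesis by (simp only: card.empty)
  next
    case True
    then obtain a where a: "a < q" "int q dvd poly p (int a)" by blast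
    define s where "s = synthetic_div p (int a)"
    have decomp: "poly p x = poly p (int a) + (x - int a) * poly s x" for x
    proof -
      have "p + Polynomial.smult (int a) s = pCons (poly p (int a)) s"
        unfolding s_def by (rule synthetic_div_correct[symmetric, THEN sym])
      then have "poly (p + Polynomial.smult (int a) s) x = poly (pCons (poly p (int a)) s) x" by simp
      then show ?thesis by (simp add: algebra_simps)
    qed
    have deg: "degree s = n" using Suc(2) by (simp add: s_def degree_synthetic_div)
    have "\<not> int q dvd poly s x0"
      using Suc.prems decomp[of x0] a(2) by (metis dvd_add dvd_mult)
    then have IH: "card {w \<in> {..<q}. int q dvd poly s (int w)} \<le> n"
      using Suc(1)[of s] deg by simp
    have "{w \<in> {..<q}. int q dvd poly p (int w)} \<subseteq> insert a {w \<in> {..<q}. int q dvd poly s (int w)}"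
    proof (rule subsetI)
      fix w assume w: "w \<in> {w \<in> {..<q}. int q dvd poly p (int w)}"
      then have "int q dvd (int w - int a) * poly s (int w)"
        using decomp[of "int w"] a(2) by (metis dvd_add_right_iff mem_Collect_eq)
      then have "int q dvd int w - int a \<or> int q dvd poly s (int w)"
        using q by (simp add: prime_dvd_mult_iff)
      moreover have "w = a" if "int q dvd int w - int a"
      proof -
        have "[int w = int a] (mod int q)" using that by (simp add: cong_iff_dvd_diff)
        then show ?thesis using w a by (auto simp: cong_def)
      qed
      ultimately show "w \<in> insert a {w \<in> {..<q}. int q dvd poly s (int w)}" using w by auto
    qed
    then have "card {w \<in> {..<q}. int q dvd poly p (int w)} \<le> card (insert a {w \<in> {..<q}. int q dvd poly s (int w)})"
      by (intro card_mono) auto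
    also have "\<dots> \<le> Suc (card {w \<in> {..<q}. int q dvd poly s (int w)})" by (rule card_insert_le_m1) auto
    finally show ?thesis using IH Suc(2) by simp
  qed
qed

text \<open>A common unit cancels from the congruence; this strips the reciprocal of
  \<open>u\<close> from a progression.\<close>

lemma Jcount_scale:
  assumes "coprime c (int q)" "\<And>t. t < T \<Longrightarrow> [l t = c * l' t] (mod int q)"
  shows "Jcount q r l T = Jcount q r l' T"
proof -
  have "[(\<Sum>i<r. l (f i)) = c * (\<Sum>i<r. l' (f i))] (mod int q)" if "f \<in> tuples r T" for f
    unfolding sum_distrib_left using that assms(2) by (intro cong_sum) (auto simp: tuples_def PiE_iff)
  then have "[(\<Sum>i<r. l (f i)) = (\<Sum>i<r. l (g i))] (mod int q) \<longleftrightarrow> [(\<Sum>i<r. l' (f i)) = (\<Sum>i<r. l' (g i))] (mod int q)"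
    if "f \<in> tuples r T" "g \<in> tuples r T" for f g
    using that cong_mult_lcancel[OF assms(1)] by (meson cong_sym cong_trans)
  then show ?thesis unfolding Jcount_def by (intro arg_cong[of _ _ card]) auto
qed

text \<open>Tuples with the same \<open>occ\<close> are rearrangements of one another; these are the
  solutions that hold for every \<open>w\<close>.\<close>

definition occ :: "nat \<Rightarrow> (nat \<Rightarrow> nat) \<Rightarrow> nat \<Rightarrow> nat" where
  "occ r f t = card {i \<in> {..<r}. f i = t}"

text \<open>Such a \<open>g\<close> takes its values in the image of \<open>f\<close>, which has at
  most r elements.\<close>

lemma card_same_occ_le:
  "card {(f, g) \<in> tuples r T \<times> tuples r T. occ r f = occ r g} \<le> T ^ r * r ^ r"
proof -
  have "card {(f, g) \<in> tuples r T \<times> tuples r T. occ r f = occ r g}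
      \<le> card (Sigma (tuples r T) (\<lambda>f. {..<r} \<rightarrow>\<^sub>E f ` {..<r}))"
  proof (intro card_mono)
    show "finite (Sigma (tuples r T) (\<lambda>f. {..<r} \<rightarrow>\<^sub>E f ` {..<r}))"
      by (intro finite_SigmaI finite_PiE) auto
    show "{(f, g) \<in> tuples r T \<times> tuples r T. occ r f = occ r g} \<subseteq> Sigma (tuples r T) (\<lambda>f. {..<r} \<rightarrow>\<^sub>E f ` {..<r})"
    proof (rule subsetI)
      fix z assume "z \<in> {(f, g) \<in> tuples r T \<times> tuples r T. occ r f = occ r g}"
      then obtain f g where z: "z = (f, g)" "f \<in> tuples r T" "g \<in> tuples r T" "occ r f = occ r g" by auto
      have "g i \<in> f ` {..<r}" if "i < r" for i
      proof -
        have "occ r g (g i) > 0" using that by (auto simp: occ_def card_gt_0_iff)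
        then have "occ r f (g i) > 0" using z by simp
        then have "{i' \<in> {..<r}. f i' = g i} \<noteq> {}" by (auto simp: occ_def card_gt_0_iff)
        then show ?thesis by (metis (mono_tags, lifting) Collect_empty_eq imageI)
      qed
      then show "z \<in> Sigma (tuples r T) (\<lambda>f. {..<r} \<rightarrow>\<^sub>E f ` {..<r})"
        using z by (auto simp: tuples_def PiE_iff)
    qed
  qed
  also have "\<dots> = (\<Sum>f\<in>tuples r T. card (f ` {..<r}) ^ r)"
    by (subst card_SigmaI) (auto simp: card_PiE intro: finite_PiE)
  also have "\<dots> \<le> (\<Sum>f\<in>tuples r T. r ^ r)"
    by (intro sum_mono power_mono) (use card_image_le[of "{..<r}"] in auto)
  also have "\<dots> = T ^ r * r ^ r" by (simp add: tuples_def card_PiE)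
  finally show ?thesis .
qed

text \<open>Collecting equal shifts turns the congruence into a relation of the form sum of c_t / (w
  + t) = 0. If the tuples are not rearrangements, some c_t is nonzero modulo q, and clearing
  denominators leaves a polynomial in \<open>w\<close> that does not vanish identically.\<close>

lemma card_rational_roots_le:
  fixes q r T :: nat
  assumes q: "prime q" and r: "r < q" and T: "T \<le> q"
    and f: "f \<in> tuples r T" and g: "g \<in> tuples r T" and ne: "occ r f \<noteq> occ r g"
  shows "card {w \<in> {..<q}. (\<forall>t<T. coprime (int w + int t) (int q)) \<and>
      [(\<Sum>i<r. shrcp q w (f i)) = (\<Sum>i<r. shrcp q w (g i))] (mod int q)} \<le> 2 * r"
    (is "card ?W \<le> _")
proof -
  define S where "S = f ` {..<r} \<union> g ` {..<r}"
  have finS: "finite S" by (simp add: S_def)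
  have cardS: "card S \<le> 2 * r"
    using card_Un_le[of "f ` {..<r}" "g ` {..<r}"] card_image_le[of "{..<r}" f] card_image_le[of "{..<r}" g]
    by (simp add: S_def)
  have ST: "t < T" if "t \<in> S" for t using that f g by (auto simp: S_def tuples_def PiE_iff)
  define c where "c = (\<lambda>t. int (occ r f t) - int (occ r g t))"
  obtain t0 where t0: "occ r f t0 \<noteq> occ r g t0" using ne by blast
  have t0S: "t0 \<in> S"
  proof (rule ccontr)
    assume "t0 \<notin> S"
    then have "{i \<in> {..<r}. f i = t0} = {}" "{i \<in> {..<r}. g i = t0} = {}" by (auto simp: S_def)
    then have "occ r f t0 = 0" "occ r g t0 = 0" unfolding occ_def by (metis card.empty)+
    then show False using t0 by simp
  qed
  define p where "p = (\<Sum>t\<in>S. Polynomial.smult (c t) (\<Prod>s\<in>S - {t}. [:int s, 1:]))"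
  have poly_p: "poly p x = (\<Sum>t\<in>S. c t * (\<Prod>s\<in>S - {t}. int s + x))" for x
    by (simp add: p_def poly_sum poly_prod)
  have "degree p \<le> card S"
    unfolding p_def
  proof (intro degree_sum_le finS)
    fix t assume "t \<in> S"
    have "degree (Polynomial.smult (c t) (\<Prod>s\<in>S - {t}. [:int s, 1:])) \<le> degree (\<Prod>s\<in>S - {t}. [:int s, 1:])"
      by (rule degree_smult_le)
    also have "\<dots> \<le> (\<Sum>s\<in>S - {t}. degree [:int s, 1:])" using finS by (intro degree_prod_sum_le[unfolded o_def]) auto
    also have "\<dots> \<le> card S" using finS by (simp add: card_Diff1_le)
    finally show "degree (Polynomial.smult (c t) (\<Prod>s\<in>S - {t}. [:int s, 1:])) \<le> card S" .
  qed
  then have deg: "degree p \<le> 2 * r" using cardS by simp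
  \<comment> \<open>At w = -t0 only the term of t0 survives. Its factors are nonzero modulo q
    because |c_t0| \<le> r < q and distinct shifts differ by less than T \<le> q.\<close>
  have "\<not> int q dvd poly p (- int t0)"
  proof
    assume d: "int q dvd poly p (- int t0)"
    have "poly p (- int t0) = c t0 * (\<Prod>s\<in>S - {t0}. int s - int t0)"
    proof -
      have "(\<Prod>s\<in>S - {t}. int s + - int t0) = 0" if "t \<in> S - {t0}" for t
        using that t0S finS by (intro prod_zero) auto
      then have "(\<Sum>t\<in>S - {t0}. c t * (\<Prod>s\<in>S - {t}. int s + - int t0)) = 0"
        by (intro sum.neutral) auto
      then show ?thesis unfolding poly_p using finS t0S by (subst sum.remove[of S t0]) auto
    qed
    then have "int q dvd c t0 \<or> (\<exists>s\<in>S - {t0}. int q dvd int s - int t0)"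
      using d q finS by (auto simp: prime_dvd_mult_iff prime_dvd_prod_iff)
    moreover have "\<not> int q dvd c t0"
    proof
      assume d: "int q dvd c t0"
      have "occ r f t0 \<le> r" "occ r g t0 \<le> r"
        unfolding occ_def using card_mono[of "{..<r}"] by (metis (no_types, lifting) card_lessThan finite_lessThan mem_Collect_eq subsetI)+
      then have "\<bar>c t0\<bar> < int q" using r by (simp add: c_def abs_less_iff)
      moreover have "c t0 \<noteq> 0" using t0 by (simp add: c_def)
      ultimately show False using dvd_imp_le_int[OF _ d] by simp
    qed
    moreover have "\<not> int q dvd int s - int t0" if "s \<in> S - {t0}" for s
    proof
      assume d: "int q dvd int s - int t0"
      have "\<bar>int s - int t0\<bar> < int q" using ST[of s] ST[OF t0S] that T by auto
      moreover have "int s - int t0 \<noteq> 0" using that by simp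
      ultimately show False using dvd_imp_le_int[OF _ d] by simp
    qed
    ultimately show False by blast
  qed
  then have card_p: "card {w \<in> {..<q}. int q dvd poly p (int w)} \<le> 2 * r"
    using card_poly_roots_mod_le[OF q] deg order_trans by blast
  have "?W \<subseteq> {w \<in> {..<q}. int q dvd poly p (int w)}"
  proof (rule subsetI)
    fix w assume w: "w \<in> ?W"
    define v where "v = (\<lambda>t. shrcp q w t)"
    have inv: "[(int w + int t) * v t = 1] (mod int q)" if "t < T" for t
      unfolding v_def using w that by (intro modinv_cong) auto
    have group: "(\<Sum>i<r. v (h i)) = (\<Sum>t\<in>S. int (occ r h t) * v t)" if "h ` {..<r} \<subseteq> S" for h
    proof -
      have "(\<Sum>i<r. v (h i)) = (\<Sum>t\<in>S. \<Sum>i\<in>{i \<in> {..<r}. h i = t}. v (h i))"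
        using that finS by (intro sum.group[symmetric]) auto
      also have "\<dots> = (\<Sum>t\<in>S. int (occ r h t) * v t)" by (intro sum.cong) (auto simp: occ_def)
      finally show ?thesis .
    qed
    have "[(\<Sum>i<r. v (f i)) = (\<Sum>i<r. v (g i))] (mod int q)" using w by (simp add: v_def)
    then have "int q dvd (\<Sum>t\<in>S. int (occ r f t) * v t) - (\<Sum>t\<in>S. int (occ r g t) * v t)"
      by (simp add: group S_def cong_iff_dvd_diff)
    also have "(\<Sum>t\<in>S. int (occ r f t) * v t) - (\<Sum>t\<in>S. int (occ r g t) * v t) = (\<Sum>t\<in>S. c t * v t)"
      by (simp add: c_def left_diff_distrib sum_subtractf)
    finally have z: "[(\<Prod>s\<in>S. int s + int w) * (\<Sum>t\<in>S. c t * v t) = 0] (mod int q)"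
      by (simp add: cong_0_iff)
    have e: "(\<Prod>s\<in>S. int s + int w) * (\<Sum>t\<in>S. c t * v t)
        = (\<Sum>t\<in>S. c t * (\<Prod>s\<in>S - {t}. int s + int w) * ((int w + int t) * v t))"
      unfolding sum_distrib_left
    proof (intro sum.cong refl)
      fix t assume "t \<in> S"
      then have "(\<Prod>s\<in>S. int s + int w) = (int t + int w) * (\<Prod>s\<in>S - {t}. int s + int w)"
        using finS by (intro prod.remove)
      then show "(\<Prod>s\<in>S. int s + int w) * (c t * v t) = c t * (\<Prod>s\<in>S - {t}. int s + int w) * ((int w + int t) * v t)"
        by (simp only: mult_ac add.commute)
    qed
    have "[(\<Sum>t\<in>S. c t * (\<Prod>s\<in>S - {t}. int s + int w) * ((int w + int t) * v t))
        = (\<Sum>t\<in>S. c t * (\<Prod>s\<in>S - {t}. int s + int w) * 1)] (mod int q)"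
      using ST by (intro cong_sum cong_scalar_left inv) auto
    from cong_trans[OF cong_sym[OF this] z[unfolded e]]
    have "[poly p (int w) = 0] (mod int q)" unfolding poly_p mult_1_right .
    then show "w \<in> {w \<in> {..<q}. int q dvd poly p (int w)}" using w by (simp add: cong_0_iff)
  qed
  then have "card ?W \<le> card {w \<in> {..<q}. int q dvd poly p (int w)}" by (intro card_mono) auto
  then show ?thesis using card_p by simp
qed

text \<open>Interchange the order: a pair of rearrangements counts for all of \<open>P\<close>.
  Every other pair admits at most 2r residues, each taken by at most \<open>D\<close> elements of
  \<open>P\<close>.\<close>

lemma sum_Jcount_le:
  fixes q r T D :: nat and P :: "'a set" and w :: "'a \<Rightarrow> nat"
  assumes q: "prime q" and r: "r < q" and T: "T \<le> q" and P: "finite P"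
    and w: "\<And>p. p \<in> P \<Longrightarrow> w p < q" "\<And>p t. p \<in> P \<Longrightarrow> t < T \<Longrightarrow> coprime (int (w p) + int t) (int q)"
    and D: "\<And>v. card {p \<in> P. w p = v} \<le> D"
  shows "(\<Sum>p\<in>P. Jcount q r (\<lambda>t. shrcp q (w p) t) T)
     \<le> card P * (T ^ r * r ^ r) + 2 * r * D * T ^ (2 * r)"
proof -
  let ?X = "tuples r T \<times> tuples r T"
  let ?R = "\<lambda>w f g. [(\<Sum>i<r. shrcp q w (f i)) = (\<Sum>i<r. shrcp q w (g i))] (mod int q)"
  let ?Z = "{(f, g) \<in> ?X. occ r f = occ r g}"
  have fX: "finite ?X" by simp
  have "(\<Sum>p\<in>P. Jcount q r (\<lambda>t. shrcp q (w p) t) T)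
      = card (Sigma P (\<lambda>p. {(f, g) \<in> ?X. ?R (w p) f g}))"
    using P by (subst card_SigmaI) (auto simp: Jcount_def intro!: finite_subset[OF _ fX])
  also have "\<dots> = card (Sigma ?X (\<lambda>(f, g). {p \<in> P. ?R (w p) f g}))"
    by (rule bij_betw_same_card[of "\<lambda>(p, z). (z, p)"]) (auto simp: bij_betw_def inj_on_def image_iff)
  also have "\<dots> = (\<Sum>(f, g)\<in>?X. card {p \<in> P. ?R (w p) f g})"
    using P by (subst card_SigmaI) (auto simp: case_prod_beta)
  also have "\<dots> \<le> (\<Sum>z\<in>?X. (if z \<in> ?Z then card P else 0) + 2 * r * D)"
  proof (rule sum_mono)
    fix z assume "z \<in> ?X"
    then obtain f g where z: "z = (f, g)" "f \<in> tuples r T" "g \<in> tuples r T" by auto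
    show "(case z of (f, g) \<Rightarrow> card {p \<in> P. ?R (w p) f g}) \<le> (if z \<in> ?Z then card P else 0) + 2 * r * D"
    proof (cases "occ r f = occ r g")
      case True
      have "card {p \<in> P. ?R (w p) f g} \<le> card P" using P by (intro card_mono) auto
      then show ?thesis using True z by simp
    next
      case False
      define V where "V = {v \<in> {..<q}. (\<forall>t<T. coprime (int v + int t) (int q)) \<and> ?R v f g}"
      have V: "card V \<le> 2 * r" unfolding V_def by (rule card_rational_roots_le[OF q r T z(2,3) False])
      have "{p \<in> P. ?R (w p) f g} \<subseteq> (\<Union>v\<in>V. {p \<in> P. w p = v})" using w by (auto simp: V_def)
      then have "card {p \<in> P. ?R (w p) f g} \<le> card (\<Union>v\<in>V. {p \<in> P. w p = v})"
        using P by (intro card_mono) (auto simp: V_def)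
      also have "\<dots> \<le> (\<Sum>v\<in>V. card {p \<in> P. w p = v})" by (rule card_UN_le) (simp add: V_def)
      also have "\<dots> \<le> (\<Sum>v\<in>V. D)" by (intro sum_mono D)
      also have "\<dots> \<le> 2 * r * D" using V by simp
      finally show ?thesis using False z by simp
    qed
  qed
  also have "\<dots> = card ?Z * card P + card ?X * (2 * r * D)"
  proof -
    have "(\<Sum>z\<in>?X. (if z \<in> ?Z then card P else 0)) = (\<Sum>z\<in>?Z. card P)"
      using fX by (intro sum.mono_neutral_cong_right fX) auto
    then show ?thesis by (simp add: sum.distrib)
  qed
  also have "\<dots> \<le> (T ^ r * r ^ r) * card P + T ^ (2 * r) * (2 * r * D)"
  proof (intro add_mono mult_right_mono card_same_occ_le)
    show "card ?X \<le> T ^ (2 * r)"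
      by (simp add: card_cartesian_product tuples_def card_PiE mult_2 power_add)
  qed auto
  finally show ?thesis by (simp add: mult_ac)
qed

text \<open>Sum over all d > D the number of pairs with both entries divisible by d. As d \<le> U
  \<le> N, the rounding in the count of multiples in [N, 2N) only raises N/d to 3N/d.\<close>

lemma card_large_gcd_le:
  fixes N U D :: nat
  assumes "1 \<le> D" "U \<le> N" "1 \<le> N"
  shows "real (card {(n, u) \<in> {N..<2 * N} \<times> {1..U}. gcd n u > D}) \<le> 3 * real N * real U / real D"
proof -
  define X where "X = (\<lambda>d. {n \<in> {N..<2 * N}. d dvd n} \<times> {u \<in> {1..U}. d dvd u})"
  have Xb: "real (card (X d)) \<le> 3 * real N * real U * (1 / real (d - 1) - 1 / real d)" if d: "d \<in> {Suc D..U}" for d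
  proof -
    have d2: "2 \<le> d" "d \<le> N" using d assms by auto
    have inj: "inj_on (\<lambda>n. n div d) {n. d dvd n}" using d2 by (auto simp: inj_on_def elim!: dvdE)
    have 1: "real (card {n \<in> {N..<2 * N}. d dvd n}) \<le> 3 * real N / real d"
    proof -
      have "card {n \<in> {N..<2 * N}. d dvd n} \<le> card {N div d..2 * N div d}"
        by (rule card_inj_on_le[OF inj_on_subset[OF inj]]) (auto intro!: div_le_mono)
      also have "\<dots> = Suc (2 * N div d) - N div d" by simp
      finally have "real (card {n \<in> {N..<2 * N}. d dvd n}) \<le> real (2 * N div d) + 1 - real (N div d)"
        using div_le_mono[of N "2 * N" d] by linarith
      moreover have "real (2 * N div d) \<le> real (2 * N) / real d" by (rule of_nat_div_le_of_nat)
      moreover have "real N / real d - 1 \<le> real (N div d)"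
      proof -
        have "\<lfloor>real N / real d\<rfloor> = int (N div d)" by (rule floor_divide_of_nat_eq)
        then show ?thesis by linarith
      qed
      moreover have "1 \<le> real N / real d" using d2 by simp
      ultimately show ?thesis by (simp add: add_divide_distrib)
    qed
    have 2: "real (card {u \<in> {1..U}. d dvd u}) \<le> real U / real d"
    proof -
      have "card {u \<in> {1..U}. d dvd u} \<le> card {1..U div d}"
        using d2 by (intro card_inj_on_le[OF inj_on_subset[OF inj]])
          (auto intro!: div_le_mono simp: Suc_le_eq div_greater_zero_iff dest: dvd_imp_le)
      moreover have "real (U div d) \<le> real U / real d" by (rule of_nat_div_le_of_nat)
      ultimately show ?thesis by simp
    qed
    have "real (card (X d)) \<le> (3 * real N / real d) * (real U / real d)"
      unfolding X_def card_cartesian_product of_nat_mult using 1 2 by (intro mult_mono) auto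
    also have "\<dots> = 3 * real N * real U * (1 / (real d * real d))" by simp
    \<comment> \<open>Replacing 1/d^2 by 1/((d - 1) d) makes the sum over d > D telescope to at most
      1/D.\<close>
    also have "\<dots> \<le> 3 * real N * real U * (1 / real (d - 1) - 1 / real d)"
    proof (intro mult_left_mono)
      have "1 / real (d - 1) - 1 / real d = 1 / (real (d - 1) * real d)"
        using d2 by (simp add: field_simps of_nat_diff)
      moreover have "1 / (real d * real d) \<le> 1 / (real (d - 1) * real d)"
        using d2 by (intro divide_left_mono mult_right_mono mult_pos_pos) auto
      ultimately show "1 / (real d * real d) \<le> 1 / real (d - 1) - 1 / real d" by simp
    qed auto
    finally show ?thesis .
  qed
  have "card {(n, u) \<in> {N..<2 * N} \<times> {1..U}. gcd n u > D} \<le> card (\<Union>d\<in>{Suc D..U}. X d)"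
  proof (intro card_mono)
    show "{(n, u) \<in> {N..<2 * N} \<times> {1..U}. gcd n u > D} \<subseteq> (\<Union>d\<in>{Suc D..U}. X d)"
    proof (rule subsetI)
      fix z assume "z \<in> {(n, u) \<in> {N..<2 * N} \<times> {1..U}. gcd n u > D}"
      then obtain n u where z: "z = (n, u)" "n \<in> {N..<2 * N}" "u \<in> {1..U}" "gcd n u > D" by auto
      have "gcd n u \<le> u" using z by (intro dvd_imp_le) auto
      then show "z \<in> (\<Union>d\<in>{Suc D..U}. X d)" using z by (intro UN_I[of "gcd n u"]) (auto simp: X_def)
    qed
  qed (auto simp: X_def)
  also have "\<dots> \<le> (\<Sum>d\<in>{Suc D..U}. card (X d))" by (rule card_UN_le) auto
  finally have "real (card {(n, u) \<in> {N..<2 * N} \<times> {1..U}. gcd n u > D}) \<le> (\<Sum>d\<in>{Suc D..U}. real (card (X d)))"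
    by (simp flip: of_nat_sum)
  also have "\<dots> \<le> (\<Sum>d\<in>{Suc D..U}. 3 * real N * real U * (1 / real (d - 1) - 1 / real d))"
    by (intro sum_mono Xb)
  also have "\<dots> = 3 * real N * real U * (\<Sum>d\<in>{Suc D..U}. 1 / real (d - 1) - 1 / real d)"
    by (simp add: sum_distrib_left)
  also have "(\<Sum>d\<in>{Suc D..U}. 1 / real (d - 1) - 1 / real d) \<le> 1 / real D"
  proof -
    have "(\<Sum>d\<in>{Suc D..V}. 1 / real (d - 1) - 1 / real d) = 1 / real D - 1 / real V" if "D \<le> V" for V
      using that by (induction V rule: dec_induct) (auto simp: sum.atLeast_Suc_atMost_Suc_shift[symmetric])
    then show ?thesis by (cases "D \<le> U") auto
  qed
  finally show ?thesis by (simp add: mult_left_mono)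
qed

text \<open>The residue of n/u determines the rational number n/u, because cross products stay below
  q. A pair with a given reduced fraction is then determined by its gcd, which is at most
  \<open>D\<close>.\<close>

lemma progression_classes:
  fixes N U q D :: nat and w :: "nat \<times> nat \<Rightarrow> nat"
  assumes q: "prime q" and NU: "2 * N * U \<le> q"
    and P: "P \<subseteq> {(n, u) \<in> {N..<2 * N} \<times> {1..U}. gcd n u \<le> D}"
    and w: "\<And>n u. (n, u) \<in> P \<Longrightarrow> [int n = int u * int (w (n, u))] (mod int q)"
  shows "card {p \<in> P. w p = v} \<le> D"
proof -
  have "card {p \<in> P. w p = v} \<le> card {1..D}"
  proof (rule card_inj_on_le[where f = "\<lambda>(n, u). gcd n u"])
    show "(\<lambda>(n, u). gcd n u) ` {p \<in> P. w p = v} \<subseteq> {1..D}"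
      using P by (auto simp: Suc_le_eq)
    show "inj_on (\<lambda>(n, u). gcd n u) {p \<in> P. w p = v}"
    proof (rule inj_onI)
      fix p p' assume p: "p \<in> {p \<in> P. w p = v}" "p' \<in> {p \<in> P. w p = v}"
        and gcd: "(case p of (n, u) \<Rightarrow> gcd n u) = (case p' of (n, u) \<Rightarrow> gcd n u)"
      obtain n u n' u' where pp: "p = (n, u)" "p' = (n', u')" by (cases p; cases p') auto
      have nu: "N \<le> n" "n < 2 * N" "1 \<le> u" "u \<le> U" "N \<le> n'" "n' < 2 * N" "1 \<le> u'" "u' \<le> U"
        using p P pp by auto
      have c1: "[int n = int u * int v] (mod int q)" and c2: "[int n' = int u' * int v] (mod int q)"
        using p w[of n u] w[of n' u'] pp by auto
      have "[int n * int u' = int u * int v * int u'] (mod int q)" by (rule cong_scalar_right[OF c1])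
      moreover have "[int n' * int u = int u' * int v * int u] (mod int q)" by (rule cong_scalar_right[OF c2])
      moreover have "int u * int v * int u' = int u' * int v * int u" by (simp only: mult_ac)
      ultimately have "[int (n * u') = int (n' * u)] (mod int q)"
        by (metis cong_sym cong_trans of_nat_mult)
      then have "[n * u' = n' * u] (mod q)" by (simp only: cong_int_iff)
      moreover have "n * u' < q" "n' * u < q"
      proof -
        have "n * u' < 2 * N * U" "n' * u < 2 * N * U"
          using nu by (auto intro: mult_less_le_imp_less)
        then show "n * u' < q" "n' * u < q" using NU by auto
      qed
      ultimately have eq: "n * u' = n' * u" by (simp add: cong_def)
      have "gcd n u * u' = gcd (n * u') (u * u')" by (simp add: gcd_mult_distrib_nat mult.commute)
      also have "\<dots> = gcd (n' * u) (u' * u)" by (simp add: eq mult.commute)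
      also have "\<dots> = gcd n' u' * u" by (simp add: gcd_mult_distrib_nat mult.commute)
      finally have "u' = u" using gcd nu pp by simp
      then show "p = p'" using eq nu pp by simp
    qed
  qed auto
  then show ?thesis by simp
qed

subsection \<open>Shifting along progressions\<close>

text \<open>The truncation n + u T \<le> Y does not mention \<open>t\<close>, so the sum over
  \<open>t\<close> can later run over the whole of {..<T}.\<close>

lemma shift_single:
  fixes g :: "nat \<Rightarrow> complex"
  assumes Y: "Y < 2 * N" and g: "\<And>n. norm (g n) \<le> 1" and t: "t < T"
  shows "norm ((\<Sum>n\<in>{N..Y}. g n) - (\<Sum>n\<in>{n \<in> {N..<2 * N}. n + u * T \<le> Y}. g (n + u * t))) \<le> real (u * T)"
proof -
  define A where "A = {n \<in> {N..<2 * N}. n + u * T \<le> Y}"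
  define B where "B = (\<lambda>n. n + u * t) ` A"
  have ut: "u * t \<le> u * T" using t by simp
  have "(\<Sum>n\<in>A. g (n + u * t)) = (\<Sum>n\<in>B. g n)"
    unfolding B_def by (subst sum.reindex) (auto simp: inj_on_def)
  moreover have BY: "B \<subseteq> {N..Y}"
  proof -
    have "n + u * t \<le> Y" if "n + u * T \<le> Y" for n using ut that by linarith
    then show ?thesis by (auto simp: B_def A_def)
  qed
  ultimately have "(\<Sum>n\<in>{N..Y}. g n) - (\<Sum>n\<in>A. g (n + u * t)) = (\<Sum>n\<in>{N..Y} - B. g n)"
    by (simp add: sum_diff)
  then have "norm ((\<Sum>n\<in>{N..Y}. g n) - (\<Sum>n\<in>A. g (n + u * t))) \<le> (\<Sum>n\<in>{N..Y} - B. 1)"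
    by (simp only:) (intro sum_norm_le g)
  also have "\<dots> = real (card ({N..Y} - B))" by simp
  \<comment> \<open>The shifted set misses only the first u t and the last u T - u t positions,
    together u T of them.\<close>
  also have "card ({N..Y} - B) \<le> card ({N..<N + u * t} \<union> {Suc Y - (u * T - u * t)..Y})"
  proof (intro card_mono subsetI)
    fix y assume y: "y \<in> {N..Y} - B"
    show "y \<in> {N..<N + u * t} \<union> {Suc Y - (u * T - u * t)..Y}"
    proof (rule ccontr)
      assume "\<not> ?thesis"
      then have "N + u * t \<le> y" "y < Suc Y - (u * T - u * t)" using y by auto
      then have "y - u * t \<in> A" "y = y - u * t + u * t" using ut Y by (auto simp: A_def)
      then have "y \<in> B" unfolding B_def by blast
      then show False using y by simp
    qed
  qed auto
  also have "\<dots> \<le> card {N..<N + u * t} + card {Suc Y - (u * T - u * t)..Y}" by (rule card_Un_le)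
  also have "\<dots> \<le> u * T"
  proof -
    define k where "k = u * T - u * t"
    have "u * t + k = u * T" using ut by (simp add: k_def)
    then show ?thesis unfolding k_def[symmetric] by simp
  qed
  finally show ?thesis by (simp add: A_def)
qed

text \<open>Average over all U T shifts. After interchanging the sums, the cutoff for fixed (n, u)
  becomes a restriction on \<open>m\<close>, and the inner sum over \<open>t\<close> is
  complete.\<close>

lemma shifted_sum_le:
  fixes g :: "nat \<Rightarrow> nat \<Rightarrow> complex" and \<gamma> :: "nat \<Rightarrow> real" and Y :: "nat \<Rightarrow> nat"
  assumes A: "finite A" and Y: "\<And>m. m \<in> A \<Longrightarrow> Y m < 2 * N" and g: "\<And>m n. norm (g m n) \<le> 1"
    and \<gamma>: "\<And>m. m \<in> A \<Longrightarrow> 0 \<le> \<gamma> m" and T: "1 \<le> T" and U: "1 \<le> U"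
  shows "norm (\<Sum>m\<in>A. of_real (\<gamma> m) * (\<Sum>n\<in>{N..Y m}. g m n)) \<le> (\<Sum>m\<in>A. \<gamma> m) * (real U * real T)
     + (\<Sum>(n, u)\<in>{N..<2 * N} \<times> {1..U}. norm (\<Sum>m\<in>{m \<in> A. n + u * T \<le> Y m}. of_real (\<gamma> m) * (\<Sum>t<T. g m (n + u * t)))) / (real U * real T)"
proof -
  let ?S = "\<lambda>m. \<Sum>n\<in>{N..Y m}. g m n"
  let ?I = "{1..U} \<times> {..<T}"
  let ?h = "\<lambda>m u t. \<Sum>n\<in>{n \<in> {N..<2 * N}. n + u * T \<le> Y m}. g m (n + u * t)"
  let ?D = "\<lambda>n u. \<Sum>m\<in>{m \<in> A. n + u * T \<le> Y m}. of_real (\<gamma> m) * (\<Sum>t<T. g m (n + u * t))"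
  have UT: "real U * real T > 0" using T U by simp
  have "norm (of_real (real U * real T) * (\<Sum>m\<in>A. of_real (\<gamma> m) * ?S m) - (\<Sum>m\<in>A. of_real (\<gamma> m) * (\<Sum>(u, t)\<in>?I. ?h m u t)))
     = norm (\<Sum>m\<in>A. of_real (\<gamma> m) * (\<Sum>(u, t)\<in>?I. ?S m - ?h m u t))"
  proof -
    have "(\<Sum>(u, t)\<in>?I. ?S m - ?h m u t) = of_real (real U * real T) * ?S m - (\<Sum>(u, t)\<in>?I. ?h m u t)" for m
      by (simp add: case_prod_beta sum_subtractf card_cartesian_product)
    then show ?thesis by (simp add: right_diff_distrib sum_subtractf sum_distrib_left mult_ac)
  qed
  also have "\<dots> \<le> (\<Sum>m\<in>A. \<gamma> m * (real U * real T * (real U * real T)))"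
  proof (rule sum_norm_le)
    fix m assume m: "m \<in> A"
    have "norm (\<Sum>(u, t)\<in>?I. ?S m - ?h m u t) \<le> (\<Sum>(u, t)\<in>?I. real U * real T)"
    proof (rule sum_norm_le)
      fix z assume "z \<in> ?I"
      then obtain u t where z: "z = (u, t)" "u \<le> U" "t < T" by auto
      have "norm (?S m - ?h m u t) \<le> real (u * T)" by (rule shift_single[OF Y[OF m] g z(3)])
      also have "\<dots> \<le> real U * real T" using z by (simp add: mult_right_mono)
      finally show "norm (case z of (u, t) \<Rightarrow> ?S m - ?h m u t) \<le> (case z of (u, t) \<Rightarrow> real U * real T)"
        by (simp add: z)
    qed
    also have "\<dots> = real U * real T * (real U * real T)" by (simp add: card_cartesian_product)
    finally show "norm (of_real (\<gamma> m) * (\<Sum>(u, t)\<in>?I. ?S m - ?h m u t)) \<le> \<gamma> m * (real U * real T * (real U * real T))"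
      unfolding norm_mult using \<gamma>[OF m] by (simp add: mult_left_mono)
  qed
  also have "\<dots> = (\<Sum>m\<in>A. \<gamma> m) * (real U * real T * (real U * real T))" by (simp only: sum_distrib_right)
  finally have 1: "norm (of_real (real U * real T) * (\<Sum>m\<in>A. of_real (\<gamma> m) * ?S m) - (\<Sum>m\<in>A. of_real (\<gamma> m) * (\<Sum>(u, t)\<in>?I. ?h m u t)))
      \<le> (\<Sum>m\<in>A. \<gamma> m) * (real U * real T * (real U * real T))" .
  have 2: "(\<Sum>m\<in>A. of_real (\<gamma> m) * (\<Sum>(u, t)\<in>?I. ?h m u t)) = (\<Sum>(n, u)\<in>{N..<2 * N} \<times> {1..U}. ?D n u)"
  proof -
    have h: "(\<Sum>(u, t)\<in>?I. ?h m u t) = (\<Sum>n\<in>{N..<2 * N}. \<Sum>u\<in>{1..U}. if n + u * T \<le> Y m then (\<Sum>t<T. g m (n + u * t)) else 0)" for m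
    proof -
      have "(\<Sum>(u, t)\<in>?I. ?h m u t) = (\<Sum>u\<in>{1..U}. \<Sum>t<T. ?h m u t)" by (rule sum.cartesian_product[symmetric])
      also have "\<dots> = (\<Sum>u\<in>{1..U}. \<Sum>n\<in>{n \<in> {N..<2 * N}. n + u * T \<le> Y m}. \<Sum>t<T. g m (n + u * t))"
        by (intro sum.cong refl sum.swap)
      also have "\<dots> = (\<Sum>u\<in>{1..U}. \<Sum>n\<in>{N..<2 * N}. if n + u * T \<le> Y m then (\<Sum>t<T. g m (n + u * t)) else 0)"
        by (intro sum.cong refl sum.inter_filter) simp
      also have "\<dots> = (\<Sum>n\<in>{N..<2 * N}. \<Sum>u\<in>{1..U}. if n + u * T \<le> Y m then (\<Sum>t<T. g m (n + u * t)) else 0)"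
        by (rule sum.swap)
      finally show ?thesis .
    qed
    have "(\<Sum>m\<in>A. of_real (\<gamma> m) * (\<Sum>(u, t)\<in>?I. ?h m u t))
       = (\<Sum>m\<in>A. \<Sum>n\<in>{N..<2 * N}. \<Sum>u\<in>{1..U}. if n + u * T \<le> Y m then of_real (\<gamma> m) * (\<Sum>t<T. g m (n + u * t)) else 0)"
      unfolding h sum_distrib_left by (intro sum.cong refl) (simp add: sum_distrib_left)
    also have "\<dots> = (\<Sum>n\<in>{N..<2 * N}. \<Sum>m\<in>A. \<Sum>u\<in>{1..U}. if n + u * T \<le> Y m then of_real (\<gamma> m) * (\<Sum>t<T. g m (n + u * t)) else 0)"
      by (rule sum.swap)
    also have "\<dots> = (\<Sum>n\<in>{N..<2 * N}. \<Sum>u\<in>{1..U}. \<Sum>m\<in>A. if n + u * T \<le> Y m then of_real (\<gamma> m) * (\<Sum>t<T. g m (n + u * t)) else 0)"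
      by (intro sum.cong refl sum.swap)
    also have "\<dots> = (\<Sum>n\<in>{N..<2 * N}. \<Sum>u\<in>{1..U}. ?D n u)"
      using A by (intro sum.cong refl sum.inter_filter[symmetric])
    finally show ?thesis by (simp add: sum.cartesian_product)
  qed
  have "real U * real T * norm (\<Sum>m\<in>A. of_real (\<gamma> m) * ?S m) = norm (of_real (real U * real T) * (\<Sum>m\<in>A. of_real (\<gamma> m) * ?S m))"
    using UT by (simp add: norm_mult)
  also have "\<dots> \<le> norm (\<Sum>(n, u)\<in>{N..<2 * N} \<times> {1..U}. ?D n u)
      + norm (of_real (real U * real T) * (\<Sum>m\<in>A. of_real (\<gamma> m) * ?S m) - (\<Sum>(n, u)\<in>{N..<2 * N} \<times> {1..U}. ?D n u))"
    by (rule norm_triangle_sub)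
  also have "\<dots> \<le> norm (\<Sum>(n, u)\<in>{N..<2 * N} \<times> {1..U}. ?D n u) + (\<Sum>m\<in>A. \<gamma> m) * (real U * real T * (real U * real T))"
    using 1 unfolding 2 by (rule add_left_mono)
  also have "\<dots> \<le> (\<Sum>(n, u)\<in>{N..<2 * N} \<times> {1..U}. norm (?D n u)) + (\<Sum>m\<in>A. \<gamma> m) * (real U * real T * (real U * real T))"
    by (intro add_right_mono sum_norm_le) auto
  finally have fin: "real U * real T * norm (\<Sum>m\<in>A. of_real (\<gamma> m) * ?S m)
      \<le> (\<Sum>(n, u)\<in>{N..<2 * N} \<times> {1..U}. norm (?D n u)) + (\<Sum>m\<in>A. \<gamma> m) * (real U * real T * (real U * real T))" .
  have "X \<le> G * C + S / C" if "C * X \<le> S + G * (C * C)" "C > 0" for X G C S :: real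
    using that by (simp add: field_simps)
  from this[OF fin UT] show ?thesis .
qed

subsection \<open>Averaging over shifts\<close>

text \<open>Concavity of the root, obtained from the power mean; \<open>W\<close> again need only
  bound the number of terms.\<close>

lemma sum_root_le:
  fixes a :: "'a \<Rightarrow> real"
  assumes "finite P" "\<And>p. p \<in> P \<Longrightarrow> 0 \<le> a p" "n \<ge> 1" "real (card P) \<le> W" "W > 0"
  shows "(\<Sum>p\<in>P. root n (a p)) \<le> W * root n ((\<Sum>p\<in>P. a p) / W)"
proof -
  let ?X = "\<Sum>p\<in>P. root n (a p)"
  have X0: "?X \<ge> 0" using assms by (intro sum_nonneg) auto
  have "?X ^ n \<le> W ^ (n - 1) * (\<Sum>p\<in>P. root n (a p) ^ n)"
    using assms by (intro power_mean_unweighted) auto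
  also have "(\<Sum>p\<in>P. root n (a p) ^ n) = (\<Sum>p\<in>P. a p)"
    using assms by (intro sum.cong refl real_root_pow_pos2) auto
  also have "W ^ (n - 1) * (\<Sum>p\<in>P. a p) = W ^ n * ((\<Sum>p\<in>P. a p) / W)"
    using assms(3,5) by (cases n) auto
  finally have le: "?X ^ n \<le> W ^ n * ((\<Sum>p\<in>P. a p) / W)" .
  have "?X = root n (?X ^ n)" using X0 assms(3) by (simp add: real_root_power_cancel)
  also have "\<dots> \<le> root n (W ^ n * ((\<Sum>p\<in>P. a p) / W))"
    using assms(3) le by (intro real_root_le_mono) auto
  also have "\<dots> = W * root n ((\<Sum>p\<in>P. a p) / W)"
    unfolding real_root_mult using assms(3,5) by (simp add: real_root_power_cancel)
  finally show ?thesis .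
qed

lemma coprime_int_prime_less:
  assumes "prime q" "0 < n" "n < q"
  shows "coprime (int n) (int q)"
proof -
  have "\<not> q dvd n" using assms by (auto dest: dvd_imp_le)
  then have "coprime q n" using assms(1) by (intro prime_imp_coprime)
  then show ?thesis by (simp add: coprime_commute)
qed

text \<open>The reciprocal of m n is written as the product of two reciprocals, so that for fixed
  \<open>n\<close> the phase is linear in the reciprocal of \<open>m\<close>. Both forms agree when
  m and n are prime to q.\<close>

definition kloo :: "nat \<Rightarrow> int \<Rightarrow> int \<Rightarrow> nat \<Rightarrow> nat \<Rightarrow> complex" where
  "kloo q a b m n = eq (int q) (a * rcp q m * rcp q n + b * int m * int n)"

abbreviation bisum :: "nat \<Rightarrow> int \<Rightarrow> int \<Rightarrow> nat \<Rightarrow> nat \<Rightarrow> (nat \<Rightarrow> real) \<Rightarrow> (nat \<Rightarrow> nat) \<Rightarrow> complex" where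
  "bisum q a b R N \<gamma> Y \<equiv> \<Sum>m\<in>{1..R}. of_real (\<gamma> m) * (\<Sum>n\<in>{N..Y m}. kloo q a b m n)"

lemma norm_kloo [simp]: "norm (kloo q a b m n) = 1"
  by (simp add: kloo_def)

lemma sum_kloo_progression:
  assumes "q > 0"
  shows "(\<Sum>t<T. kloo q a b m (n + u * t)) = eq (int q) (b * int m * int n)
     * twisted q T (\<lambda>t. rcp q (n + u * t)) (a * rcp q m) (real_of_int (b * int m * int u) / real q)"
proof -
  have "kloo q a b m (n + u * t) = eq (int q) (b * int m * int n)
     * (eq (int q) (a * rcp q m * rcp q (n + u * t)) * E (real_of_int (b * int m * int u) / real q * real t))" for t
  proof -
    have "E (real_of_int (b * int m * int u) / real q * real t) = eq (int q) (b * int m * int u * int t)"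
      by (simp add: eq_conv_E)
    moreover have "a * rcp q m * rcp q (n + u * t) + b * int m * int (n + u * t)
       = b * int m * int n + (a * rcp q m * rcp q (n + u * t) + b * int m * int u * int t)"
      by (simp add: algebra_simps)
    ultimately show ?thesis unfolding kloo_def by (simp only: eq_add)
  qed
  then show ?thesis by (simp only: twisted_def sum_distrib_left)
qed

text \<open>\<open>X\<close> collects exceptional pairs that are bounded trivially, so the average
  of the counts \<open>J\<close> runs only over well-behaved progressions. The energy factor does
  not depend on (n, u) and stays outside that average.\<close>

lemma bilinear_average_le:
  fixes q N R T U L r :: nat and a b :: int and \<gamma> :: "nat \<Rightarrow> real" and G :: real and Y :: "nat \<Rightarrow> nat"
    and X :: "(nat \<times> nat) set"
  defines "P \<equiv> {(n, u) \<in> {N..<2 * N} \<times> {1..U}. n + u * T < 2 * N \<and> n + u * T < q} - X"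
    and "J \<equiv> \<lambda>n u. Jcount q r (\<lambda>t. rcp q (n + u * t)) T"
  assumes q: "q > 0" and R: "R \<ge> 1" and N: "N \<ge> 1"
    and Y: "\<And>m. Y m < 2 * N" "\<And>m. Y m < q"
    and \<gamma>: "\<And>m. 0 \<le> \<gamma> m" "\<And>m. \<gamma> m \<le> G"
    and TU: "T \<ge> 1" "U \<ge> 1" "L \<ge> 1" "r \<ge> 1"
    and X: "X \<subseteq> {N..<2 * N} \<times> {1..U}"
  shows "norm (bisum q a b R N \<gamma> Y) \<le>
     G * real R * (real U * real T + real (card X) / real U + real N * sqrt (2 * pi * real T / real L)
       + real N * root (4 * r) (real (energy q {1..R} (\<lambda>m. a * rcp q m)) / real R ^ 4 * (real L * real q)
            * ((\<Sum>(n, u)\<in>P. real (J n u)) / (real N * real U * real T ^ (2 * r)))))"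
proof -
  let ?En = "real (energy q {1..R} (\<lambda>m. a * rcp q m))"
  define V where "V = ?En / real R ^ 4 * (real L * real q)"
  define s where "s = sqrt (2 * pi * real T / real L)"
  define M where "M = (\<lambda>n u. {m \<in> {1..R}. n + u * T \<le> Y m})"
  define D where "D = (\<lambda>n u. \<Sum>m\<in>M n u. of_real (\<gamma> m) * (\<Sum>t<T. kloo q a b m (n + u * t)))"
  let ?All = "{N..<2 * N} \<times> {1..U}"
  have G0: "G \<ge> 0" using \<gamma>[of 0] by simp
  have UT: "real U > 0" "real T > 0" "real N > 0" "real R > 0" using TU N R by auto
  have V0: "V \<ge> 0" by (simp add: V_def)
  have s0: "s \<ge> 0" by (simp add: s_def)
  have finX: "finite X" using X by (rule finite_subset) auto
  have finP: "finite P" unfolding P_def by (rule finite_Diff) (auto intro: finite_subset[where B = ?All])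
  have cardM: "real (card (M n u)) \<le> real R" for n u
  proof -
    have "card (M n u) \<le> card {1..R}" by (intro card_mono) (auto simp: M_def)
    then show ?thesis by simp
  qed
  have sum\<gamma>: "(\<Sum>m\<in>{1..R}. \<gamma> m) \<le> G * real R"
    using sum_mono[of "{1..R}" \<gamma> "\<lambda>_. G"] \<gamma>(2) by (simp add: mult.commute)
  have trivD: "norm (D n u) \<le> G * real R * real T" for n u
  proof -
    have "norm (D n u) \<le> (\<Sum>m\<in>M n u. G * real T)"
      unfolding D_def
    proof (rule sum_norm_le)
      fix m
      have "norm (\<Sum>t<T. kloo q a b m (n + u * t)) \<le> (\<Sum>t<T. 1)" by (rule sum_norm_le) simp
      then show "norm (of_real (\<gamma> m) * (\<Sum>t<T. kloo q a b m (n + u * t))) \<le> G * real T"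
        unfolding norm_mult using \<gamma>[of m] by (intro mult_mono) auto
    qed
    also have "\<dots> = real (card (M n u)) * (G * real T)" by simp
    also have "\<dots> \<le> real R * (G * real T)" using cardM G0 by (intro mult_right_mono) auto
    finally show ?thesis by (simp add: mult_ac)
  qed
  \<comment> \<open>Every \<open>Y m\<close> is below both 2N and q, so for these pairs no
    \<open>m\<close> meets the cutoff.\<close>
  have zeroD: "D n u = 0" if "(n, u) \<in> ?All - P - X" for n u
  proof -
    have "n + u * T \<ge> 2 * N \<or> n + u * T \<ge> q" using that by (auto simp: P_def)
    moreover have "n + u * T < 2 * N \<and> n + u * T < q" if "m \<in> M n u" for m
      using that Y[of m] by (auto simp: M_def)
    ultimately have "M n u = {}" by fastforce
    then show ?thesis by (simp add: D_def)
  qed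
  have goodD: "norm (D n u) \<le> G * real R * real T * (s + root (4 * r) (V * real (J n u) / real T ^ (2 * r)))" for n u
  proof -
    let ?l = "\<lambda>t. rcp q (n + u * t)"
    have eqD: "D n u = (\<Sum>m\<in>M n u. (of_real (\<gamma> m) * eq (int q) (b * int m * int n)) * twisted q T ?l (a * rcp q m) (real_of_int (b * int m * int u) / real q))"
      unfolding D_def sum_kloo_progression[OF q] by (simp only: mult.assoc)
    have "norm (D n u) \<le> G * real R * real T * (s + root (4 * r) (real (energy q (M n u) (\<lambda>m. a * rcp q m)) / real R ^ 4 * (real L * real q * real (Jcount q r ?l T)) / real T ^ (2 * r)))"
      unfolding s_def eqD
    proof (rule bilinear_le[OF q TU(3) TU(4) _ cardM UT(4) _ G0 TU(1)])
      show "norm (of_real (\<gamma> m) * eq (int q) (b * int m * int n)) \<le> G" for m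
        using \<gamma>[of m] by (simp add: norm_mult)
      show "finite (M n u)" by (simp add: M_def)
    qed
    also have "\<dots> \<le> G * real R * real T * (s + root (4 * r) (V * real (J n u) / real T ^ (2 * r)))"
    proof -
      \<comment> \<open>Passing to the full interval {1..R} removes the dependence of the energy on
        (n, u) and needs no structure of \<open>M n u\<close>.\<close>
      have "energy q (M n u) (\<lambda>m. a * rcp q m) \<le> energy q {1..R} (\<lambda>m. a * rcp q m)"
        by (rule energy_mono) (auto simp: M_def)
      then have e: "real (energy q (M n u) (\<lambda>m. a * rcp q m)) \<le> ?En" by (simp only: of_nat_le_iff)
      have "real (energy q (M n u) (\<lambda>m. a * rcp q m)) / real R ^ 4 * (real L * real q * real (J n u)) / real T ^ (2 * r)
         \<le> ?En / real R ^ 4 * (real L * real q * real (J n u)) / real T ^ (2 * r)"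
        by (intro divide_right_mono mult_right_mono e) simp_all
      also have "\<dots> = V * real (J n u) / real T ^ (2 * r)" by (simp only: V_def mult.assoc)
      finally have r: "root (4 * r) (real (energy q (M n u) (\<lambda>m. a * rcp q m)) / real R ^ 4 * (real L * real q * real (J n u)) / real T ^ (2 * r))
         \<le> root (4 * r) (V * real (J n u) / real T ^ (2 * r))"
        using TU by (intro real_root_le_mono) simp_all
      show ?thesis unfolding J_def
        by (intro mult_left_mono add_left_mono r[unfolded J_def]) (simp_all add: G0)
    qed
    finally show ?thesis .
  qed
  have "(\<Sum>(n, u)\<in>?All. norm (D n u)) = (\<Sum>(n, u)\<in>X \<union> P. norm (D n u))"
  proof (rule sum.mono_neutral_right)
    show "X \<union> P \<subseteq> ?All" using X by (auto simp: P_def)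
    show "\<forall>i\<in>?All - (X \<union> P). (case i of (n, u) \<Rightarrow> norm (D n u)) = 0"
    proof
      fix i assume "i \<in> ?All - (X \<union> P)"
      then have "(fst i, snd i) \<in> ?All - P - X" by simp
      from zeroD[OF this] show "(case i of (n, u) \<Rightarrow> norm (D n u)) = 0" by (simp add: case_prod_beta)
    qed
  qed simp
  also have "\<dots> \<le> (\<Sum>(n, u)\<in>X. norm (D n u)) + (\<Sum>(n, u)\<in>P. norm (D n u))"
    using finX finP by (subst sum.union_disjoint) (auto simp: P_def)
  also have "\<dots> \<le> (\<Sum>(n, u)\<in>X. G * real R * real T) + (\<Sum>(n, u)\<in>P. G * real R * real T * (s + root (4 * r) (V * real (J n u) / real T ^ (2 * r))))"
    using trivD goodD by (intro add_mono sum_mono) (auto simp: case_prod_beta)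
  also have "(\<Sum>(n, u)\<in>P. G * real R * real T * (s + root (4 * r) (V * real (J n u) / real T ^ (2 * r))))
      = G * real R * real T * (real (card P) * s + (\<Sum>p\<in>P. root (4 * r) (V * real (J (fst p) (snd p)) / real T ^ (2 * r))))"
    by (simp add: case_prod_beta sum.distrib sum_distrib_left distrib_left)
  also have "\<dots> \<le> G * real R * real T * ((real N * real U) * s + (real N * real U) * root (4 * r) ((\<Sum>p\<in>P. V * real (J (fst p) (snd p)) / real T ^ (2 * r)) / (real N * real U)))"
  proof -
    have "card P \<le> card ?All" by (intro card_mono) (auto simp: P_def)
    then have cP: "real (card P) \<le> real N * real U" by (simp add: card_cartesian_product flip: of_nat_mult)
    have "(\<Sum>p\<in>P. root (4 * r) (V * real (J (fst p) (snd p)) / real T ^ (2 * r)))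
       \<le> (real N * real U) * root (4 * r) ((\<Sum>p\<in>P. V * real (J (fst p) (snd p)) / real T ^ (2 * r)) / (real N * real U))"
      using finP V0 TU cP UT by (intro sum_root_le) auto
    then show ?thesis using cP G0 s0 by (intro mult_left_mono add_mono mult_right_mono) auto
  qed
  also have "(\<Sum>p\<in>P. V * real (J (fst p) (snd p)) / real T ^ (2 * r)) / (real N * real U)
      = V * ((\<Sum>(n, u)\<in>P. real (J n u)) / (real N * real U * real T ^ (2 * r)))"
    using UT by (simp add: case_prod_beta sum_distrib_left sum_divide_distrib mult_ac)
  finally have main: "(\<Sum>(n, u)\<in>?All. norm (D n u)) \<le> real (card X) * (G * real R * real T)
     + G * real R * real T * ((real N * real U) * s + (real N * real U) * root (4 * r) (V * ((\<Sum>(n, u)\<in>P. real (J n u)) / (real N * real U * real T ^ (2 * r)))))"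
    by (simp add: case_prod_beta)
  have "norm (bisum q a b R N \<gamma> Y)
     \<le> (\<Sum>m\<in>{1..R}. \<gamma> m) * (real U * real T) + (\<Sum>(n, u)\<in>?All. norm (D n u)) / (real U * real T)"
    unfolding D_def M_def using Y \<gamma> TU by (intro shifted_sum_le) auto
  also have "\<dots> \<le> (G * real R) * (real U * real T) + (real (card X) * (G * real R * real T)
     + G * real R * real T * ((real N * real U) * s + (real N * real U) * root (4 * r) (V * ((\<Sum>(n, u)\<in>P. real (J n u)) / (real N * real U * real T ^ (2 * r)))))) / (real U * real T)"
    using sum\<gamma> main UT by (intro add_mono mult_right_mono divide_right_mono) auto
  also have "\<dots> = G * real R * (real U * real T + real (card X) / real U + real N * s
       + real N * root (4 * r) (V * ((\<Sum>(n, u)\<in>P. real (J n u)) / (real N * real U * real T ^ (2 * r)))))"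
  proof -
    have "(g * \<rho>) * (u * t) + (x * (g * \<rho> * t) + g * \<rho> * t * ((m * u) * s + (m * u) * w)) / (u * t)
       = g * \<rho> * (u * t + x / u + m * s + m * w)" if "u > 0" "t > 0" for g \<rho> u t x m s w :: real
      using that by (simp add: field_simps)
    from this[OF UT(1,2)] show ?thesis .
  qed
  finally show ?thesis unfolding V_def s_def .
qed

subsection \<open>Rounding and powers of the modulus\<close>

lemma nat_ceiling_bounds:
  assumes "(x::real) \<ge> 1"
  shows "x \<le> real (nat \<lceil>x\<rceil>)" "real (nat \<lceil>x\<rceil>) \<le> 2 * x" "1 \<le> nat \<lceil>x\<rceil>"
proof -
  have c: "of_int \<lceil>x\<rceil> \<ge> x" "of_int \<lceil>x\<rceil> < x + 1" by linarith+
  have "\<lceil>x\<rceil> \<ge> 1" using assms by (simp add: le_ceiling_iff)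
  then have "real (nat \<lceil>x\<rceil>) = of_int \<lceil>x\<rceil>" by simp
  with c assms show "x \<le> real (nat \<lceil>x\<rceil>)" "real (nat \<lceil>x\<rceil>) \<le> 2 * x" by linarith+
  show "1 \<le> nat \<lceil>x\<rceil>" using \<open>\<lceil>x\<rceil> \<ge> 1\<close> by arith
qed

lemma nat_floor_bounds:
  assumes "(x::real) \<ge> 1"
  shows "x / 2 \<le> real (nat \<lfloor>x\<rfloor>)" "real (nat \<lfloor>x\<rfloor>) \<le> x" "1 \<le> nat \<lfloor>x\<rfloor>"
proof -
  have c: "of_int \<lfloor>x\<rfloor> \<le> x" "x < of_int \<lfloor>x\<rfloor> + 1" by linarith+
  have f1: "\<lfloor>x\<rfloor> \<ge> 1" using assms by simp
  then have e: "real (nat \<lfloor>x\<rfloor>) = of_int \<lfloor>x\<rfloor>" by simp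
  have "real_of_int \<lfloor>x\<rfloor> \<ge> 1" using f1 by linarith
  with c e show "x / 2 \<le> real (nat \<lfloor>x\<rfloor>)" "real (nat \<lfloor>x\<rfloor>) \<le> x" by linarith+
  show "1 \<le> nat \<lfloor>x\<rfloor>" using f1 by arith
qed

lemma root_powr:
  assumes "n \<ge> 1" "x > 0"
  shows "root n (x powr e) = x powr (e / real n)"
  using assms by (simp add: root_powr_inverse powr_powr)

lemma le_powr_root:
  fixes V x e f :: real
  assumes "n \<ge> 1" "x > 1" "V \<le> x powr e" "e / real n \<le> f"
  shows "root n V \<le> x powr f"
proof -
  have "root n V \<le> root n (x powr e)" using assms by (intro real_root_le_mono) auto
  also have "\<dots> = x powr (e / real n)" using assms by (intro root_powr) auto
  also have "\<dots> \<le> x powr f" using assms by (intro powr_mono) auto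
  finally show ?thesis .
qed

section \<open>Progressions as shifts of a single residue\<close>

lemma progression_residue:
  fixes q n u T :: nat
  defines "w \<equiv> nat ((int n * rcp q u) mod int q)"
  assumes q: "prime q" and u: "0 < u" "u < q" and n: "0 < n" "n + u * T < q"
  shows "w < q" "[int n = int u * int w] (mod int q)"
    "\<And>t. t < T \<Longrightarrow> coprime (int w + int t) (int q)"
    "\<And>t. t < T \<Longrightarrow> [rcp q (n + u * t) = rcp q u * shrcp q w t] (mod int q)"
proof -
  have q0: "q > 0" using q prime_gt_0_nat by simp
  show "w < q" using q0 by (simp add: w_def nat_less_iff)
  have iu: "[int u * rcp q u = 1] (mod int q)"
    by (rule modinv_cong[OF coprime_int_prime_less[OF q u]])
  have w: "[int w = int n * rcp q u] (mod int q)" using q0 by (simp add: w_def)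
  have "[int u * int w = int u * (int n * rcp q u)] (mod int q)" by (rule cong_scalar_left[OF w])
  also have "int u * (int n * rcp q u) = int n * (int u * rcp q u)" by (simp only: mult_ac)
  also have "[\<dots> = int n * 1] (mod int q)" by (rule cong_scalar_left[OF iu])
  finally show nuw: "[int n = int u * int w] (mod int q)" by (simp add: cong_sym)
  fix t assume t: "t < T"
  have "u * t \<le> u * T" using t by simp
  \<comment> \<open>As the whole progression stays strictly between 0 and q, none of its terms is
    divisible by q.\<close>
  then have nt: "0 < n + u * t" "n + u * t < q" using n by linarith+
  have e: "[int (n + u * t) = int u * (int w + int t)] (mod int q)"
    using cong_add[OF nuw cong_refl[of "int u * int t"]] by (simp add: distrib_left)
  have cop: "coprime (int (n + u * t)) (int q)" by (rule coprime_int_prime_less[OF q nt])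
  then have "coprime (int u * (int w + int t)) (int q)" using e cong_imp_coprime by blast
  then show copw: "coprime (int w + int t) (int q)" by simp
  let ?wt = "int w + int t"
  have "[int (n + u * t) * (rcp q u * modinv (int q) ?wt) = int u * ?wt * (rcp q u * modinv (int q) ?wt)] (mod int q)"
    by (rule cong_scalar_right[OF e])
  also have "int u * ?wt * (rcp q u * modinv (int q) ?wt) = (int u * rcp q u) * (?wt * modinv (int q) ?wt)"
    by (simp only: mult_ac)
  also have "[\<dots> = 1 * 1] (mod int q)" by (rule cong_mult[OF iu modinv_cong[OF copw]])
  finally have "[int (n + u * t) * (rcp q u * modinv (int q) ?wt) = int (n + u * t) * rcp q (n + u * t)] (mod int q)"
    using modinv_cong[OF cop] by (metis cong_sym cong_trans mult_1)
  then show "[rcp q (n + u * t) = rcp q u * modinv (int q) ?wt] (mod int q)"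
    using cop cong_mult_lcancel cong_sym by blast
qed

lemma coprime_modinv:
  assumes "coprime n q"
  shows "coprime (modinv q n) q"
proof -
  have "[n * modinv q n = 1] (mod q)" by (rule modinv_cong[OF assms])
  then have "coprime (n * modinv q n) q" by (metis cong_imp_coprime cong_sym coprime_1_left)
  then show ?thesis by simp
qed

subsection \<open>Long smooth variables\<close>

text \<open>The map \<open>(n, u) \<mapsto> (n u\<^sup>*, a u\<^sup>*)\<close> is injective modulo \<open>q\<close>, and there are more than
  \<open>q\<close> pairs; hence the sums over \<open>t\<close> are small on average.\<close>

lemma sum_peak_pairs_le:
  fixes q N U T L r :: nat and a :: int
  defines "w \<equiv> \<lambda>(n, u). nat ((int n * rcp q u) mod int q)"
    and "k \<equiv> \<lambda>(n::nat, u). nat ((a * rcp q u) mod int q)"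
  assumes q: "prime q" and a: "coprime a (int q)" and r: "1 \<le> r" "r < q" and T: "1 \<le> T" "T \<le> q" "q \<le> T ^ r"
    and L: "L \<ge> 1" and N: "N \<ge> 1" and U: "1 \<le> U" "U < q"
    and P: "P \<subseteq> {(n, u) \<in> {N..<2 * N} \<times> {1..U}. n + u * T < q}"
  shows "(\<Sum>p\<in>P. peak q L T (\<lambda>t. shrcp q (w p) t) (int (k p)))
     \<le> real N * real U * real T * root (2 * r) (real L * real q * (real r ^ r + 2 * real r) / (real N * real U))"
proof -
  let ?pk = "\<lambda>(w, k). peak q L T (\<lambda>t. shrcp q w t) (int k)"
  let ?All = "{N..<2 * N} \<times> {1..U}"
  define W where "W = {w \<in> {..<q}. \<forall>t<T. coprime (int w + int t) (int q)}"
  have q0: "q > 0" using q prime_gt_0_nat by simp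
  have finP: "finite P" by (rule finite_subset[OF P]) (auto intro: finite_subset[where B = ?All])
  have Pn: "0 < u" "u < q" "0 < n" "n + u * T < q" "n \<in> {N..<2 * N}" "u \<in> {1..U}" if "(n, u) \<in> P" for n u
    using that P U N by auto
  have pk0: "0 \<le> ?pk z" for z using peak_nonneg[OF L] by (simp add: case_prod_beta)
  \<comment> \<open>The second component determines the class of u, hence u < q itself; then the
    first determines n < q.\<close>
  have inj: "inj_on (\<lambda>p. (w p, k p)) P"
  proof (rule inj_onI)
    fix p p' assume p: "p \<in> P" "p' \<in> P" and e: "(w p, k p) = (w p', k p')"
    obtain n u n' u' where pp: "p = (n, u)" "p' = (n', u')" by (cases p; cases p') auto
    note nu = Pn[OF p(1)[unfolded pp]] and nu' = Pn[OF p(2)[unfolded pp]]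
    have iu: "[int u * rcp q u = 1] (mod int q)" "[int u' * rcp q u' = 1] (mod int q)"
      using nu nu' by (auto intro!: modinv_cong coprime_int_prime_less q)
    have "nat ((a * rcp q u) mod int q) = nat ((a * rcp q u') mod int q)"
      using e by (simp add: k_def pp)
    then have "[a * rcp q u = a * rcp q u'] (mod int q)"
      using q0 by (simp add: cong_def eq_nat_nat_iff)
    then have c: "[rcp q u = rcp q u'] (mod int q)"
      using a cong_mult_lcancel by blast
    have A: "[int u' * (int u * rcp q u) = int u' * 1] (mod int q)" by (rule cong_scalar_left[OF iu(1)])
    have B: "[int u * (int u' * rcp q u') = int u * 1] (mod int q)" by (rule cong_scalar_left[OF iu(2)])
    have C: "[int u' * int u * rcp q u = int u' * int u * rcp q u'] (mod int q)"
      by (rule cong_scalar_left[OF c])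
    have e1: "int u' * int u * rcp q u = int u' * (int u * rcp q u)" by (rule mult.assoc)
    have e2: "int u' * int u * rcp q u' = int u * (int u' * rcp q u')" by (simp only: mult_ac)
    from cong_trans[OF cong_trans[OF cong_sym[OF A] C[unfolded e1 e2]] B]
    have "[int u' = int u] (mod int q)" unfolding mult_1_right .
    then have uu: "u' = u" using nu nu' by (simp add: cong_int_iff cong_def)
    have "w p = w p'" using e by simp
    then have "[int n = int n'] (mod int q)"
      using progression_residue(2)[OF q nu(1-4)] progression_residue(2)[OF q nu'(1-4)]
      unfolding uu \<open>w p = w p'\<close>[unfolded w_def pp uu prod.case] by (blast intro: cong_sym cong_trans)
    moreover have "n < q" "n' < q" using nu nu' by linarith+
    ultimately have "n = n'" by (simp add: cong_int_iff cong_def)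
    then show "p = p'" by (simp add: pp uu)
  qed
  have img: "(\<lambda>p. (w p, k p)) ` P \<subseteq> W \<times> {..<q}"
  proof (rule image_subsetI)
    fix p assume p: "p \<in> P"
    obtain n u where pp: "p = (n, u)" by (cases p)
    note nu = Pn[OF p[unfolded pp]]
    show "(w p, k p) \<in> W \<times> {..<q}"
      using progression_residue(1,3)[OF q nu(1-4)] q0 by (simp add: W_def w_def k_def pp nat_less_iff)
  qed
  have "(\<Sum>p\<in>P. ?pk (w p, k p) ^ (2 * r)) = (\<Sum>z\<in>(\<lambda>p. (w p, k p)) ` P. ?pk z ^ (2 * r))"
    using inj by (simp add: sum.reindex)
  \<comment> \<open>Peaks are nonnegative, so the sum may be completed to all admissible
    \<open>w\<close> and all residues. Completion makes the moment bound available.\<close>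
  also have "\<dots> \<le> (\<Sum>z\<in>W \<times> {..<q}. ?pk z ^ (2 * r))"
    using img pk0 by (intro sum_mono2) (auto simp: W_def)
  also have "\<dots> = (\<Sum>w\<in>W. \<Sum>\<kappa><q. peak q L T (\<lambda>t. shrcp q w t) (int \<kappa>) ^ (2 * r))"
    by (simp add: sum.cartesian_product case_prod_beta)
  also have "\<dots> \<le> (\<Sum>w\<in>W. real L * real q * real (Jcount q r (\<lambda>t. shrcp q w t) T))"
    by (intro sum_mono sum_peak_power_le q0 L)
  also have "\<dots> = real L * real q * real (\<Sum>w\<in>W. Jcount q r (\<lambda>t. shrcp q w t) T)"
    by (simp add: sum_distrib_left)
  also have "\<dots> \<le> real L * real q * real (card W * (T ^ r * r ^ r) + 2 * r * 1 * T ^ (2 * r))"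
  proof (intro mult_left_mono of_nat_mono)
    have D1: "card {w \<in> W. w = v} \<le> 1" for v
    proof -
      have "{w \<in> W. w = v} \<subseteq> {v}" by auto
      then have "card {w \<in> W. w = v} \<le> card {v}" by (intro card_mono) auto
      then show ?thesis by simp
    qed
    show "(\<Sum>w\<in>W. Jcount q r (\<lambda>t. shrcp q w t) T) \<le> card W * (T ^ r * r ^ r) + 2 * r * 1 * T ^ (2 * r)"
      by (rule sum_Jcount_le[OF q r(2) T(2) _ _ _ D1]) (auto simp: W_def)
  qed auto
  also have "\<dots> \<le> real L * real q * (real T ^ (2 * r) * (real r ^ r + 2 * real r))"
  proof (intro mult_left_mono)
    have "card W \<le> q" using card_mono[of "{..<q}" W] by (auto simp: W_def)
    \<comment> \<open>This is what q \<le> T^r is for: the rearrangements then contribute no more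
      than the order T^(2r) of the remaining solutions.\<close>
    then have "card W \<le> T ^ r" using T(3) by linarith
    then have "card W * (T ^ r * r ^ r) + 2 * r * 1 * T ^ (2 * r) \<le> T ^ r * (T ^ r * r ^ r) + 2 * r * 1 * T ^ (2 * r)"
      by (intro add_mono mult_right_mono) auto
    also have "\<dots> = T ^ (2 * r) * (r ^ r + 2 * r)" unfolding mult_2[of r] power_add by (simp add: distrib_left mult_ac)
    finally have "real (card W * (T ^ r * r ^ r) + 2 * r * 1 * T ^ (2 * r)) \<le> real (T ^ (2 * r) * (r ^ r + 2 * r))"
      by (simp only: of_nat_le_iff)
    then show "real (card W * (T ^ r * r ^ r) + 2 * r * 1 * T ^ (2 * r)) \<le> real T ^ (2 * r) * (real r ^ r + 2 * real r)"
      by simp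
  qed auto
  finally have tot: "(\<Sum>p\<in>P. ?pk (w p, k p) ^ (2 * r)) \<le> real L * real q * (real T ^ (2 * r) * (real r ^ r + 2 * real r))" .
  have NU: "real N * real U > 0" using N U by simp
  have cP: "real (card P) \<le> real N * real U"
  proof -
    have "card P \<le> card ?All" using P by (intro card_mono) auto
    then show ?thesis by (simp add: card_cartesian_product flip: of_nat_mult)
  qed
  have "(\<Sum>p\<in>P. ?pk (w p, k p)) = (\<Sum>p\<in>P. root (2 * r) (?pk (w p, k p) ^ (2 * r)))"
    using r pk0 by (intro sum.cong refl real_root_power_cancel[symmetric]) auto
  also have "\<dots> \<le> (real N * real U) * root (2 * r) ((\<Sum>p\<in>P. ?pk (w p, k p) ^ (2 * r)) / (real N * real U))"
    using finP r cP NU by (intro sum_root_le) (auto intro!: zero_le_power pk0)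
  also have "\<dots> \<le> (real N * real U) * root (2 * r) (real T ^ (2 * r) * (real L * real q * (real r ^ r + 2 * real r) / (real N * real U)))"
  proof (intro mult_left_mono real_root_le_mono)
    have "(\<Sum>p\<in>P. ?pk (w p, k p) ^ (2 * r)) / (real N * real U) \<le> real L * real q * (real T ^ (2 * r) * (real r ^ r + 2 * real r)) / (real N * real U)"
      using tot NU by (intro divide_right_mono) auto
    then show "(\<Sum>p\<in>P. ?pk (w p, k p) ^ (2 * r)) / (real N * real U) \<le> real T ^ (2 * r) * (real L * real q * (real r ^ r + 2 * real r) / (real N * real U))"
      by (simp add: mult_ac)
  qed (use r NU in auto)
  also have "root (2 * r) (real T ^ (2 * r) * (real L * real q * (real r ^ r + 2 * real r) / (real N * real U)))
     = real T * root (2 * r) (real L * real q * (real r ^ r + 2 * real r) / (real N * real U))"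
    unfolding real_root_mult[of _ "real T ^ (2 * r)"] using r by (simp add: real_root_power_cancel)
  finally show ?thesis by (simp add: mult_ac)
qed

lemma ceiling_powr_length:
  fixes q r :: nat and \<delta> :: real
  defines "T \<equiv> nat \<lceil>real q powr \<delta>\<rceil>"
  assumes q: "q \<ge> 2" and \<delta>: "0 < \<delta>" "\<delta> \<le> 1 / 2" "8 \<le> real q powr \<delta>" and r: "1 / \<delta> \<le> real r"
  shows "real q powr \<delta> \<le> real T" "real T \<le> 2 * real q powr \<delta>" "1 \<le> T" "T \<le> q" "q \<le> T ^ r"
proof -
  show T: "real q powr \<delta> \<le> real T" "real T \<le> 2 * real q powr \<delta>" "1 \<le> T"
    using nat_ceiling_bounds[of "real q powr \<delta>"] \<delta>(3) unfolding T_def by auto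
  have "real T \<le> real q powr \<delta> * real q powr \<delta>" using \<delta>(3) by (intro order_trans[OF T(2)] mult_right_mono) auto
  also have "\<dots> = real q powr (2 * \<delta>)" by (simp flip: powr_add)
  also have "\<dots> \<le> real q powr 1" using q \<delta> by (intro powr_mono) auto
  finally show "T \<le> q" using q by simp
  have "real q powr 1 \<le> real q powr (\<delta> * real r)" using q r \<delta>(1) by (intro powr_mono) (auto simp: field_simps)
  also have "\<dots> = (real q powr \<delta>) ^ r" using q by (simp add: powr_realpow[symmetric] powr_powr)
  also have "\<dots> \<le> real T ^ r" using T(1) by (intro power_mono) auto
  finally have "real q \<le> real (T ^ r)" using q by simp
  then show "q \<le> T ^ r" by simp
qed

text \<open>With L about T q^(2\<delta>), the rounding error relative to T is q^(-2\<delta>), and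
  still q^(-\<delta>) after the square root taken in the bilinear bound.\<close>

lemma grid_length_bounds:
  fixes Q \<delta> :: real and T :: nat
  defines "L \<equiv> nat \<lceil>real T * Q powr (2 * \<delta>)\<rceil>"
  assumes Q: "Q > 1" and T: "1 \<le> T" and \<delta>: "0 < \<delta>"
  shows "1 \<le> L" "real L \<le> 2 * (real T * Q powr (2 * \<delta>))"
    "2 * pi * (real T / real L) \<le> 7 * Q powr (- 2 * \<delta>)" "sqrt (2 * pi * real T / real L) \<le> 3 * Q powr (- \<delta>)"
proof -
  have "1 * 1 \<le> real T * Q powr (2 * \<delta>)" using T \<delta> Q by (intro mult_mono ge_one_powr_ge_zero) auto
  then have "1 \<le> real T * Q powr (2 * \<delta>)" by simp
  note L = nat_ceiling_bounds[OF this, folded L_def]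
  show "1 \<le> L" "real L \<le> 2 * (real T * Q powr (2 * \<delta>))" by fact+
  have "real T = real T * Q powr (2 * \<delta>) * Q powr (- 2 * \<delta>)" using Q by (simp add: mult.assoc flip: powr_add)
  also have "\<dots> \<le> real L * Q powr (- 2 * \<delta>)" using L(1) by (intro mult_right_mono) auto
  finally have "real T / real L \<le> Q powr (- 2 * \<delta>)" using L(3) by (simp add: divide_le_eq mult.commute)
  moreover have "2 * pi \<le> 7" using pi_approx by simp
  ultimately show *: "2 * pi * (real T / real L) \<le> 7 * Q powr (- 2 * \<delta>)" by (intro mult_mono) auto
  also have "\<dots> \<le> (3 * Q powr (- \<delta>)) ^ 2" by (simp add: power2_eq_square flip: powr_add)
  finally show "sqrt (2 * pi * real T / real L) \<le> 3 * Q powr (- \<delta>)" by (intro real_le_lsqrt) auto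
qed

text \<open>Origin of the 64: a saving q^(-\<epsilon>/8) under a root of order at most
  8/\<delta>.\<close>

lemma root_le_powr_saving:
  fixes Q \<epsilon> \<delta> V :: real
  assumes "Q > 1" "0 < \<epsilon>" "n \<ge> 1" "real n * \<delta> \<le> 8" "V \<le> Q powr (- \<epsilon> / 8)"
  shows "root n V \<le> Q powr (- \<epsilon> * \<delta> / 64)"
proof (rule le_powr_root)
  have "\<epsilon> * (real n * \<delta>) \<le> \<epsilon> * 8" using assms by (intro mult_left_mono) auto
  then show "(- \<epsilon> / 8) / real n \<le> - \<epsilon> * \<delta> / 64" using assms by (simp add: field_simps)
qed fact+

lemma powr_le_powr_saving:
  fixes Q \<epsilon> \<delta> c :: real
  assumes "Q > 1" "0 < \<epsilon>" "\<epsilon> \<le> 1 / 10" "0 < \<delta>" "\<delta> \<le> c"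
  shows "Q powr (- c) \<le> Q powr (- \<epsilon> * \<delta> / 64)"
proof (rule powr_mono)
  have "\<epsilon> * \<delta> \<le> 1 * \<delta>" using assms by (intro mult_right_mono) auto
  then have "\<epsilon> * \<delta> \<le> 64 * c" using assms by linarith
  then show "- c \<le> - \<epsilon> * \<delta> / 64" by simp
qed (use assms in simp)

text \<open>Here N U exceeds q by a power, so the factor q lost by completing to all pairs of
  residues is more than repaid by the average over (n, u). The linear coefficient \<open>b\<close>
  only enters the frequency that \<open>peak\<close> absorbs.\<close>

lemma long_sum_le:
  fixes q N Y r :: nat and a b :: int and \<epsilon> \<delta> :: real
  assumes q: "prime q" and a: "coprime a (int q)" and N: "N \<ge> 1" "N \<le> q" and Y: "Y < 2 * N" "Y < q"
    and big: "real q powr (1 / 2 + \<epsilon> / 8) \<le> real N"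
    and \<epsilon>: "0 < \<epsilon>" "\<epsilon> \<le> 1 / 10" and \<delta>: "0 < \<delta>" "\<delta> \<le> \<epsilon> / 100"
    and r: "1 / \<delta> \<le> real r" "real r \<le> 2 / \<delta>" "r < q"
    and q1: "8 \<le> real q powr \<delta>" and q2: "8 * (real r ^ r + 2 * real r) \<le> real q powr \<delta>"
  shows "norm (\<Sum>n\<in>{N..Y}. eq (int q) (a * rcp q n + b * int n)) \<le> 10 * real N * real q powr (- \<epsilon> * \<delta> / 64)"
proof -
  define Q where "Q = real q"
  have qq: "real q = Q" by (simp add: Q_def)
  have q2': "q \<ge> 2" using prime_ge_2_nat[OF q] .
  then have Q1: "Q > 1" by (simp add: Q_def)
  have Q0: "Q > 0" using Q1 by simp
  have padd: "Q powr x * Q powr y = Q powr (x + y)" for x y by (simp add: powr_add)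
  have pmono: "Q powr x \<le> Q powr y" if "x \<le> y" for x y using that Q1 by (intro powr_mono) auto
  have pone: "1 \<le> Q powr x" if "0 \<le> x" for x using that Q1 by (simp add: ge_one_powr_ge_zero)
  have p1: "Q = Q powr 1" using Q0 by simp
  have r1: "r \<ge> 1"
  proof -
    have "real r > 0" using r(1) \<delta>(1) by (meson divide_pos_pos less_le_trans zero_less_one)
    then show ?thesis by simp
  qed
  define T where "T = nat \<lceil>Q powr \<delta>\<rceil>"
  have "\<delta> \<le> 1 / 2" using \<epsilon> \<delta> by simp
  note T = ceiling_powr_length[OF q2' \<delta>(1) this q1 r(1), unfolded qq, folded T_def]
  \<comment> \<open>Small enough that the shift error U T is at most 2 N q^(-2\<delta>), large
    enough that N U still exceeds q.\<close>
  define U where "U = nat \<lfloor>real N * Q powr (- 3 * \<delta>)\<rfloor>"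
  have "Q powr (1 / 2 + \<epsilon> / 8) * Q powr (- 3 * \<delta>) \<le> real N * Q powr (- 3 * \<delta>)"
    using big unfolding qq by (intro mult_right_mono) auto
  moreover have "1 \<le> Q powr (1 / 2 + \<epsilon> / 8) * Q powr (- 3 * \<delta>)"
    unfolding padd using \<epsilon> \<delta> by (intro pone) simp
  ultimately have "1 \<le> real N * Q powr (- 3 * \<delta>)" by linarith
  note U = nat_floor_bounds[OF this, folded U_def]
  have UN: "real U \<le> real N"
  proof -
    have "real N * Q powr (- 3 * \<delta>) \<le> real N * Q powr 0" using \<delta> by (intro mult_left_mono pmono) auto
    then show ?thesis using U(2) Q0 by simp
  qed
  have Uq: "U < q"
  proof -
    have "real N * Q powr (- 3 * \<delta>) < real N * Q powr 0"
      using \<delta> N Q1 by (intro mult_strict_left_mono powr_less_mono) auto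
    then have "real U < real N" using U(2) Q0 by simp
    then show ?thesis using N by simp
  qed
  define L where "L = nat \<lceil>real T * Q powr (2 * \<delta>)\<rceil>"
  note L = grid_length_bounds[OF Q1 T(3) \<delta>(1), folded L_def]
  have UT0: "real U * real T > 0" using U(3) T(3) by simp
  define h where "h = (\<lambda>n. eq (int q) (a * rcp q n + b * int n))"
  define P where "P = {(n, u) \<in> {N..<2 * N} \<times> {1..U}. n + u * T \<le> Y}"
  define w where "w = (\<lambda>(n, u). nat ((int n * rcp q u) mod int q))"
  define k where "k = (\<lambda>(n::nat, u). nat ((a * rcp q u) mod int q))"
  let ?pk = "\<lambda>p. peak q L T (\<lambda>t. shrcp q (w p) t) (int (k p))"
  let ?err = "2 * pi * real T ^ 2 / real L"
  \<comment> \<open>The shifting inequality is applied with a one-element range of \<open>m\<close>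
    and weight 1.\<close>
  have "norm (\<Sum>m\<in>{0::nat}. of_real 1 * (\<Sum>n\<in>{N..Y}. h n)) \<le> (\<Sum>m\<in>{0::nat}. 1) * (real U * real T)
     + (\<Sum>(n, u)\<in>{N..<2 * N} \<times> {1..U}. norm (\<Sum>m\<in>{m \<in> {0::nat}. n + u * T \<le> Y}. of_real 1 * (\<Sum>t<T. h (n + u * t)))) / (real U * real T)"
    using Y T(3) U(3) by (intro shifted_sum_le[where Y = "\<lambda>_. Y" and g = "\<lambda>_. h" and \<gamma> = "\<lambda>_. 1"]) (auto simp: h_def)
  also have "(\<Sum>(n, u)\<in>{N..<2 * N} \<times> {1..U}. norm (\<Sum>m\<in>{m \<in> {0::nat}. n + u * T \<le> Y}. of_real 1 * (\<Sum>t<T. h (n + u * t))))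
     = (\<Sum>(n, u)\<in>P. norm (\<Sum>t<T. h (n + u * t)))"
    unfolding P_def by (rule sum.mono_neutral_cong_right) auto
  finally have shift: "norm (\<Sum>n\<in>{N..Y}. h n) \<le> real U * real T + (\<Sum>(n, u)\<in>P. norm (\<Sum>t<T. h (n + u * t))) / (real U * real T)"
    by simp
  have each: "norm (\<Sum>t<T. h (n + u * t)) \<le> ?pk (n, u) + ?err" if "(n, u) \<in> P" for n u
  proof -
    have nu: "0 < u" "u < q" "0 < n" "n + u * T < q" using that Uq N Y by (auto simp: P_def)
    note res = progression_residue[OF q nu]
    have wnu: "w (n, u) = nat ((int n * rcp q u) mod int q)" by (simp add: w_def)
    have kc: "[int (k (n, u)) = a * rcp q u] (mod int q)"
      using Q0 by (simp add: k_def Q_def)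
    have "h (n + u * t) = eq (int q) (b * int n) * (eq (int q) (int (k (n, u)) * shrcp q (w (n, u)) t) * E (real_of_int (b * int u) / real q * real t))"
      if t: "t < T" for t
    proof -
      have "[a * rcp q (n + u * t) = a * (rcp q u * shrcp q (w (n, u)) t)] (mod int q)"
        unfolding wnu by (rule cong_scalar_left[OF res(4)[OF t]])
      moreover have "[int (k (n, u)) * shrcp q (w (n, u)) t = a * rcp q u * shrcp q (w (n, u)) t] (mod int q)"
        by (rule cong_scalar_right[OF kc])
      ultimately have "[a * rcp q (n + u * t) = int (k (n, u)) * shrcp q (w (n, u)) t] (mod int q)"
        unfolding mult.assoc by (blast intro: cong_sym cong_trans)
      then have "eq (int q) (a * rcp q (n + u * t)) = eq (int q) (int (k (n, u)) * shrcp q (w (n, u)) t)"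
        by (rule eq_cong)
      moreover have "E (real_of_int (b * int u) / real q * real t) = eq (int q) (b * int u * int t)"
        by (simp add: eq_conv_E)
      moreover have "a * rcp q (n + u * t) + b * int (n + u * t) = a * rcp q (n + u * t) + (b * int n + b * int u * int t)"
        by (simp add: algebra_simps)
      ultimately show ?thesis unfolding h_def by (simp only: eq_add mult_ac)
    qed
    then have "(\<Sum>t<T. h (n + u * t)) = eq (int q) (b * int n) * twisted q T (\<lambda>t. shrcp q (w (n, u)) t) (int (k (n, u))) (real_of_int (b * int u) / real q)"
      unfolding twisted_def sum_distrib_left by (intro sum.cong) auto
    then have e: "norm (\<Sum>t<T. h (n + u * t)) = norm (twisted q T (\<lambda>t. shrcp q (w (n, u)) t) (int (k (n, u))) (real_of_int (b * int u) / real q))"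
      by (simp only: norm_mult norm_eq mult_1)
    show ?thesis unfolding e by (rule norm_twisted_le[OF L(1)])
  qed
  define V where "V = real L * real q * (real r ^ r + 2 * real r) / (real N * real U)"
  have "(\<Sum>(n, u)\<in>P. norm (\<Sum>t<T. h (n + u * t))) \<le> (\<Sum>p\<in>P. ?pk p + ?err)"
    using each by (intro sum_mono) auto
  also have "\<dots> = (\<Sum>p\<in>P. ?pk p) + real (card P) * ?err" by (simp add: sum.distrib)
  also have "\<dots> \<le> real N * real U * real T * root (2 * r) V + (real N * real U) * ?err"
  proof (rule add_mono)
    show "(\<Sum>p\<in>P. ?pk p) \<le> real N * real U * real T * root (2 * r) V"
      unfolding w_def k_def V_def
      using Y by (intro sum_peak_pairs_le q a r1 r(3) T(3,4,5) L(1) N(1) U(3) Uq) (auto simp: P_def)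
    have "card P \<le> card ({N..<2 * N} \<times> {1..U})" by (intro card_mono) (auto simp: P_def)
    then have "real (card P) \<le> real N * real U" by (simp add: card_cartesian_product flip: of_nat_mult)
    then show "real (card P) * ?err \<le> (real N * real U) * ?err" by (intro mult_right_mono) auto
  qed
  finally have "norm (\<Sum>n\<in>{N..Y}. h n) \<le> real U * real T + (real N * real U * real T * root (2 * r) V + (real N * real U) * ?err) / (real U * real T)"
    using UT0 by (intro order_trans[OF shift] add_left_mono divide_right_mono) auto
  also have "\<dots> = real U * real T + real N * root (2 * r) V + real N * (2 * pi * real T / real L)"
  proof -
    have "u * t + (n * u * t * w + n * u * (2 * pi * t ^ 2 / l)) / (u * t) = u * t + n * w + n * (2 * pi * t / l)"
      if "u \<noteq> 0" "t \<noteq> 0" for u t n w l :: real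
      using that by (simp add: field_simps power2_eq_square)
    from this[of "real U" "real T"] show ?thesis using U(3) T(3) by simp
  qed
  finally have bound: "norm (\<Sum>n\<in>{N..Y}. h n) \<le> real U * real T + real N * root (2 * r) V + real N * (2 * pi * real T / real L)" .
  have "real U * real T \<le> (real N * Q powr (- 3 * \<delta>)) * (2 * Q powr \<delta>)"
    using U T by (intro mult_mono) auto
  also have "\<dots> = 2 * real N * Q powr (- 2 * \<delta>)" by (simp add: padd[symmetric] powr_add[symmetric] mult_ac)
  finally have b1: "real U * real T \<le> 2 * real N * Q powr (- 2 * \<delta>)" .
  have b2: "real N * (2 * pi * real T / real L) \<le> real N * (7 * Q powr (- 2 * \<delta>))"
    using L(3) by (intro mult_left_mono) auto
  have "V \<le> Q powr (- \<epsilon> / 8)"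
  proof -
    \<comment> \<open>N contributes the exponent 1/2 + \<epsilon>/8 twice; the 3\<delta> is the
      shortening of U, and the 1/2 comes from rounding down.\<close>
    have NU: "Q powr (1 + \<epsilon> / 4 - 3 * \<delta>) / 2 \<le> real N * real U"
    proof -
      have "Q powr (1 + \<epsilon> / 4 - 3 * \<delta>) = Q powr (1 / 2 + \<epsilon> / 8) * (Q powr (1 / 2 + \<epsilon> / 8) * Q powr (- 3 * \<delta>))"
        unfolding padd by (rule arg_cong[of _ _ "(powr) Q"]) simp
      also have "\<dots> \<le> real N * (real N * Q powr (- 3 * \<delta>))"
        using big unfolding qq by (intro mult_mono) auto
      also have "\<dots> \<le> real N * (2 * real U)" using U(1) by (intro mult_left_mono) auto
      finally show ?thesis by simp
    qed
    have L4: "real L \<le> 4 * Q powr (3 * \<delta>)"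
    proof -
      have "real L \<le> 2 * (2 * Q powr \<delta> * Q powr (2 * \<delta>))" using L(2) T(2) by (intro order_trans[OF L(2)] mult_left_mono mult_right_mono) auto
      also have "\<dots> = 4 * Q powr (3 * \<delta>)" by (simp add: mult.assoc padd)
      finally show ?thesis .
    qed
    have "V \<le> (4 * Q powr (3 * \<delta>)) * Q * (real r ^ r + 2 * real r) / (Q powr (1 + \<epsilon> / 4 - 3 * \<delta>) / 2)"
      unfolding V_def qq using L4 NU Q0 by (intro frac_le mult_mono mult_right_mono) auto
    also have "\<dots> = (8 * (real r ^ r + 2 * real r)) * (Q powr (3 * \<delta>) * Q powr 1 * Q powr (- (1 + \<epsilon> / 4 - 3 * \<delta>)))"
    proof -
      have *: "(4 * x) * z * c / (y / 2) = (8 * c) * (x * z * inverse y)" if "y > 0" for x y z c :: real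
        using that by (simp add: field_simps)
      have m: "Q powr (- (1 + \<epsilon> / 4 - 3 * \<delta>)) = inverse (Q powr (1 + \<epsilon> / 4 - 3 * \<delta>))" by (rule powr_minus)
      have y: "0 < Q powr (1 + \<epsilon> / 4 - 3 * \<delta>)" using Q0 by simp
      show ?thesis unfolding m p1[symmetric] by (rule *[OF y])
    qed
    also have "\<dots> \<le> Q powr \<delta> * (Q powr (3 * \<delta>) * Q powr 1 * Q powr (- (1 + \<epsilon> / 4 - 3 * \<delta>)))"
      using q2 unfolding qq by (intro mult_right_mono) auto
    also have "\<dots> = Q powr (7 * \<delta> - \<epsilon> / 4)" unfolding padd by (rule arg_cong[of _ _ "(powr) Q"]) simp
    also have "\<dots> \<le> Q powr (- \<epsilon> / 8)" using \<epsilon> \<delta> by (intro pmono) simp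
    finally show ?thesis .
  qed
  moreover have "real (2 * r) * \<delta> \<le> 8" using r(2) \<delta>(1) by (simp add: field_simps)
  ultimately have "root (2 * r) V \<le> Q powr (- \<epsilon> * \<delta> / 64)" using r1 by (intro root_le_powr_saving Q1 \<epsilon>) auto
  then have b3: "real N * root (2 * r) V \<le> real N * Q powr (- \<epsilon> * \<delta> / 64)" by (intro mult_left_mono) auto
  have "Q powr (- 2 * \<delta>) \<le> Q powr (- \<epsilon> * \<delta> / 64)"
    using powr_le_powr_saving[OF Q1 \<epsilon> \<delta>(1), of "2 * \<delta>"] \<delta> by simp
  then have b4: "9 * (real N * Q powr (- 2 * \<delta>)) \<le> 9 * (real N * Q powr (- \<epsilon> * \<delta> / 64))" by (intro mult_left_mono) auto
  show ?thesis using bound b1 b2 b3 b4 unfolding h_def qq by simp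
qed

subsection \<open>Medium and short smooth variables\<close>

text \<open>With R = q^\<alpha>, the two terms are R^(-2), from the solutions that are always
  present, and R^(-1/2) q^(-1/2).\<close>

lemma energy_normalised_le:
  fixes q R :: nat and a :: int and B \<alpha> :: real
  assumes q: "prime q" and R: "1 \<le> R" "2 * R < q" and a: "coprime a (int q)"
    and B: "\<And>n. 0 < n \<Longrightarrow> n \<le> q ^ 4 \<Longrightarrow> real (ndiv n) \<le> B"
    and \<alpha>: "real R = real q powr \<alpha>"
  shows "real (energy q {1..R} (\<lambda>m. a * rcp q m)) / real R ^ 4
     \<le> 12 * B * (real q powr (- 2 * \<alpha>) + real q powr (- \<alpha> / 2 - 1 / 2))"
proof -
  have q0: "real q > 0" using prime_gt_0_nat[OF q] by simp
  have R0: "real R > 0" using R by simp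
  have e1: "1 / real R ^ 2 = real q powr (- 2 * \<alpha>)"
    using q0 by (simp add: \<alpha> powr_realpow[symmetric] powr_powr powr_minus_divide mult.commute)
  have "sqrt (real R / real q) / real R = real q powr (- \<alpha> / 2 - 1 / 2)"
  proof -
    have "sqrt (real R / real q) = real q powr ((\<alpha> - 1) / 2)"
    proof -
      have "real R / real q = real q powr (\<alpha> - 1)" using q0 by (simp add: \<alpha> powr_diff)
      then show ?thesis using q0 by (simp add: powr_half_sqrt[symmetric] powr_powr)
    qed
    then have "sqrt (real R / real q) / real R = real q powr ((\<alpha> - 1) / 2 - \<alpha>)" using q0 by (simp add: \<alpha> powr_diff)
    also have "(\<alpha> - 1) / 2 - \<alpha> = - \<alpha> / 2 - 1 / 2" by (simp add: field_simps)
    finally show ?thesis .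
  qed
  note e2 = this
  have "real (energy q {1..R} (\<lambda>m. a * rcp q m)) / real R ^ 4
      \<le> 12 * B * (real R ^ 2 + real R ^ 3 * sqrt (real R / real q)) / real R ^ 4"
    using R by (intro divide_right_mono energy_modinv_le q a B) auto
  also have "\<dots> = 12 * B * (1 / real R ^ 2 + sqrt (real R / real q) / real R)"
    using R0 by (simp add: field_simps power_numeral_reduce)
  finally show ?thesis unfolding e1 e2 .
qed

text \<open>The N U pairs give few repeated residues n/u once large common factors are discarded, so
  the counts \<open>J\<close> are nearly diagonal on average. What is then missing from q comes from
  the energy of the reciprocals of \<open>m\<close>.\<close>

lemma bilinear_medium_le:
  fixes q N R r :: nat and a b :: int and \<gamma> :: "nat \<Rightarrow> real" and G B \<epsilon> \<delta> :: real and Y :: "nat \<Rightarrow> nat"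
  assumes q: "prime q" and a: "coprime a (int q)" and R: "R \<ge> 1" "2 * R < q" and N: "N \<ge> 1"
    and Y: "\<And>m. Y m < 2 * N" "\<And>m. Y m < q"
    and \<gamma>: "\<And>m. 0 \<le> \<gamma> m" "\<And>m. \<gamma> m \<le> G"
    and big: "real q powr (1 / 2 + \<epsilon> / 2) \<le> real R * real N"
    and Nr: "real q powr (1 / 6) \<le> real N" "real N \<le> real q powr (1 / 2 + \<epsilon> / 8)"
    and B: "\<And>n. 0 < n \<Longrightarrow> n \<le> q ^ 4 \<Longrightarrow> real (ndiv n) \<le> B"
    and \<epsilon>: "0 < \<epsilon>" "\<epsilon> \<le> 1 / 10" and \<delta>: "0 < \<delta>" "\<delta> \<le> \<epsilon> / 100"
    and r: "1 / \<delta> \<le> real r" "real r \<le> 2 / \<delta>" "r < q"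
    and q1: "8 \<le> real q powr \<delta>" and q2: "192 * B * (real r ^ r + 8 * real r) \<le> real q powr \<delta>"
  shows "norm (bisum q a b R N \<gamma> Y)
     \<le> 10 * G * real R * real N * real q powr (- \<epsilon> * \<delta> / 64)"
proof -
  define Q where "Q = real q"
  have qq: "real q = Q" by (simp add: Q_def)
  have q0: "q > 0" using prime_gt_0_nat[OF q] .
  have q2': "q \<ge> 2" using prime_ge_2_nat[OF q] .
  then have Q1: "Q > 1" by (simp add: Q_def)
  have Q0: "Q > 0" using Q1 by simp
  have padd: "Q powr x * Q powr y = Q powr (x + y)" for x y by (simp add: powr_add)
  have pmono: "Q powr x \<le> Q powr y" if "x \<le> y" for x y using that Q1 by (intro powr_mono) auto
  have pone: "1 \<le> Q powr x" if "0 \<le> x" for x using that Q1 by (simp add: ge_one_powr_ge_zero)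
  have G0: "G \<ge> 0" using \<gamma>[of 0] by simp
  have r1: "r \<ge> 1"
  proof -
    have "real r > 0" using r(1) \<delta>(1) by (meson divide_pos_pos less_le_trans zero_less_one)
    then show ?thesis by simp
  qed
  have B1: "B \<ge> 1" using B[of 1] q0 by (simp add: ndiv_def Suc_le_eq)
  define \<alpha> where "\<alpha> = log Q (real R)"
  define \<beta> where "\<beta> = log Q (real N)"
  have \<alpha>: "real R = Q powr \<alpha>" and \<beta>: "real N = Q powr \<beta>"
    using Q1 R N by (simp_all add: \<alpha>_def \<beta>_def)
  have \<alpha>0: "\<alpha> \<ge> 0" using Q1 R by (simp add: \<alpha>_def)
  have \<alpha>\<beta>: "1 / 2 + \<epsilon> / 2 \<le> \<alpha> + \<beta>" using big Q1 unfolding qq \<alpha> \<beta> padd by simp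
  have \<beta>1: "1 / 6 \<le> \<beta>" "\<beta> \<le> 1 / 2 + \<epsilon> / 8" using Nr Q1 unfolding qq \<beta> by simp_all
  \<comment> \<open>The cap 1/2 - \<epsilon>/8 complements \<beta> \<le> 1/2 + \<epsilon>/8, so that
    \<beta> + \<nu> \<le> 1 and cross products of pairs stay below q.\<close>
  define \<nu> where "\<nu> = min \<beta> (1 / 2 - \<epsilon> / 8)"
  have \<nu>: "\<nu> \<le> \<beta>" "\<nu> \<le> 1 / 2 - \<epsilon> / 8" "1 / 6 \<le> \<nu>" using \<beta>1 \<epsilon> by (auto simp: \<nu>_def)
  define T where "T = nat \<lceil>Q powr \<delta>\<rceil>"
  have "\<delta> \<le> 1 / 2" using \<epsilon> \<delta> by simp
  note T = ceiling_powr_length[OF q2' \<delta>(1) this q1 r(1), unfolded qq, folded T_def]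
  have T0: "real T > 0" using T(3) by simp
  \<comment> \<open>Discarding gcds above T costs a proportion of about q^(-\<delta>), while each
    residue is repeated at most T \<le> 2 q^\<delta> times.\<close>
  define D where "D = T"
  define U where "U = nat \<lfloor>Q powr (\<nu> - 3 * \<delta>)\<rfloor>"
  have "1 \<le> Q powr (\<nu> - 3 * \<delta>)" using \<nu> \<epsilon> \<delta> by (intro pone) simp
  note U = nat_floor_bounds[OF this, folded U_def]
  have UN: "U \<le> N"
  proof -
    have "real U \<le> Q powr \<beta>" using \<nu> \<delta> by (intro order_trans[OF U(2)] pmono) simp
    then show ?thesis unfolding \<beta>[symmetric] by simp
  qed
  have NUq: "2 * N * U \<le> q"
  proof -
    have "real (2 * N * U) = 2 * (Q powr \<beta> * real U)" by (simp add: \<beta>)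
    also have "\<dots> \<le> Q powr \<delta> * (Q powr \<beta> * Q powr (\<nu> - 3 * \<delta>))"
      using U(2) q1 unfolding qq by (intro mult_mono) auto
    also have "\<dots> \<le> Q powr 1" unfolding padd using \<beta>1 \<nu> \<delta> by (intro pmono) simp
    also have "\<dots> = real q" using Q0 by (simp add: Q_def)
    finally show ?thesis by (simp only: of_nat_le_iff)
  qed
  have Uq: "U < q"
  proof -
    have "2 * U \<le> 2 * N * U" using N by simp
    then show ?thesis using NUq U(3) by linarith
  qed
  define L where "L = nat \<lceil>real T * Q powr (2 * \<delta>)\<rceil>"
  note L = grid_length_bounds[OF Q1 T(3) \<delta>(1), folded L_def]
  define X where "X = {(n, u) \<in> {N..<2 * N} \<times> {1..U}. gcd n u > D}"
  define P where "P = {(n, u) \<in> {N..<2 * N} \<times> {1..U}. n + u * T < 2 * N \<and> n + u * T < q} - X"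
  define w where "w = (\<lambda>(n, u). nat ((int n * rcp q u) mod int q))"
  define J where "J = (\<lambda>n u. Jcount q r (\<lambda>t. rcp q (n + u * t)) T)"
  define s where "s = (\<Sum>(n, u)\<in>P. real (J n u)) / (real N * real U * real T ^ (2 * r))"
  define En where "En = real (energy q {1..R} (\<lambda>m. a * rcp q m)) / real R ^ 4"
  have NU0: "real N * real U > 0" using N U(3) by simp
  have main: "norm (bisum q a b R N \<gamma> Y) \<le>
     G * real R * (real U * real T + real (card X) / real U + real N * sqrt (2 * pi * real T / real L)
       + real N * root (4 * r) (En * (real L * real q) * s))"
    unfolding En_def s_def P_def J_def
    by (rule bilinear_average_le[OF q0 R(1) N Y \<gamma> T(3) U(3) L(1) r1]) (auto simp: X_def)
  have finP: "finite P" unfolding P_def by (rule finite_Diff) (auto intro: finite_subset[where B = "{N..<2 * N} \<times> {1..U}"])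
  have Pn: "0 < u" "u < q" "0 < n" "n + u * T < q" if "(n, u) \<in> P" for n u
    using that Uq N by (auto simp: P_def)
  have Jw: "J n u = Jcount q r (\<lambda>t. shrcp q (w (n, u)) t) T" if "(n, u) \<in> P" for n u
    unfolding J_def
  proof (rule Jcount_scale)
    note nu = Pn[OF that]
    show "coprime (rcp q u) (int q)"
      by (intro coprime_modinv coprime_int_prime_less q nu)
    show "[rcp q (n + u * t) = rcp q u * shrcp q (w (n, u)) t] (mod int q)" if "t < T" for t
      using progression_residue(4)[OF q nu that] by (simp add: w_def)
  qed
  have "(\<Sum>(n, u)\<in>P. real (J n u)) = real (\<Sum>p\<in>P. Jcount q r (\<lambda>t. shrcp q (w p) t) T)"
    unfolding of_nat_sum by (intro sum.cong refl) (auto simp: Jw)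
  also have "\<dots> \<le> real (card P * (T ^ r * r ^ r) + 2 * r * D * T ^ (2 * r))"
  proof (intro of_nat_mono sum_Jcount_le[OF q r(3) T(4) finP])
    fix p assume p: "p \<in> P"
    obtain n u where pp: "p = (n, u)" by (cases p)
    note nu = Pn[OF p[unfolded pp]]
    show "w p < q" using progression_residue(1)[OF q nu] by (simp add: w_def pp)
    show "coprime (int (w p) + int t) (int q)" if "t < T" for t
      using progression_residue(3)[OF q nu that] by (simp add: w_def pp)
  next
    fix v
    show "card {p \<in> P. w p = v} \<le> D"
    proof (rule progression_classes[OF q NUq])
      show "P \<subseteq> {(n, u) \<in> {N..<2 * N} \<times> {1..U}. gcd n u \<le> D}" by (auto simp: P_def X_def)
      show "[int n = int u * int (w (n, u))] (mod int q)" if "(n, u) \<in> P" for n u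
        using progression_residue(2)[OF q Pn[OF that]] by (simp add: w_def)
    qed
  qed
  also have "\<dots> \<le> real N * real U * (real T ^ r * real r ^ r) + 2 * real r * real D * real T ^ (2 * r)"
  proof -
    have "card P \<le> card ({N..<2 * N} \<times> {1..U})" by (intro card_mono) (auto simp: P_def)
    then have "real (card P) \<le> real N * real U" by (simp add: card_cartesian_product flip: of_nat_mult)
    then have "real (card P) * (real T ^ r * real r ^ r) \<le> real N * real U * (real T ^ r * real r ^ r)"
      by (intro mult_right_mono) auto
    then show ?thesis by simp
  qed
  finally have "s \<le> (real N * real U * (real T ^ r * real r ^ r) + 2 * real r * real D * real T ^ (2 * r)) / (real N * real U * real T ^ (2 * r))"
    unfolding s_def using NU0 by (intro divide_right_mono) auto
  also have "\<dots> = real r ^ r / real T ^ r + 2 * real r * (real D / (real N * real U))"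
  proof -
    have *: "(m * (t * c) + 2 * d * e * (t * t)) / (m * (t * t)) = c / t + 2 * d * (e / m)" if "m \<noteq> 0" "t \<noteq> 0" for m t c d e :: real
      using that by (simp add: field_simps)
    have tt: "real T ^ (2 * r) = real T ^ r * real T ^ r" unfolding mult_2[of r] by (rule power_add)
    show ?thesis unfolding tt by (rule *) (use N U(3) T0 in simp_all)
  qed
  also have "\<dots> \<le> real r ^ r * Q powr (- \<beta> - \<nu> + 4 * \<delta>) + 2 * real r * (4 * Q powr (- \<beta> - \<nu> + 4 * \<delta>))"
  proof (intro add_mono mult_left_mono)
    \<comment> \<open>T^r \<ge> q bounds the diagonal part by r^r / q, which is no larger than the
      other part since \<beta> + \<nu> \<le> 1.\<close>
    have "real r ^ r / real T ^ r \<le> real r ^ r / Q" using T(5) Q0 unfolding Q_def by (intro frac_le) (auto simp flip: of_nat_power)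
    also have "\<dots> = real r ^ r * Q powr (- 1)" using Q0 by (simp add: powr_minus_divide)
    also have "\<dots> \<le> real r ^ r * Q powr (- \<beta> - \<nu> + 4 * \<delta>)" using \<beta>1 \<nu> \<delta> by (intro mult_left_mono pmono) auto
    finally show "real r ^ r / real T ^ r \<le> real r ^ r * Q powr (- \<beta> - \<nu> + 4 * \<delta>)" .
    have "real D / (real N * real U) \<le> (2 * Q powr \<delta>) / (Q powr \<beta> * (Q powr (\<nu> - 3 * \<delta>) / 2))"
      using T U(1) Q0 unfolding D_def \<beta> by (intro frac_le mult_left_mono) auto
    also have "\<dots> = 4 * (Q powr \<delta> * Q powr (- (\<beta> + (\<nu> - 3 * \<delta>))))"
    proof -
      have *: "(2 * x) / (y * (z / 2)) = 4 * (x * inverse (y * z))" if "y > 0" "z > 0" for x y z :: real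
        using that by (simp add: field_simps)
      show ?thesis unfolding powr_minus[of Q "\<beta> + (\<nu> - 3 * \<delta>)"] powr_add[of Q \<beta> "\<nu> - 3 * \<delta>"] using Q0 by (intro *) simp_all
    qed
    also have "\<dots> = 4 * Q powr (- \<beta> - \<nu> + 4 * \<delta>)"
      unfolding padd by (intro arg_cong[of _ _ "\<lambda>z. 4 * Q powr z"]) simp
    finally show "real D / (real N * real U) \<le> 4 * Q powr (- \<beta> - \<nu> + 4 * \<delta>)" .
  qed auto
  finally have s: "s \<le> (real r ^ r + 8 * real r) * Q powr (- \<beta> - \<nu> + 4 * \<delta>)" by (simp add: algebra_simps)
  have s0: "0 \<le> s" unfolding s_def by (intro divide_nonneg_nonneg sum_nonneg) auto
  have En: "En \<le> 12 * B * (Q powr (- 2 * \<alpha>) + Q powr (- \<alpha> / 2 - 1 / 2))"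
    unfolding En_def Q_def using \<alpha> by (intro energy_normalised_le q R a B) (auto simp: Q_def)
  have L4: "real L \<le> 4 * Q powr (3 * \<delta>)"
  proof -
    have "real L \<le> 2 * (2 * Q powr \<delta> * Q powr (2 * \<delta>))" using L(2) T(2) by (intro order_trans[OF L(2)] mult_left_mono mult_right_mono) auto
    also have "\<dots> = 4 * Q powr (3 * \<delta>)" by (simp add: mult.assoc padd)
    finally show ?thesis .
  qed
  have V: "En * (real L * real q) * s \<le> Q powr (- \<epsilon> / 8)"
  proof -
    have "En * (real L * real q) * s \<le> (12 * B * (Q powr (- 2 * \<alpha>) + Q powr (- \<alpha> / 2 - 1 / 2))) * ((4 * Q powr (3 * \<delta>)) * Q powr 1)
        * ((real r ^ r + 8 * real r) * Q powr (- \<beta> - \<nu> + 4 * \<delta>))"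
      using En L4 s s0 B1 Q0 unfolding qq by (intro mult_mono) (auto simp: En_def)
    also have "\<dots> = (48 * B * (real r ^ r + 8 * real r)) * ((Q powr (- 2 * \<alpha>) + Q powr (- \<alpha> / 2 - 1 / 2)) * (Q powr (3 * \<delta>) * Q powr 1 * Q powr (- \<beta> - \<nu> + 4 * \<delta>)))"
      by (simp only: mult_ac)
    also have "\<dots> \<le> (Q powr \<delta> / 4) * ((Q powr (- 2 * \<alpha>) + Q powr (- \<alpha> / 2 - 1 / 2)) * (Q powr (3 * \<delta>) * Q powr 1 * Q powr (- \<beta> - \<nu> + 4 * \<delta>)))"
      using q2 unfolding qq by (intro mult_right_mono) auto
    also have "\<dots> = (Q powr (1 + 8 * \<delta> - \<beta> - \<nu> - 2 * \<alpha>) + Q powr (1 / 2 + 8 * \<delta> - \<beta> - \<nu> - \<alpha> / 2)) / 4"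
    proof -
      have *: "(d / 4) * ((x + y) * z) = (d * (x * z) + d * (y * z)) / 4" for d x y z :: real
        by (simp add: field_simps)
      show ?thesis unfolding * padd
        by (intro arg_cong[of _ _ "\<lambda>z. z / 4"] arg_cong2[of _ _ _ _ "(+)"] arg_cong[of _ _ "(powr) Q"]) simp_all
    qed
    also have "\<dots> \<le> (Q powr (- \<epsilon> / 8) + Q powr (- \<epsilon> / 8)) / 4"
    proof (intro divide_right_mono add_mono pmono)
      show "1 + 8 * \<delta> - \<beta> - \<nu> - 2 * \<alpha> \<le> - \<epsilon> / 8"
        using \<alpha>\<beta> \<beta>1 \<epsilon> \<delta> unfolding \<nu>_def min_def by (auto split: if_splits)
      \<comment> \<open>If \<nu> = \<beta>, then \<alpha> + \<beta> \<ge> 1/2 + \<epsilon>/2 bounds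
        this by 1/4 - 3\<beta>/2 - \<epsilon>/4 + 8\<delta>. Hence the lower limit 1/6 for
        \<beta>.\<close>
      show "1 / 2 + 8 * \<delta> - \<beta> - \<nu> - \<alpha> / 2 \<le> - \<epsilon> / 8"
        using \<alpha>\<beta> \<beta>1 \<epsilon> \<delta> unfolding \<nu>_def min_def by (auto split: if_splits)
    qed auto
    also have "\<dots> \<le> Q powr (- \<epsilon> / 8)" using powr_ge_zero[of Q "- \<epsilon> / 8"] by simp
    finally show ?thesis .
  qed
  moreover have "real (4 * r) * \<delta> \<le> 8" using r(2) \<delta>(1) by (simp add: field_simps)
  ultimately have b4: "root (4 * r) (En * (real L * real q) * s) \<le> Q powr (- \<epsilon> * \<delta> / 64)"
    using r1 by (intro root_le_powr_saving Q1 \<epsilon>) auto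
  have d: "Q powr (- \<delta>) \<le> Q powr (- \<epsilon> * \<delta> / 64)" by (rule powr_le_powr_saving[OF Q1 \<epsilon> \<delta>(1) order_refl])
  have b1: "real U * real T \<le> real N * (2 * Q powr (- \<delta>))"
  proof -
    have "real U * real T \<le> Q powr (\<nu> - 3 * \<delta>) * (2 * Q powr \<delta>)" using U T by (intro mult_mono) auto
    also have "\<dots> = 2 * Q powr (\<nu> - 2 * \<delta>)" by (simp add: padd)
    also have "\<dots> \<le> 2 * Q powr (\<beta> - \<delta>)" using \<nu> \<delta> by (intro mult_left_mono pmono) auto
    also have "\<dots> = real N * (2 * Q powr (- \<delta>))" by (simp add: \<beta> padd)
    finally show ?thesis .
  qed
  have b2: "real (card X) / real U \<le> real N * (3 * Q powr (- \<delta>))"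
  proof -
    have "real (card X) \<le> 3 * real N * real U / real D"
      unfolding X_def using T(3) UN N by (intro card_large_gcd_le) (auto simp: D_def)
    then have "real (card X) / real U \<le> (3 * real N * real U / real D) / real U" by (intro divide_right_mono) auto
    also have "\<dots> = 3 * real N / real D" using U(3) by simp
    also have "\<dots> \<le> 3 * real N / Q powr \<delta>" using T Q0 by (intro frac_le) (auto simp: D_def)
    finally show ?thesis by (simp add: powr_minus_divide mult_ac)
  qed
  have "real U * real T + real (card X) / real U + real N * sqrt (2 * pi * real T / real L)
       + real N * root (4 * r) (En * (real L * real q) * s)
     \<le> real N * (2 * Q powr (- \<delta>)) + real N * (3 * Q powr (- \<delta>)) + real N * (3 * Q powr (- \<delta>)) + real N * Q powr (- \<epsilon> * \<delta> / 64)"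
    using b1 b2 L(4) b4 by (intro add_mono mult_left_mono) auto
  also have "\<dots> = real N * (8 * Q powr (- \<delta>) + Q powr (- \<epsilon> * \<delta> / 64))" by (simp add: algebra_simps)
  also have "\<dots> \<le> real N * (10 * Q powr (- \<epsilon> * \<delta> / 64))"
  proof (rule mult_left_mono)
    have "0 \<le> Q powr (- \<epsilon> * \<delta> / 64)" by (rule powr_ge_zero)
    with d show "8 * Q powr (- \<delta>) + Q powr (- \<epsilon> * \<delta> / 64) \<le> 10 * Q powr (- \<epsilon> * \<delta> / 64)" by linarith
  qed simp
  finally have "norm (bisum q a b R N \<gamma> Y) \<le> G * real R * (real N * (10 * Q powr (- \<epsilon> * \<delta> / 64)))"
    using G0 by (intro order_trans[OF main] mult_left_mono) auto
  then show ?thesis by (simp add: qq mult_ac)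
qed

section \<open>Smooth variables of length at most q^(1/6)\<close>

lemma Jcount_interval_le:
  assumes "n \<ge> N" "n + T \<le> 2 * N"
  shows "Jcount q r (\<lambda>t. rcp q (n + t)) T \<le> invJ q r N"
  unfolding Jcount_def invJ_def
proof (rule card_inj_on_le)
  let ?\<phi> = "\<lambda>f i. if i < r then n + f i else undefined"
  have inj: "inj_on ?\<phi> (tuples r T)"
  proof (rule inj_onI)
    fix f g :: "nat \<Rightarrow> nat" assume f: "f \<in> tuples r T" "g \<in> tuples r T" and e: "?\<phi> f = ?\<phi> g"
    have "f i = g i" if "i < r" for i using fun_cong[OF e, of i] that by simp
    then show "f = g" using f unfolding tuples_def by (intro PiE_ext) auto
  qed
  show "inj_on (map_prod ?\<phi> ?\<phi>) {(f, g) \<in> tuples r T \<times> tuples r T. [(\<Sum>i<r. rcp q (n + f i)) = (\<Sum>i<r. rcp q (n + g i))] (mod int q)}"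
    by (rule inj_on_subset[OF map_prod_inj_on[OF inj inj]]) auto
  have mem: "?\<phi> f \<in> reps r N (2 * N)" if "f \<in> tuples r T" for f
  proof -
    have "f i < T" if "i < r" for i using that \<open>f \<in> tuples r T\<close> by (auto simp: tuples_def)
    then show ?thesis using assms by (fastforce simp: reps_def PiE_iff extensional_def)
  qed
  show "map_prod ?\<phi> ?\<phi> ` {(f, g) \<in> tuples r T \<times> tuples r T. [(\<Sum>i<r. rcp q (n + f i)) = (\<Sum>i<r. rcp q (n + g i))] (mod int q)}
      \<subseteq> {(f, g) \<in> reps r N (2 * N) \<times> reps r N (2 * N). [(\<Sum>i<r. rcp q (f i)) = (\<Sum>i<r. rcp q (g i))] (mod int q)}"
  proof (rule image_subsetI)
    fix z assume "z \<in> {(f, g) \<in> tuples r T \<times> tuples r T. [(\<Sum>i<r. rcp q (n + f i)) = (\<Sum>i<r. rcp q (n + g i))] (mod int q)}"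
    then obtain f g where z: "z = (f, g)" "f \<in> tuples r T" "g \<in> tuples r T"
      and e: "[(\<Sum>i<r. rcp q (n + f i)) = (\<Sum>i<r. rcp q (n + g i))] (mod int q)" by auto
    have "(\<Sum>i<r. rcp q (?\<phi> h i)) = (\<Sum>i<r. rcp q (n + h i))" for h
      by (intro sum.cong) auto
    then show "map_prod ?\<phi> ?\<phi> z \<in> {(f, g) \<in> reps r N (2 * N) \<times> reps r N (2 * N). [(\<Sum>i<r. rcp q (f i)) = (\<Sum>i<r. rcp q (g i))] (mod int q)}"
      using z mem e by simp
  qed
  show "finite {(f, g) \<in> reps r N (2 * N) \<times> reps r N (2 * N). [(\<Sum>i<r. rcp q (f i)) = (\<Sum>i<r. rcp q (g i))] (mod int q)}"
    by (rule finite_subset[of _ "reps r N (2 * N) \<times> reps r N (2 * N)"]) auto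
qed

text \<open>With U = 1 the progression is an interval inside [N, 2N), so its count is at most
  \<open>invJ\<close>. \<open>T\<close> is almost as long as N, hence the loss 2^(2r) q^(2r\<delta>)
  in comparing N^(2r) with T^(2r) must be paid; \<delta> \<le> \<epsilon>/(100 k) keeps it
  small.\<close>

lemma bilinear_short_le:
  fixes q N R k :: nat and a b :: int and \<gamma> :: "nat \<Rightarrow> real" and G B \<epsilon> \<delta> :: real and Y :: "nat \<Rightarrow> nat"
  assumes q: "prime q" and a: "coprime a (int q)" and R: "R \<ge> 1" "2 * R < q" and N: "N \<ge> 1" and k: "k \<ge> 1"
    and Y: "\<And>m. Y m < 2 * N" "\<And>m. Y m < q"
    and \<gamma>: "\<And>m. 0 \<le> \<gamma> m" "\<And>m. \<gamma> m \<le> G"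
    and big: "real q powr (1 / 2 + \<epsilon> / 2) \<le> real R * real N"
    and Nr: "real q powr (1 / (2 * real k)) \<le> real N" "real N \<le> real q powr (1 / 6)"
    and B: "\<And>n. 0 < n \<Longrightarrow> n \<le> q ^ (k + 4) \<Longrightarrow> real (ndiv n) \<le> B"
    and \<epsilon>: "0 < \<epsilon>" "\<epsilon> \<le> 1 / 10" and \<delta>: "0 < \<delta>" "\<delta> \<le> \<epsilon> / (100 * real k)"
    and q1: "8 \<le> real q powr \<delta>" and q2: "192 * 4 ^ k * (2 ^ k + real k * 2 ^ (3 * k + 1)) * B ^ (2 * k + 2) \<le> real q powr \<delta>"
  shows "norm (bisum q a b R N \<gamma> Y)
     \<le> 10 * G * real R * real N * real q powr (- \<epsilon> * \<delta> / 64)"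
proof -
  define Q where "Q = real q"
  have qq: "real q = Q" by (simp add: Q_def)
  have q0: "q > 0" using prime_gt_0_nat[OF q] .
  have Q1: "Q > 1" using prime_gt_1_nat[OF q] by (simp add: Q_def)
  have Q0: "Q > 0" using Q1 by simp
  have padd: "Q powr x * Q powr y = Q powr (x + y)" for x y by (simp add: powr_add)
  have pmono: "Q powr x \<le> Q powr y" if "x \<le> y" for x y using that Q1 by (intro powr_mono) auto
  have pone: "1 \<le> Q powr x" if "0 \<le> x" for x using that Q1 by (simp add: ge_one_powr_ge_zero)
  have ppow: "(Q powr x) ^ n = Q powr (real n * x)" for x n
    using Q0 by (simp add: powr_realpow[symmetric] powr_powr mult.commute)
  have G0: "G \<ge> 0" using \<gamma>[of 0] by simp
  have B1: "B \<ge> 1" using B[of 1] q0 by (simp add: ndiv_def Suc_le_eq)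
  have k0: "real k \<ge> 1" using k by simp
  have dk: "\<delta> * real k \<le> \<epsilon> / 100" using \<delta>(2) k0 by (simp add: field_simps)
  have d1: "\<delta> \<le> \<epsilon> / 100"
  proof -
    have "\<delta> * 1 \<le> \<delta> * real k" using k0 \<delta>(1) by (intro mult_left_mono) auto
    then show ?thesis using dk by simp
  qed
  define \<alpha> where "\<alpha> = log Q (real R)"
  define \<beta> where "\<beta> = log Q (real N)"
  have \<alpha>: "real R = Q powr \<alpha>" and \<beta>: "real N = Q powr \<beta>"
    using Q1 R N by (simp_all add: \<alpha>_def \<beta>_def)
  have \<alpha>\<beta>: "1 / 2 + \<epsilon> / 2 \<le> \<alpha> + \<beta>" using big Q1 unfolding qq \<alpha> \<beta> padd by simp
  have \<beta>1: "1 / (2 * real k) \<le> \<beta>" "\<beta> \<le> 1 / 6" using Nr Q1 unfolding qq \<beta> by simp_all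
  have \<beta>k: "1 / 2 \<le> real k * \<beta>" using \<beta>1(1) k0 by (simp add: field_simps)
  have \<beta>\<delta>: "\<delta> \<le> \<beta>"
  proof -
    have "\<delta> * real k \<le> real k * \<beta>" using dk \<beta>k \<epsilon> by linarith
    then show ?thesis using k0 by (simp add: mult.commute)
  qed
  \<comment> \<open>The least r with N^r \<ge> q^(1/2). Then N^r \<le> N^(2r) q^(-1/2), while
    minimality, N^(r-1) \<le> q^(1/2), gives N^r N^(2r-1) / q \<le> N^(2r) q^(-1/2). So both terms
    of the bound for \<open>invJ\<close> have the same target size.\<close>
  define r where "r = (LEAST r. 1 / 2 \<le> real r * \<beta>)"
  have r: "1 / 2 \<le> real r * \<beta>" unfolding r_def by (rule LeastI[where P = "\<lambda>r. 1 / 2 \<le> real r * \<beta>", OF \<beta>k])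
  have rk: "r \<le> k" unfolding r_def by (rule Least_le[where P = "\<lambda>r. 1 / 2 \<le> real r * \<beta>", OF \<beta>k])
  have r1: "r \<ge> 1" using r by (cases r) auto
  have rm: "real (r - 1) * \<beta> \<le> 1 / 2"
  proof (rule ccontr)
    assume "\<not> ?thesis"
    then have "1 / 2 \<le> real (r - 1) * \<beta>" by linarith
    then have "r \<le> r - 1" unfolding r_def by (rule Least_le[where P = "\<lambda>r. 1 / 2 \<le> real r * \<beta>"])
    then show False using r1 by simp
  qed
  have kr: "real k \<ge> real r" using rk by simp
  \<comment> \<open>Shorter than N by q^\<delta>, so that the ends lost in shifting are
    negligible.\<close>
  define T where "T = nat \<lfloor>Q powr (\<beta> - \<delta>)\<rfloor>"
  have "1 \<le> Q powr (\<beta> - \<delta>)" using \<beta>\<delta> by (intro pone) simp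
  note T = nat_floor_bounds[OF this, folded T_def]
  have T0: "real T > 0" using T(3) by simp
  define L where "L = nat \<lceil>real T * Q powr (2 * \<delta>)\<rceil>"
  note L = grid_length_bounds[OF Q1 T(3) \<delta>(1), folded L_def]
  define P where "P = {(n, u) \<in> {N..<2 * N} \<times> {1..1::nat}. n + u * T < 2 * N \<and> n + u * T < q} - {}"
  define J where "J = (\<lambda>n u. Jcount q r (\<lambda>t. rcp q (n + u * t)) T)"
  define s where "s = (\<Sum>(n, u)\<in>P. real (J n u)) / (real N * real 1 * real T ^ (2 * r))"
  define En where "En = real (energy q {1..R} (\<lambda>m. a * rcp q m)) / real R ^ 4"
  have main: "norm (bisum q a b R N \<gamma> Y) \<le>
     G * real R * (real 1 * real T + real (card ({} :: (nat \<times> nat) set)) / real 1 + real N * sqrt (2 * pi * real T / real L)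
       + real N * root (4 * r) (En * (real L * real q) * s))"
    unfolding En_def s_def P_def J_def
    by (rule bilinear_average_le[OF q0 R(1) N Y \<gamma> T(3) _ L(1) r1]) auto
  \<comment> \<open>As 2N \<le> q^(1/2), the integers that need a divisor bound in
    \<open>invJ_le\<close> are at most q^r, hence at most q^(k+4).\<close>
  have Nq: "2 * N \<le> q" "(2 * N) ^ (2 * r) \<le> q ^ (k + 4)"
  proof -
    have "real (2 * N) \<le> Q powr \<delta> * Q powr (1 / 6)"
      using q1 Nr(2) unfolding qq of_nat_mult by (intro mult_mono) auto
    also have "\<dots> \<le> Q powr (1 / 2)" unfolding padd using d1 \<epsilon> by (intro pmono) simp
    finally have h: "real (2 * N) \<le> Q powr (1 / 2)" .
    also have "\<dots> \<le> Q powr 1" by (intro pmono) simp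
    also have "\<dots> = real q" using Q0 by (simp add: Q_def)
    finally show "2 * N \<le> q" by (simp only: of_nat_le_iff)
    have "real ((2 * N) ^ (2 * r)) = real (2 * N) ^ (2 * r)" by (rule of_nat_power)
    also have "\<dots> \<le> (Q powr (1 / 2)) ^ (2 * r)" using h by (intro power_mono) auto
    also have "\<dots> = Q ^ r" unfolding ppow using Q0 by (simp add: powr_realpow)
    also have "\<dots> \<le> Q ^ (k + 4)" using Q1 rk by (intro power_increasing) auto
    also have "\<dots> = real (q ^ (k + 4))" by (simp add: Q_def)
    finally show "(2 * N) ^ (2 * r) \<le> q ^ (k + 4)" by (simp only: of_nat_le_iff)
  qed
  define c where "c = 2 ^ k + real k * 2 ^ (3 * k + 1)"
  have c0: "c \<ge> 0" by (simp add: c_def)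
  have invJ: "real (invJ q r N) \<le> c * B ^ (2 * k + 1) * Q powr (2 * real r * \<beta> - 1 / 2)"
  proof -
    have Bk: "B ^ n \<le> B ^ (2 * k + 1)" if "n \<le> 2 * k + 1" for n using B1 that by (intro power_increasing) auto
    have "real (invJ q r N) \<le> (2 * real N) ^ r * B ^ (2 * r + 1) + real N ^ r * (2 ^ (r + 2) * (real r * (2 * real N) ^ (2 * r - 1) / real q) * B ^ r)"
      using Nq by (intro invJ_le q N r1 B) auto
    also have "\<dots> \<le> 2 ^ k * Q powr (2 * real r * \<beta> - 1 / 2) * B ^ (2 * k + 1) + (real k * 2 ^ (3 * k + 1)) * Q powr (2 * real r * \<beta> - 1 / 2) * B ^ (2 * k + 1)"
    proof (rule add_mono)
      have "(2 * real N) ^ r = 2 ^ r * Q powr (real r * \<beta>)" by (simp add: \<beta> power_mult_distrib ppow)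
      also have "\<dots> \<le> 2 ^ k * Q powr (2 * real r * \<beta> - 1 / 2)"
      proof -
        have "2 * real r * \<beta> = 2 * (real r * \<beta>)" by simp
        then have "real r * \<beta> \<le> 2 * real r * \<beta> - 1 / 2" using r by linarith
        then show ?thesis using rk by (intro mult_mono power_increasing pmono) auto
      qed
      finally show "(2 * real N) ^ r * B ^ (2 * r + 1) \<le> 2 ^ k * Q powr (2 * real r * \<beta> - 1 / 2) * B ^ (2 * k + 1)"
        using rk B1 by (intro mult_mono Bk) auto
      have e1: "real N ^ r = Q powr (real r * \<beta>)" by (simp add: \<beta> ppow)
      have e2: "(2 * real N) ^ (2 * r - 1) = 2 ^ (2 * r - 1) * Q powr (real (2 * r - 1) * \<beta>)" by (simp add: \<beta> power_mult_distrib ppow)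
      have e3: "2 ^ (r + 2) * 2 ^ (2 * r - 1) = (2::real) ^ (3 * r + 1)"
      proof -
        have "r + 2 + (2 * r - 1) = 3 * r + 1" using r1 by simp
        then show ?thesis by (simp only: power_add[symmetric])
      qed
      have "real N ^ r * (2 ^ (r + 2) * (real r * (2 * real N) ^ (2 * r - 1) / real q))
          = (real r * (2 ^ (r + 2) * 2 ^ (2 * r - 1))) * (Q powr (real r * \<beta>) * Q powr (real (2 * r - 1) * \<beta>) / Q)"
        unfolding e1 e2 qq by simp
      also have "\<dots> = (real r * 2 ^ (3 * r + 1)) * Q powr (real r * \<beta> + real (2 * r - 1) * \<beta> - 1)"
        unfolding e3 padd using Q0 by (simp add: powr_diff)
      also have "\<dots> \<le> (real k * 2 ^ (3 * k + 1)) * Q powr (2 * real r * \<beta> - 1 / 2)"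
      proof (intro mult_mono power_increasing pmono)
        have "real (2 * r - 1) = real r + real (r - 1)" using r1 by (simp add: of_nat_diff)
        then have "real (2 * r - 1) * \<beta> = real r * \<beta> + real (r - 1) * \<beta>" by (simp add: distrib_right)
        then show "real r * \<beta> + real (2 * r - 1) * \<beta> - 1 \<le> 2 * real r * \<beta> - 1 / 2" using rm by simp
      qed (use rk in auto)
      finally have le: "real N ^ r * (2 ^ (r + 2) * (real r * (2 * real N) ^ (2 * r - 1) / real q))
         \<le> (real k * 2 ^ (3 * k + 1)) * Q powr (2 * real r * \<beta> - 1 / 2)" .
      have "real N ^ r * (2 ^ (r + 2) * (real r * (2 * real N) ^ (2 * r - 1) / real q)) * B ^ r
         \<le> (real k * 2 ^ (3 * k + 1)) * Q powr (2 * real r * \<beta> - 1 / 2) * B ^ (2 * k + 1)"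
        by (rule mult_mono[OF le Bk]) (use rk B1 in auto)
      then show "real N ^ r * (2 ^ (r + 2) * (real r * (2 * real N) ^ (2 * r - 1) / real q) * B ^ r)
         \<le> (real k * 2 ^ (3 * k + 1)) * Q powr (2 * real r * \<beta> - 1 / 2) * B ^ (2 * k + 1)"
        by (simp only: mult.assoc)
    qed
    also have "\<dots> = c * B ^ (2 * k + 1) * Q powr (2 * real r * \<beta> - 1 / 2)" by (simp add: c_def algebra_simps)
    finally show ?thesis .
  qed
  have s0: "0 \<le> s" unfolding s_def by (intro divide_nonneg_nonneg sum_nonneg) auto
  have s: "s \<le> 4 ^ k * (c * B ^ (2 * k + 1)) * Q powr (2 * real k * \<delta> - 1 / 2)"
  proof -
    have "(\<Sum>(n, u)\<in>P. real (J n u)) \<le> (\<Sum>(n, u)\<in>P. real (invJ q r N))"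
    proof (intro sum_mono)
      fix p assume "p \<in> P"
      then obtain n where p: "p = (n, 1)" "N \<le> n" "n + T \<le> 2 * N" by (auto simp: P_def)
      show "(case p of (n, u) \<Rightarrow> real (J n u)) \<le> (case p of (n, u) \<Rightarrow> real (invJ q r N))"
        using Jcount_interval_le[OF p(2,3), of q r] by (simp add: p(1) J_def)
    qed
    also have "\<dots> = real (card P) * real (invJ q r N)" by (simp add: case_prod_beta)
    also have "\<dots> \<le> real N * real (invJ q r N)"
    proof (intro mult_right_mono)
      have "card P \<le> card ({N..<2 * N} \<times> {1..1::nat})" by (intro card_mono) (auto simp: P_def)
      then show "real (card P) \<le> real N" by (simp add: card_cartesian_product)
    qed auto
    finally have "s \<le> real N * real (invJ q r N) / (real N * real 1 * real T ^ (2 * r))"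
      unfolding s_def by (intro divide_right_mono) auto
    also have "\<dots> = real (invJ q r N) / real T ^ (2 * r)" using N by simp
    also have "\<dots> \<le> (c * B ^ (2 * k + 1) * Q powr (2 * real r * \<beta> - 1 / 2)) / (Q powr (\<beta> - \<delta>) / 2) ^ (2 * r)"
      using invJ T(1) Q0 by (intro frac_le power_mono) auto
    also have "(Q powr (\<beta> - \<delta>) / 2) ^ (2 * r) = Q powr (2 * real r * (\<beta> - \<delta>)) / 4 ^ r"
    proof -
      have "real (2 * r) * (\<beta> - \<delta>) = 2 * real r * (\<beta> - \<delta>)" by simp
      moreover have "(2::real) ^ (2 * r) = 4 ^ r" by (simp add: power_mult)
      ultimately show ?thesis unfolding power_divide ppow by (simp only:)
    qed
    also have "(c * B ^ (2 * k + 1) * Q powr (2 * real r * \<beta> - 1 / 2)) / (Q powr (2 * real r * (\<beta> - \<delta>)) / 4 ^ r)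
       = 4 ^ r * (c * B ^ (2 * k + 1)) * (Q powr (2 * real r * \<beta> - 1 / 2) / Q powr (2 * real r * (\<beta> - \<delta>)))"
      by simp
    also have "Q powr (2 * real r * \<beta> - 1 / 2) / Q powr (2 * real r * (\<beta> - \<delta>)) = Q powr (2 * real r * \<delta> - 1 / 2)"
      unfolding powr_diff[symmetric] by (rule arg_cong[of _ _ "(powr) Q"]) (simp add: algebra_simps)
    also have "4 ^ r * (c * B ^ (2 * k + 1)) * Q powr (2 * real r * \<delta> - 1 / 2) \<le> 4 ^ k * (c * B ^ (2 * k + 1)) * Q powr (2 * real k * \<delta> - 1 / 2)"
      using rk c0 B1 \<delta>(1) by (intro mult_mono power_increasing pmono) auto
    finally show ?thesis .
  qed
  have En: "En \<le> 12 * B * (Q powr (- 2 * \<alpha>) + Q powr (- \<alpha> / 2 - 1 / 2))"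
  proof -
    have B4: "real (ndiv n) \<le> B" if "0 < n" "n \<le> q ^ 4" for n
    proof (rule B[OF that(1)])
      have "q ^ 4 \<le> q ^ (k + 4)" using q0 by (intro power_increasing) auto
      then show "n \<le> q ^ (k + 4)" using that by linarith
    qed
    show ?thesis unfolding En_def Q_def using \<alpha> by (intro energy_normalised_le q R a B4) (auto simp: Q_def)
  qed
  have L4: "real L \<le> 2 * Q powr (\<beta> + \<delta>)"
  proof -
    have "real L \<le> 2 * (Q powr (\<beta> - \<delta>) * Q powr (2 * \<delta>))" using L(2) T(2) by (intro order_trans[OF L(2)] mult_left_mono mult_right_mono) auto
    also have "\<dots> = 2 * Q powr (\<beta> + \<delta>)" by (simp add: padd add.commute)
    finally show ?thesis .
  qed
  have V: "En * (real L * real q) * s \<le> Q powr (- \<epsilon> / 8)"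
  proof -
    have "En * (real L * real q) * s \<le> (12 * B * (Q powr (- 2 * \<alpha>) + Q powr (- \<alpha> / 2 - 1 / 2))) * ((2 * Q powr (\<beta> + \<delta>)) * Q powr 1)
        * (4 ^ k * (c * B ^ (2 * k + 1)) * Q powr (2 * real k * \<delta> - 1 / 2))"
      using En L4 s s0 B1 Q0 unfolding qq by (intro mult_mono) (auto simp: En_def)
    also have "\<dots> = (24 * 4 ^ k * c * (B * B ^ (2 * k + 1))) * ((Q powr (- 2 * \<alpha>) + Q powr (- \<alpha> / 2 - 1 / 2)) * (Q powr (\<beta> + \<delta>) * Q powr 1 * Q powr (2 * real k * \<delta> - 1 / 2)))"
      by (simp only: mult_ac)
    also have "\<dots> \<le> (Q powr \<delta> / 8) * ((Q powr (- 2 * \<alpha>) + Q powr (- \<alpha> / 2 - 1 / 2)) * (Q powr (\<beta> + \<delta>) * Q powr 1 * Q powr (2 * real k * \<delta> - 1 / 2)))"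
    proof (intro mult_right_mono)
      have e: "B * B ^ (2 * k + 1) = B ^ (2 * k + 2)" by simp
      show "24 * 4 ^ k * c * (B * B ^ (2 * k + 1)) \<le> Q powr \<delta> / 8"
        using q2 unfolding qq e c_def by simp
    qed auto
    also have "\<dots> = (Q powr (\<delta> + (- 2 * \<alpha> + (\<beta> + \<delta> + 1 + (2 * real k * \<delta> - 1 / 2)))) + Q powr (\<delta> + (- \<alpha> / 2 - 1 / 2 + (\<beta> + \<delta> + 1 + (2 * real k * \<delta> - 1 / 2))))) / 8"
    proof -
      have *: "(d / 8) * ((x + y) * z) = (d * (x * z) + d * (y * z)) / 8" for d x y z :: real
        by (simp add: field_simps)
      show ?thesis unfolding * padd ..
    qed
    also have "\<dots> \<le> (Q powr (- \<epsilon> / 8) + Q powr (- \<epsilon> / 8)) / 8"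
    proof (intro divide_right_mono add_mono pmono)
      have dk': "2 * real k * \<delta> \<le> \<epsilon> / 50" using dk by (simp add: mult.commute)
      \<comment> \<open>Up to multiples of \<delta>, the two exponents are at most 3\<beta> - 1/2 -
        \<epsilon> and half of 3\<beta> - 1/2 - \<epsilon>/2. Both have main term 0 at \<beta> =
        1/6.\<close>
      show "\<delta> + (- 2 * \<alpha> + (\<beta> + \<delta> + 1 + (2 * real k * \<delta> - 1 / 2))) \<le> - \<epsilon> / 8"
        using \<alpha>\<beta> \<beta>1(2) \<epsilon> d1 dk' by simp
      show "\<delta> + (- \<alpha> / 2 - 1 / 2 + (\<beta> + \<delta> + 1 + (2 * real k * \<delta> - 1 / 2))) \<le> - \<epsilon> / 8"
        using \<alpha>\<beta> \<beta>1(2) \<epsilon> d1 dk' by simp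
    qed auto
    also have "\<dots> \<le> Q powr (- \<epsilon> / 8)" using powr_ge_zero[of Q "- \<epsilon> / 8"] by simp
    finally show ?thesis .
  qed
  moreover have "real (4 * r) * \<delta> \<le> 8"
  proof -
    have "real r * \<delta> \<le> real k * \<delta>" using kr \<delta>(1) by (intro mult_right_mono) auto
    then show ?thesis using dk \<epsilon> by (simp add: mult.commute)
  qed
  ultimately have b4: "root (4 * r) (En * (real L * real q) * s) \<le> Q powr (- \<epsilon> * \<delta> / 64)"
    using r1 by (intro root_le_powr_saving Q1 \<epsilon>) auto
  have d: "Q powr (- \<delta>) \<le> Q powr (- \<epsilon> * \<delta> / 64)" by (rule powr_le_powr_saving[OF Q1 \<epsilon> \<delta>(1) order_refl])
  have b1: "real 1 * real T \<le> real N * Q powr (- \<delta>)"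
    using T(2) by (simp add: \<beta> padd)
  have "real 1 * real T + real (card ({} :: (nat \<times> nat) set)) / real 1 + real N * sqrt (2 * pi * real T / real L)
       + real N * root (4 * r) (En * (real L * real q) * s)
     \<le> real N * Q powr (- \<delta>) + 0 + real N * (3 * Q powr (- \<delta>)) + real N * Q powr (- \<epsilon> * \<delta> / 64)"
    using b1 L(4) b4 by (intro add_mono mult_left_mono) auto
  also have "\<dots> = real N * (4 * Q powr (- \<delta>) + Q powr (- \<epsilon> * \<delta> / 64))" by (simp add: algebra_simps)
  also have "\<dots> \<le> real N * (10 * Q powr (- \<epsilon> * \<delta> / 64))"
  proof (rule mult_left_mono)
    have "0 \<le> Q powr (- \<epsilon> * \<delta> / 64)" by (rule powr_ge_zero)
    with d show "4 * Q powr (- \<delta>) + Q powr (- \<epsilon> * \<delta> / 64) \<le> 10 * Q powr (- \<epsilon> * \<delta> / 64)" by linarith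
  qed simp
  finally have "norm (bisum q a b R N \<gamma> Y) \<le> G * real R * (real N * (10 * Q powr (- \<epsilon> * \<delta> / 64)))"
    using G0 by (intro order_trans[OF main] mult_left_mono) auto
  then show ?thesis by (simp add: qq mult_ac)
qed

subsection \<open>Bilinear sums in all ranges\<close>

text \<open>When N is this large the other factor may be tiny and cannot help. Its reciprocal is a
  unit, so it only changes \<open>a\<close>, and each sum over \<open>n\<close> is bounded on its
  own.\<close>

lemma bilinear_long_le:
  fixes q N R r :: nat and a b :: int and \<gamma> :: "nat \<Rightarrow> real" and G \<epsilon> \<delta> :: real and Y :: "nat \<Rightarrow> nat"
  assumes q: "prime q" and a: "coprime a (int q)" and R: "2 * R < q" and N: "N \<ge> 1" "N \<le> q"
    and Y: "\<And>m. Y m < 2 * N" "\<And>m. Y m < q"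
    and \<gamma>: "\<And>m. 0 \<le> \<gamma> m" "\<And>m. \<gamma> m \<le> G"
    and big: "real q powr (1 / 2 + \<epsilon> / 8) \<le> real N"
    and \<epsilon>: "0 < \<epsilon>" "\<epsilon> \<le> 1 / 10" and \<delta>: "0 < \<delta>" "\<delta> \<le> \<epsilon> / 100"
    and r: "1 / \<delta> \<le> real r" "real r \<le> 2 / \<delta>" "r < q"
    and q1: "8 \<le> real q powr \<delta>" and q2: "8 * (real r ^ r + 2 * real r) \<le> real q powr \<delta>"
  shows "norm (bisum q a b R N \<gamma> Y)
     \<le> 10 * G * real R * real N * real q powr (- \<epsilon> * \<delta> / 64)"
proof -
  have "norm (bisum q a b R N \<gamma> Y) \<le> (\<Sum>m\<in>{1..R}. G * (10 * real N * real q powr (- \<epsilon> * \<delta> / 64)))"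
  proof (rule sum_norm_le)
    fix m assume m: "m \<in> {1..R}"
    have "coprime (int m) (int q)" using m R by (intro coprime_int_prime_less q) auto
    then have "coprime (a * rcp q m) (int q)" using a coprime_modinv by simp
    then have "norm (\<Sum>n\<in>{N..Y m}. kloo q a b m n) \<le> 10 * real N * real q powr (- \<epsilon> * \<delta> / 64)"
      unfolding kloo_def by (rule long_sum_le[OF q _ N Y big \<epsilon> \<delta> r q1 q2])
    then show "norm (of_real (\<gamma> m) * (\<Sum>n\<in>{N..Y m}. kloo q a b m n)) \<le> G * (10 * real N * real q powr (- \<epsilon> * \<delta> / 64))"
      unfolding norm_mult using \<gamma>[of m] by (intro mult_mono) auto
  qed
  then show ?thesis by (simp add: mult_ac)
qed

text \<open>One threshold serves all three ranges because each asks only that a constant times at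
  most \<open>B ^ (2 * k + 2)\<close> be below q^\<delta>.\<close>

lemma bilinear_all_ranges:
  fixes k :: nat and \<epsilon> \<delta> :: real
  assumes k: "k \<ge> 1" and \<epsilon>: "0 < \<epsilon>" "\<epsilon> \<le> 1 / 10" and \<delta>: "\<delta> = \<epsilon> / (100 * real k)"
  shows "\<exists>q0::real. \<forall>(q::nat) (a::int) (b::int) (R::nat) (N::nat) (G::real) \<gamma> Y.
     prime q \<longrightarrow> real q \<ge> q0 \<longrightarrow> coprime a (int q) \<longrightarrow> R \<ge> 1 \<longrightarrow> 2 * R < q \<longrightarrow> N \<ge> 1 \<longrightarrow> N \<le> q \<longrightarrow>
     (\<forall>m. Y m < 2 * N \<and> Y m < q) \<longrightarrow> (\<forall>m. 0 \<le> \<gamma> m \<and> \<gamma> m \<le> G) \<longrightarrow>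
     real q powr (1 / 2 + \<epsilon> / 2) \<le> real R * real N \<longrightarrow> real q powr (1 / (2 * real k)) \<le> real N \<longrightarrow>
     norm (bisum q a b R N \<gamma> Y)
       \<le> 10 * G * real R * real N * real q powr (- \<epsilon> * \<delta> / 64)"
proof -
  have k0: "real k \<ge> 1" using k by simp
  have \<delta>0: "0 < \<delta>" using \<epsilon> k0 by (simp add: \<delta>)
  have \<delta>1: "\<delta> \<le> \<epsilon> / 100" unfolding \<delta> using \<epsilon> k0 by (intro frac_le) auto
  define r where "r = nat \<lceil>1 / \<delta>\<rceil>"
  have "1 \<le> 1 / \<delta>" using \<delta>0 \<delta>1 \<epsilon> by simp
  note r = nat_ceiling_bounds[OF this, folded r_def]
  \<comment> \<open>Solves \<eta> (k + 4) (2k + 2) = \<delta>/2: divisor bounds up to q^(k+4),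
    raised to the power 2k + 2, then cost exactly q^(\<delta>/2). The range q^(k+4) covers both the
    energy (q^4) and the tuple products.\<close>
  define \<eta> where "\<eta> = \<delta> / (2 * (2 * real k + 2) * (real k + 4))"
  have \<eta>0: "\<eta> > 0" using \<delta>0 k0 by (simp add: \<eta>_def)
  obtain C where C: "C \<ge> 1" "\<And>n. n > 0 \<Longrightarrow> real (ndiv n) \<le> C * real n powr \<eta>"
    using divisor_bound[OF \<eta>0] by blast
  define c where "c = 192 * 4 ^ k * (2 ^ k + real k * 2 ^ (3 * k + 1))"
  define c' where "c' = 192 * (real r ^ r + 8 * real r)"
  define K where "K = (c + c' + 8) * C ^ (2 * k + 2)"
  have c0: "c \<ge> 0" "c' \<ge> 0" by (simp_all add: c_def c'_def)
  have Ck: "1 \<le> C ^ (2 * k + 2)" using C(1) by (rule one_le_power)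
  have K8: "8 \<le> K"
  proof -
    have "8 * 1 \<le> (c + c' + 8) * C ^ (2 * k + 2)" using c0 Ck by (intro mult_mono) auto
    then show ?thesis by (simp add: K_def)
  qed
  show ?thesis
  \<comment> \<open>The first entry gives K \<le> q^(\<delta>/2), the half of q^\<delta> not spent
    on divisors; the second gives r < q.\<close>
  proof (rule exI[of _ "max (K powr (2 / \<delta>)) (real r + 1)"], intro allI impI)
    fix q R N :: nat and a b :: int and G :: real and \<gamma> :: "nat \<Rightarrow> real" and Y :: "nat \<Rightarrow> nat"
    assume q: "prime q" and qq0: "real q \<ge> max (K powr (2 / \<delta>)) (real r + 1)" and a: "coprime a (int q)"
      and R: "R \<ge> 1" "2 * R < q" and N: "N \<ge> 1" "N \<le> q"
      and Y: "\<forall>m. Y m < 2 * N \<and> Y m < q" and \<gamma>: "\<forall>m. 0 \<le> \<gamma> m \<and> \<gamma> m \<le> G"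
      and big: "real q powr (1 / 2 + \<epsilon> / 2) \<le> real R * real N" and Nk: "real q powr (1 / (2 * real k)) \<le> real N"
    have q0: "real q > 0" using prime_gt_0_nat[OF q] by simp
    have q1: "real q \<ge> 1" using prime_gt_0_nat[OF q] by simp
    have rq: "r < q" using qq0 by simp
    have Kq: "K \<le> real q powr (\<delta> / 2)"
    proof -
      have "K = (K powr (2 / \<delta>)) powr (\<delta> / 2)" using K8 \<delta>0 by (simp add: powr_powr)
      also have "\<dots> \<le> real q powr (\<delta> / 2)" using qq0 \<delta>0 by (intro powr_mono2) auto
      finally show ?thesis .
    qed
    have half: "real q powr (\<delta> / 2) * real q powr (\<delta> / 2) = real q powr \<delta>" by (simp flip: powr_add)
    have one: "1 \<le> real q powr (\<delta> / 2)" using q1 \<delta>0 by (simp add: ge_one_powr_ge_zero)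
    have halfle: "real q powr (\<delta> / 2) \<le> real q powr \<delta>" using q1 \<delta>0 by (intro powr_mono) auto
    have big8: "8 \<le> real q powr \<delta>" using K8 Kq halfle by linarith
    define B where "B = C * real q powr (\<eta> * (real k + 4))"
    have Bk: "B ^ (2 * k + 2) = C ^ (2 * k + 2) * real q powr (\<delta> / 2)"
    proof -
      have "(real q powr (\<eta> * (real k + 4))) ^ (2 * k + 2) = real q powr (\<eta> * (real k + 4) * real (2 * k + 2))"
        unfolding powr_powr[symmetric] using q0 by (intro powr_realpow[symmetric]) simp
      also have "\<eta> * (real k + 4) * real (2 * k + 2) = \<delta> / 2"
      proof -
        have "real k + 4 \<noteq> 0" "2 * real k + 2 \<noteq> 0" using k0 by linarith+
        then show ?thesis unfolding \<eta>_def by (simp add: divide_simps)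
      qed
      finally show ?thesis by (simp add: B_def power_mult_distrib)
    qed
    have Bdiv: "real (ndiv n) \<le> B" if "0 < n" "n \<le> q ^ (k + 4)" for n
    proof -
      have "real n \<le> real (q ^ (k + 4))" using that by (simp only: of_nat_le_iff)
      also have "\<dots> = real q powr (real k + 4)"
        using q0 powr_realpow[of "real q" "k + 4"] by (simp add: add.commute)
      finally have "real n powr \<eta> \<le> (real q powr (real k + 4)) powr \<eta>" using \<eta>0 by (intro powr_mono2) auto
      then have "C * real n powr \<eta> \<le> B" unfolding B_def powr_powr using C(1) by (simp add: mult.commute mult_left_mono)
      then show ?thesis using C(2)[OF that(1)] by linarith
    qed
    have B1: "B \<ge> 1" using Bdiv[of 1] q1 prime_gt_0_nat[OF q] by (simp add: ndiv_def)
    have lim: "t * B ^ (2 * k + 2) \<le> real q powr \<delta>" if "0 \<le> t" "t \<le> c + c' + 8" for t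
    proof -
      have "t * B ^ (2 * k + 2) = (t * C ^ (2 * k + 2)) * real q powr (\<delta> / 2)" by (simp only: Bk mult.assoc)
      also have "\<dots> \<le> K * real q powr (\<delta> / 2)" unfolding K_def using that Ck by (intro mult_right_mono) auto
      also have "\<dots> \<le> real q powr (\<delta> / 2) * real q powr (\<delta> / 2)" using Kq by (intro mult_right_mono) auto
      finally show ?thesis by (simp add: half)
    qed
    have r2: "real r \<le> 2 / \<delta>" using r(2) by simp
    show "norm (bisum q a b R N \<gamma> Y)
       \<le> 10 * G * real R * real N * real q powr (- \<epsilon> * \<delta> / 64)"
    proof (cases "real N \<le> real q powr (1 / 6)")
      case True
      show ?thesis
      proof (rule bilinear_short_le[OF q a R N(1) k _ _ _ _ big Nk True Bdiv \<epsilon> \<delta>0 _ big8])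
        show "192 * 4 ^ k * (2 ^ k + real k * 2 ^ (3 * k + 1)) * B ^ (2 * k + 2) \<le> real q powr \<delta>"
          using lim[of c] c0 by (simp add: c_def)
      qed (use Y \<gamma> \<delta> in auto)
    next
      case False
      have BB: "B \<le> B ^ (2 * k + 2)" using B1 power_increasing[of 1 "2 * k + 2" B] by simp
      show ?thesis
      proof (cases "real N \<le> real q powr (1 / 2 + \<epsilon> / 8)")
        case True
        show ?thesis
        proof (rule bilinear_medium_le[OF q a R N(1) _ _ _ _ big _ True _ \<epsilon> \<delta>0 \<delta>1 r(1) r2 rq big8])
          show "192 * B * (real r ^ r + 8 * real r) \<le> real q powr \<delta>"
          proof -
            have "192 * B * (real r ^ r + 8 * real r) = c' * B" by (simp add: c'_def)
            also have "\<dots> \<le> c' * B ^ (2 * k + 2)" using BB c0 by (intro mult_left_mono)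
            also have "\<dots> \<le> real q powr \<delta>" using c0 by (intro lim) auto
            finally show ?thesis .
          qed
          show "real (ndiv n) \<le> B" if "0 < n" "n \<le> q ^ 4" for n
          proof (rule Bdiv[OF that(1)])
            have "q ^ 4 \<le> q ^ (k + 4)" using prime_gt_0_nat[OF q] by (intro power_increasing) auto
            then show "n \<le> q ^ (k + 4)" using that by linarith
          qed
        qed (use Y \<gamma> \<open>\<not> real N \<le> real q powr (1 / 6)\<close> in auto)
      next
        case False
        show ?thesis
        proof (rule bilinear_long_le[OF q a R(2) N _ _ _ _ _ \<epsilon> \<delta>0 \<delta>1 r(1) r2 rq big8])
          have "8 * (real r ^ r + 2 * real r) \<le> c'" unfolding c'_def by simp
          also have "c' = c' * 1" by simp
          also have "c' * 1 \<le> c' * B ^ (2 * k + 2)" using B1 c0 by (intro mult_left_mono one_le_power)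
          also have "\<dots> \<le> real q powr \<delta>" using c0 by (intro lim) auto
          finally show "8 * (real r ^ r + 2 * real r) \<le> real q powr \<delta>" .
        qed (use Y \<gamma> False in auto)
      qed
    qed
  qed
qed

subsection \<open>Dyadic decomposition of the divisor sum\<close>

definition box :: "nat set \<Rightarrow> (nat \<Rightarrow> nat) \<Rightarrow> (nat \<Rightarrow> nat) set" where
  "box I l = (\<Pi>\<^sub>E i\<in>I. {2 ^ l i..<2 * 2 ^ l i})"

lemma finite_box: "finite I \<Longrightarrow> finite (box I l)"
  by (simp add: box_def finite_PiE)

lemma card_box: "finite I \<Longrightarrow> card (box I l) = (\<Prod>i\<in>I. 2 ^ l i)"
  by (simp add: box_def card_PiE)

lemma box_prod_bounds:
  assumes "finite I" "f \<in> box I l"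
  shows "(\<Prod>i\<in>I. 2 ^ l i) \<le> (\<Prod>i\<in>I. f i)" "(\<Prod>i\<in>I. f i) \<le> 2 ^ card I * (\<Prod>i\<in>I. 2 ^ l i)"
proof -
  have f: "2 ^ l i \<le> f i" "f i \<le> 2 * 2 ^ l i" if "i \<in> I" for i
    using assms(2) that by (force simp: box_def PiE_iff)+
  show "(\<Prod>i\<in>I. 2 ^ l i) \<le> (\<Prod>i\<in>I. f i)" using f by (intro prod_mono) auto
  have "(\<Prod>i\<in>I. f i) \<le> (\<Prod>i\<in>I. 2 * 2 ^ l i)" using f by (intro prod_mono) auto
  also have "\<dots> = 2 ^ card I * (\<Prod>i\<in>I. 2 ^ l i)" using assms(1) by (simp add: prod.distrib)
  finally show "(\<Prod>i\<in>I. f i) \<le> 2 ^ card I * (\<Prod>i\<in>I. 2 ^ l i)" .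
qed

text \<open>Updating at \<open>j\<close> matches a tuple with its restriction and its j-th entry;
  the restriction is \<open>undefined\<close> at \<open>j\<close>, as extensional functions
  require.\<close>

lemma box_split:
  fixes h :: "nat \<Rightarrow> complex"
  assumes I: "finite I" "j \<in> I"
  shows "(\<Sum>f\<in>{f \<in> box I l. P (\<Prod>i\<in>I. f i)}. h (\<Prod>i\<in>I. f i))
     = (\<Sum>g\<in>box (I - {j}) l. \<Sum>n\<in>{n \<in> {2 ^ l j..<2 * 2 ^ l j}. P ((\<Prod>i\<in>I - {j}. g i) * n)}. h ((\<Prod>i\<in>I - {j}. g i) * n))"
proof -
  let ?S = "Sigma (box (I - {j}) l) (\<lambda>g. {n \<in> {2 ^ l j..<2 * 2 ^ l j}. P ((\<Prod>i\<in>I - {j}. g i) * n)})"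
  have pr: "(\<Prod>i\<in>I. (g(j := n)) i) = (\<Prod>i\<in>I - {j}. g i) * n" for g :: "nat \<Rightarrow> nat" and n
  proof -
    have "(\<Prod>i\<in>I. (g(j := n)) i) = (g(j := n)) j * (\<Prod>i\<in>I - {j}. (g(j := n)) i)" using I by (rule prod.remove)
    also have "(\<Prod>i\<in>I - {j}. (g(j := n)) i) = (\<Prod>i\<in>I - {j}. g i)" by (intro prod.cong) auto
    finally show ?thesis by (simp add: mult.commute)
  qed
  have "(\<Sum>f\<in>{f \<in> box I l. P (\<Prod>i\<in>I. f i)}. h (\<Prod>i\<in>I. f i)) = (\<Sum>(g, n)\<in>?S. h ((\<Prod>i\<in>I - {j}. g i) * n))"
  proof (rule sum.reindex_bij_witness[where i = "\<lambda>(g, n). g(j := n)" and j = "\<lambda>f. (f(j := undefined), f j)"])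
    fix f assume f: "f \<in> {f \<in> box I l. P (\<Prod>i\<in>I. f i)}"
    then have fp: "P ((\<Prod>i\<in>I - {j}. (f(j := undefined)) i) * f j)"
      using pr[of "f(j := undefined)" "f j"] by simp
    show "(case (f(j := undefined), f j) of (g, n) \<Rightarrow> g(j := n)) = f" by simp
    show "(f(j := undefined), f j) \<in> ?S"
      using f fp I by (auto simp: box_def PiE_iff extensional_def)
    show "(case (f(j := undefined), f j) of (g, n) \<Rightarrow> h ((\<Prod>i\<in>I - {j}. g i) * n)) = h (\<Prod>i\<in>I. f i)"
      using pr[of "f(j := undefined)" "f j"] by simp
  next
    fix z assume z: "z \<in> ?S"
    obtain g n where gn: "z = (g, n)" by (cases z)
    have gj: "g j = undefined" using z gn by (auto simp: box_def PiE_iff extensional_def)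
    show "((case z of (g, n) \<Rightarrow> g(j := n))(j := undefined), (case z of (g, n) \<Rightarrow> g(j := n)) j) = z"
      using gj by (auto simp: gn fun_upd_idem)
    show "(case z of (g, n) \<Rightarrow> g(j := n)) \<in> {f \<in> box I l. P (\<Prod>i\<in>I. f i)}"
      using z I pr[of g n] by (auto simp: gn box_def PiE_iff extensional_def)
  qed
  also have "\<dots> = (\<Sum>g\<in>box (I - {j}) l. \<Sum>n\<in>{n \<in> {2 ^ l j..<2 * 2 ^ l j}. P ((\<Prod>i\<in>I - {j}. g i) * n)}. h ((\<Prod>i\<in>I - {j}. g i) * n))"
    using I by (intro sum.Sigma[symmetric] ballI finite_box) auto
  finally show ?thesis .
qed

definition phase :: "nat \<Rightarrow> int \<Rightarrow> int \<Rightarrow> nat \<Rightarrow> complex" where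
  "phase q a b n = eq (int q) (a * rcp q n + b * int n)"

lemma norm_phase [simp]: "norm (phase q a b n) = 1"
  by (simp add: phase_def)

lemma phase_mult:
  assumes "coprime (int m) (int q)" "coprime (int n) (int q)"
  shows "phase q a b (m * n) = kloo q a b m n"
proof -
  let ?x = "rcp q m" and ?y = "rcp q n"
  have cop: "coprime (int (m * n)) (int q)" using assms by simp
  have "[(int m * ?x) * (int n * ?y) = 1 * 1] (mod int q)" by (intro cong_mult modinv_cong assms)
  moreover have "(int m * ?x) * (int n * ?y) = int (m * n) * (?x * ?y)" by simp
  ultimately have "[int (m * n) * rcp q (m * n) = int (m * n) * (?x * ?y)] (mod int q)"
    using modinv_cong[OF cop] by (metis cong_sym cong_trans mult_1)
  then have "[rcp q (m * n) = ?x * ?y] (mod int q)" using cop cong_mult_lcancel by blast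
  then have "[a * rcp q (m * n) + b * int (m * n) = a * (?x * ?y) + b * int (m * n)] (mod int q)"
    by (intro cong_add cong_scalar_left) auto
  then have "phase q a b (m * n) = eq (int q) (a * (?x * ?y) + b * int (m * n))"
    unfolding phase_def by (rule eq_cong)
  then show ?thesis by (simp add: kloo_def mult.assoc)
qed

text \<open>Enlarging the coordinate range from {1..n} to {1..X} adds no tuples, since a coordinate
  divides the product \<open>n\<close>. The range thereby no longer depends on
  \<open>n\<close>.\<close>

lemma divisor_sum_eq_tuple_sum:
  fixes h :: "nat \<Rightarrow> complex"
  shows "(\<Sum>n\<in>{n \<in> {1..X}. P n}. of_nat (divisor_k k n) * h n)
     = (\<Sum>f\<in>{f \<in> {0..<k} \<rightarrow>\<^sub>E {1..X}. (\<Prod>i\<in>{0..<k}. f i) \<le> X \<and> P (\<Prod>i\<in>{0..<k}. f i)}. h (\<Prod>i\<in>{0..<k}. f i))"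
proof -
  let ?p = "\<lambda>f. \<Prod>i\<in>{0..<k}. f i"
  let ?F = "{f \<in> {0..<k} \<rightarrow>\<^sub>E {1..X}. ?p f \<le> X \<and> P (?p f)}"
  have finF: "finite ?F" by (rule finite_subset[of _ "{0..<k} \<rightarrow>\<^sub>E {1..X}"]) (auto intro: finite_PiE)
  have pos: "?p f \<ge> 1" if "f \<in> {0..<k} \<rightarrow>\<^sub>E {1..X}" for f
  proof -
    have "?p f > 0" using that by (intro prod_pos) (force simp: PiE_iff)
    then show ?thesis by linarith
  qed
  have "(\<Sum>f\<in>?F. h (?p f)) = (\<Sum>n\<in>{n \<in> {1..X}. P n}. \<Sum>f\<in>{f \<in> ?F. ?p f = n}. h (?p f))"
    using finF pos by (intro sum.group[symmetric]) auto
  also have "\<dots> = (\<Sum>n\<in>{n \<in> {1..X}. P n}. of_nat (divisor_k k n) * h n)"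
  proof (intro sum.cong refl)
    fix n assume n: "n \<in> {n \<in> {1..X}. P n}"
    have "{f \<in> ?F. ?p f = n} = {f \<in> {0..<k} \<rightarrow>\<^sub>E {1..n}. (\<Prod>i<k. f i) = n}"
    proof (intro equalityI subsetI)
      fix f assume f: "f \<in> {f \<in> ?F. ?p f = n}"
      have "f i \<in> {1..n}" if "i \<in> {0..<k}" for i
      proof -
        have "f i dvd ?p f" using that by (intro dvd_prodI) auto
        then have "f i \<le> n" using f n by (auto dest: dvd_imp_le)
        then show ?thesis using f that by (auto simp: PiE_iff)
      qed
      then show "f \<in> {f \<in> {0..<k} \<rightarrow>\<^sub>E {1..n}. (\<Prod>i<k. f i) = n}"
        using f by (auto simp: PiE_iff atLeast0LessThan)
    next
      fix f assume f: "f \<in> {f \<in> {0..<k} \<rightarrow>\<^sub>E {1..n}. (\<Prod>i<k. f i) = n}"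
      then show "f \<in> {f \<in> ?F. ?p f = n}" using n by (force simp: PiE_iff atLeast0LessThan)
    qed
    then have "card {f \<in> ?F. ?p f = n} = divisor_k k n" by (simp add: divisor_k_def)
    moreover have "(\<Sum>f\<in>{f \<in> ?F. ?p f = n}. h (?p f)) = (\<Sum>f\<in>{f \<in> ?F. ?p f = n}. h n)"
      by (intro sum.cong) auto
    ultimately show "(\<Sum>f\<in>{f \<in> ?F. ?p f = n}. h (?p f)) = of_nat (divisor_k k n) * h n" by simp
  qed
  finally show ?thesis ..
qed

text \<open>The largest coordinate becomes the smooth variable and the product of the others the
  variable \<open>m\<close>, with weight the number of ways to factor it inside the box.\<close>

lemma box_sum_le:
  fixes k q X :: nat and a b :: int and l :: "nat \<Rightarrow> nat" and \<epsilon> \<sigma> G q0 :: real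
  defines "W \<equiv> (\<Prod>i\<in>{0..<k}. 2 ^ l i :: nat)"
  assumes k: "k \<ge> 1" and q: "prime q" "real q \<ge> q0" and a: "coprime a (int q)" and X: "X \<le> q"
    and bil: "\<And>(R::nat) (N::nat) \<gamma> Y. R \<ge> 1 \<Longrightarrow> 2 * R < q \<Longrightarrow> N \<ge> 1 \<Longrightarrow> N \<le> q \<Longrightarrow>
     (\<forall>m. Y m < 2 * N \<and> Y m < q) \<Longrightarrow> (\<forall>m. 0 \<le> \<gamma> m \<and> \<gamma> m \<le> G) \<Longrightarrow>
     real q powr (1 / 2 + \<epsilon> / 2) \<le> real R * real N \<Longrightarrow> real q powr (1 / (2 * real k)) \<le> real N \<Longrightarrow>
     norm (bisum q a b R N \<gamma> Y)
       \<le> 10 * G * real R * real N * real q powr (- \<sigma>)"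
    and W: "real q powr (1 / 2 + \<epsilon> / 2) \<le> real W" "W \<le> X" and \<epsilon>: "\<epsilon> > 0"
    and G: "\<And>m. 0 < m \<Longrightarrow> m \<le> q \<Longrightarrow> real (ndiv m) ^ k \<le> G" and G0: "G \<ge> 0"
    and q2: "2 ^ k < real q powr (1 / (2 * real k))"
  shows "norm (\<Sum>f\<in>{f \<in> box {0..<k} l. (\<Prod>i\<in>{0..<k}. f i) \<le> X \<and> coprime (\<Prod>i\<in>{0..<k}. f i) q}. phase q a b (\<Prod>i\<in>{0..<k}. f i))
     \<le> 10 * 2 ^ k * G * real W * real q powr (- \<sigma>)"
proof -
  let ?I = "{0..<k}"
  have q1: "real q > 1" using prime_gt_1_nat[OF q(1)] by simp
  have "Max (l ` ?I) \<in> l ` ?I" using k by (intro Max_in) auto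
  then obtain j where j: "j \<in> ?I" "l j = Max (l ` ?I)" by auto
  have lj: "l i \<le> l j" if "i \<in> ?I" for i unfolding j(2) using that by (intro Max_ge) auto
  define N where "N = (2::nat) ^ l j"
  define M where "M = (\<Prod>i\<in>?I - {j}. 2 ^ l i :: nat)"
  \<comment> \<open>Each of the k - 1 remaining coordinates is less than twice its dyadic size, so
    their product is at most \<open>R\<close>.\<close>
  define R where "R = 2 ^ (k - 1) * M"
  have WNM: "W = N * M" unfolding W_def N_def M_def using j by (intro prod.remove) auto
  have N0: "N \<ge> 1" by (simp add: N_def)
  have M0: "M \<ge> 1" unfolding M_def by (simp add: Suc_le_eq)
  have cardI: "card (?I - {j}) = k - 1" using j by simp
  have NW: "N \<le> W" using M0 by (simp add: WNM)
  have Nq: "N \<le> q" using NW W(2) X by linarith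
  \<comment> \<open>Maximality of \<open>l j\<close>; together with W \<ge> q^(1/2) it yields the
    lower bound q^(1/(2k)) for N.\<close>
  have WNk: "W \<le> N ^ k"
  proof -
    have "W \<le> (\<Prod>i\<in>?I. N)" unfolding W_def N_def using lj by (intro prod_mono) auto
    then show ?thesis by simp
  qed
  have Nlow: "real q powr (1 / (2 * real k)) \<le> real N"
  proof -
    have "real q powr (1 / 2) \<le> real q powr (1 / 2 + \<epsilon> / 2)" using q1 \<epsilon> by (intro powr_mono) auto
    also have "\<dots> \<le> real (N ^ k)" using W(1) WNk by (meson of_nat_mono order_trans)
    finally have h: "real q powr (1 / 2) \<le> real N powr real k" using N0 by (simp add: powr_realpow)
    have "real q powr (1 / (2 * real k)) = (real q powr (1 / 2)) powr (1 / real k)" by (simp add: powr_powr)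
    also have "\<dots> \<le> (real N powr real k) powr (1 / real k)" using h by (intro powr_mono2) auto
    also have "\<dots> = real N" using N0 k by (simp add: powr_powr)
    finally show ?thesis .
  qed
  have R2q: "2 * R < q"
  proof -
    have "real (2 * R) = 2 ^ k * real M"
      using k by (cases k) (simp_all add: R_def)
    \<comment> \<open>N itself absorbs the factor 2^k lost to dyadic rounding, which is the purpose
      of the assumption on 2^k.\<close>
    also have "\<dots> < real N * real M"
    proof (rule mult_strict_right_mono)
      show "2 ^ k < real N" using q2 Nlow by (rule less_le_trans)
    qed (use M0 in simp)
    also have "\<dots> = real W" by (simp add: WNM)
    also have "\<dots> \<le> real q" using W(2) X by simp
    finally show ?thesis by (simp only: of_nat_less_iff)
  qed
  have R1: "R \<ge> 1" using M0 by (simp add: R_def Suc_le_eq)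
  define p where "p = (\<lambda>g. \<Prod>i\<in>?I - {j}. g i :: nat)"
  define \<G> where "\<G> = box (?I - {j}) l"
  have fin\<G>: "finite \<G>" by (simp add: \<G>_def finite_box)
  have p: "1 \<le> p g" "p g \<le> R" if "g \<in> \<G>" for g
  proof -
    have "M \<le> p g" "p g \<le> 2 ^ card (?I - {j}) * M"
      unfolding p_def M_def using that by (intro box_prod_bounds; simp add: \<G>_def)+
    then show "1 \<le> p g" "p g \<le> R" using M0 by (auto simp: R_def cardI)
  qed
  \<comment> \<open>The caps encode the dyadic block, m n \<le> X, and coprimality: as X \<le> q,
    the only n with a factor q is q itself.\<close>
  define Y where "Y = (\<lambda>m. min (2 * N - 1) (min (X div m) (q - 1)))"
  define \<gamma> where "\<gamma> = (\<lambda>m. real (card {g \<in> \<G>. p g = m}))"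
  have Yb: "Y m < 2 * N \<and> Y m < q" for m
    using N0 prime_gt_0_nat[OF q(1)] by (auto simp: Y_def min_def)
  have copm: "coprime (int m) (int q)" if "1 \<le> m" "m \<le> R" for m
    using that R2q by (intro coprime_int_prime_less q(1)) auto
  have range: "{n \<in> {N..<2 * N}. p g * n \<le> X \<and> coprime (p g * n) q} = {N..Y (p g)}" if g: "g \<in> \<G>" for g
  proof (intro equalityI subsetI)
    fix n assume n: "n \<in> {n \<in> {N..<2 * N}. p g * n \<le> X \<and> coprime (p g * n) q}"
    have "n \<le> X div p g" using n p(1)[OF g] by (simp add: less_eq_div_iff_mult_less_eq mult.commute)
    moreover have "n \<le> q - 1"
    proof -
      have "n \<noteq> q" using n q1 by auto
      moreover have "n \<le> X"
      proof -
        have "1 * n \<le> p g * n" using p(1)[OF g] by (rule mult_le_mono1)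
        moreover have "p g * n \<le> X" using n by simp
        ultimately show ?thesis by linarith
      qed
      ultimately show ?thesis using X by linarith
    qed
    ultimately show "n \<in> {N..Y (p g)}" using n by (auto simp: Y_def)
  next
    fix n assume n: "n \<in> {N..Y (p g)}"
    then have b: "N \<le> n" "n \<le> 2 * N - 1" "n \<le> X div p g" "n \<le> q - 1" by (auto simp: Y_def)
    have "n < q" "0 < n" using b(1,4) N0 prime_gt_0_nat[OF q(1)] by auto
    then have "coprime (int n) (int q)" by (intro coprime_int_prime_less q(1))
    moreover have "coprime (int (p g)) (int q)" using p[OF g] by (intro copm)
    ultimately have "coprime (p g * n) q" by simp
    moreover have "p g * n \<le> X" using b(3) p(1)[OF g] by (simp add: less_eq_div_iff_mult_less_eq mult.commute)
    ultimately show "n \<in> {n \<in> {N..<2 * N}. p g * n \<le> X \<and> coprime (p g * n) q}" using b N0 by auto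
  qed
  have "(\<Sum>f\<in>{f \<in> box ?I l. (\<Prod>i\<in>?I. f i) \<le> X \<and> coprime (\<Prod>i\<in>?I. f i) q}. phase q a b (\<Prod>i\<in>?I. f i))
     = (\<Sum>g\<in>\<G>. \<Sum>n\<in>{n \<in> {N..<2 * N}. p g * n \<le> X \<and> coprime (p g * n) q}. phase q a b (p g * n))"
    unfolding \<G>_def p_def N_def using j by (intro box_split[where P = "\<lambda>n. n \<le> X \<and> coprime n q"]) auto
  also have "\<dots> = (\<Sum>g\<in>\<G>. \<Sum>n\<in>{N..Y (p g)}. kloo q a b (p g) n)"
  proof (rule sum.cong[OF refl])
    fix g assume g: "g \<in> \<G>"
    show "(\<Sum>n\<in>{n \<in> {N..<2 * N}. p g * n \<le> X \<and> coprime (p g * n) q}. phase q a b (p g * n)) = (\<Sum>n\<in>{N..Y (p g)}. kloo q a b (p g) n)"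
      unfolding range[OF g]
    proof (rule sum.cong[OF refl])
      fix n assume "n \<in> {N..Y (p g)}"
      then have "coprime (p g * n) q" unfolding range[OF g, symmetric] by simp
      then show "phase q a b (p g * n) = kloo q a b (p g) n" by (intro phase_mult) auto
    qed
  qed
  also have "\<dots> = (\<Sum>m\<in>{1..R}. \<Sum>g\<in>{g \<in> \<G>. p g = m}. \<Sum>n\<in>{N..Y (p g)}. kloo q a b (p g) n)"
    using fin\<G> p by (intro sum.group[symmetric]) auto
  also have "\<dots> = (bisum q a b R N \<gamma> Y)"
  proof (rule sum.cong[OF refl])
    fix m
    have "(\<Sum>g\<in>{g \<in> \<G>. p g = m}. \<Sum>n\<in>{N..Y (p g)}. kloo q a b (p g) n) = (\<Sum>g\<in>{g \<in> \<G>. p g = m}. \<Sum>n\<in>{N..Y m}. kloo q a b m n)"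
      by (intro sum.cong) auto
    then show "(\<Sum>g\<in>{g \<in> \<G>. p g = m}. \<Sum>n\<in>{N..Y (p g)}. kloo q a b (p g) n) = of_real (\<gamma> m) * (\<Sum>n\<in>{N..Y m}. kloo q a b m n)"
      by (simp add: \<gamma>_def)
  qed
  finally have eq: "(\<Sum>f\<in>{f \<in> box ?I l. (\<Prod>i\<in>?I. f i) \<le> X \<and> coprime (\<Prod>i\<in>?I. f i) q}. phase q a b (\<Prod>i\<in>?I. f i))
     = (bisum q a b R N \<gamma> Y)" .
  have \<gamma>G: "0 \<le> \<gamma> m \<and> \<gamma> m \<le> G" for m
  proof (cases "1 \<le> m \<and> m \<le> R")
    case True
    have m: "0 < m" "m \<le> q" using True R2q by auto
    have "card {g \<in> \<G>. p g = m} \<le> card {f \<in> (?I - {j}) \<rightarrow>\<^sub>E UNIV. (\<Prod>i\<in>?I - {j}. f i) = m}"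
      using card_tuples_prod_le(1)[of "?I - {j}" m] m by (intro card_mono) (auto simp: \<G>_def box_def p_def PiE_iff)
    also have "\<dots> \<le> ndiv m ^ card (?I - {j})" using m by (intro card_tuples_prod_le) auto
    also have "\<dots> \<le> ndiv m ^ k" unfolding cardI using ndiv_pos[OF m(1)] by (intro power_increasing) auto
    finally have "\<gamma> m \<le> real (ndiv m ^ k)" unfolding \<gamma>_def by (simp only: of_nat_le_iff)
    then have "\<gamma> m \<le> real (ndiv m) ^ k" by (simp only: of_nat_power)
    then have "\<gamma> m \<le> G" using G[OF m] by (rule order_trans)
    then show ?thesis by (simp add: \<gamma>_def)
  next
    case False
    then have e: "{g \<in> \<G>. p g = m} = {}" using p by auto
    show ?thesis unfolding \<gamma>_def e using G0 by simp
  qed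
  have RN: "real R * real N = 2 ^ (k - 1) * real W" by (simp add: R_def WNM)
  have "norm (bisum q a b R N \<gamma> Y) \<le> 10 * G * real R * real N * real q powr (- \<sigma>)"
  proof (rule bil[OF R1 R2q N0 Nq _ _ _ Nlow])
    have "1 * real W \<le> 2 ^ (k - 1) * real W" by (intro mult_right_mono) auto
    then show "real q powr (1 / 2 + \<epsilon> / 2) \<le> real R * real N" using W(1) unfolding RN by linarith
  qed (use Yb \<gamma>G in auto)
  also have "\<dots> = 10 * G * (real R * real N) * real q powr (- \<sigma>)" by (simp only: mult.assoc)
  also have "\<dots> = (10 * G * real W * real q powr (- \<sigma>)) * 2 ^ (k - 1)" unfolding RN by (simp only: mult_ac)
  also have "\<dots> \<le> (10 * G * real W * real q powr (- \<sigma>)) * 2 ^ k"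
    using G0 by (intro mult_left_mono power_increasing) auto
  also have "\<dots> = 10 * 2 ^ k * G * real W * real q powr (- \<sigma>)" by (simp only: mult_ac)
  finally show ?thesis unfolding eq .
qed

section \<open>Summation over dyadic boxes and choice of constants\<close>

theorem theorem6:
  fixes k :: nat
  assumes "k \<ge> 1"
  shows "\<exists>c::real > 0. \<forall>\<epsilon>::real. 0 < \<epsilon> \<and> \<epsilon> < 0.1 \<longrightarrow>
     (\<exists>q5::real. \<exists>C::real > 0. \<forall>(q::nat) (a::int) (b::int) (x::real).
        prime q \<and> real q \<ge> q5 \<and> coprime a (int q) \<and>
        real q powr (1/2 + \<epsilon>) \<le> x \<and> x \<le> real q \<longrightarrow>
        norm (\<Sum>n \<in> {n \<in> {1..nat \<lfloor>x\<rfloor>}. coprime n q}.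
                 of_nat (divisor_k k n) *
                 eq (int q) (a * modinv (int q) (int n) + b * int n))
          \<le> C * x * real q powr (- c * \<epsilon> ^ 4))"
proof -
  have k0: "real k \<ge> 1" using assms by simp
  \<comment> \<open>Each box saves q^(-\<sigma>) with \<sigma> = \<epsilon>^2 / (6400 k), and half
    of \<sigma> is kept at the end. Then \<epsilon>^4 \<le> \<epsilon>^2 leads to the stated
    exponent.\<close>
  define c where "c = 1 / (12800 * real k)"
  have c0: "c > 0" using k0 by (simp add: c_def)
  show ?thesis
  proof (rule exI[of _ c], intro conjI c0 allI impI)
    fix \<epsilon> :: real assume \<epsilon>': "0 < \<epsilon> \<and> \<epsilon> < 0.1"
    then have \<epsilon>: "0 < \<epsilon>" "\<epsilon> \<le> 1 / 10" by auto
    define \<delta> where "\<delta> = \<epsilon> / (100 * real k)"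
    define \<sigma> where "\<sigma> = \<epsilon> * \<delta> / 64"
    have \<sigma>: "\<sigma> = \<epsilon> ^ 2 / (6400 * real k)" by (simp add: \<sigma>_def \<delta>_def power2_eq_square)
    have \<sigma>0: "\<sigma> > 0" using \<epsilon> k0 by (simp add: \<sigma>)
    have \<sigma>\<epsilon>: "\<sigma> \<le> \<epsilon> / 2"
    proof -
      have "\<epsilon> ^ 2 / (6400 * real k) \<le> \<epsilon> / 2"
        using \<epsilon> k0 by (intro frac_le) (auto simp: power2_eq_square mult_left_le)
      then show ?thesis by (simp add: \<sigma>)
    qed
    have c\<sigma>: "c * \<epsilon> ^ 4 \<le> \<sigma> / 2"
    proof -
      have "\<epsilon> ^ 4 \<le> \<epsilon> ^ 2" using \<epsilon> by (intro power_decreasing) auto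
      then have "\<epsilon> ^ 4 / (12800 * real k) \<le> \<epsilon> ^ 2 / (12800 * real k)" using k0 by (intro divide_right_mono) auto
      then show ?thesis by (simp add: c_def \<sigma>)
    qed
    obtain q0 :: real where bil: "\<forall>(q::nat) (a::int) (b::int) (R::nat) (N::nat) (G::real) \<gamma> Y.
     prime q \<longrightarrow> real q \<ge> q0 \<longrightarrow> coprime a (int q) \<longrightarrow> R \<ge> 1 \<longrightarrow> 2 * R < q \<longrightarrow> N \<ge> 1 \<longrightarrow> N \<le> q \<longrightarrow>
     (\<forall>m. Y m < 2 * N \<and> Y m < q) \<longrightarrow> (\<forall>m. 0 \<le> \<gamma> m \<and> \<gamma> m \<le> G) \<longrightarrow>
     real q powr (1 / 2 + \<epsilon> / 2) \<le> real R * real N \<longrightarrow> real q powr (1 / (2 * real k)) \<le> real N \<longrightarrow>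
     norm (bisum q a b R N \<gamma> Y)
       \<le> 10 * G * real R * real N * real q powr (- \<epsilon> * \<delta> / 64)"
      using bilinear_all_ranges[OF assms \<epsilon> \<delta>_def] by blast
    \<comment> \<open>Two factors, the divisor weights and the number of boxes, are each a k-th
      power of O(q^\<eta>); together they cost q^(\<sigma>/2).\<close>
    define \<eta> where "\<eta> = \<sigma> / (4 * real k)"
    have \<eta>0: "\<eta> > 0" using \<sigma>0 k0 by (simp add: \<eta>_def)
    have \<eta>k: "\<eta> * real k = \<sigma> / 4" using k0 by (simp add: \<eta>_def)
    obtain D where D: "D \<ge> 1" "\<And>n. n > 0 \<Longrightarrow> real (ndiv n) \<le> D * real n powr \<eta>"
      using divisor_bound[OF \<eta>0] by blast
    define c\<^sub>1 where "c\<^sub>1 = max 1 (1 / (\<eta> * ln 2))"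
    have c\<^sub>1: "c\<^sub>1 \<ge> 1" by (simp add: c\<^sub>1_def)
    define C where "C = c\<^sub>1 ^ k * (10 * 2 ^ k * D ^ k)"
    have CD: "1 \<le> 10 * 2 ^ k * D ^ k"
    proof -
      have "1 * 1 * 1 \<le> 10 * 2 ^ k * D ^ k" using D(1) by (intro mult_mono one_le_power) auto
      then show ?thesis by simp
    qed
    have C0: "C > 0" 
    proof -
      have "0 < c\<^sub>1 ^ k" using c\<^sub>1 by simp
      moreover have "0 < 10 * 2 ^ k * D ^ k" using CD by linarith
      ultimately show ?thesis unfolding C_def by (rule mult_pos_pos)
    qed
    \<comment> \<open>The second entry gives 2^k < q^(1/(2k)), as the box estimate requires.\<close>
    define q5 where "q5 = max q0 ((2 ^ k + 1) powr (2 * real k))"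
    show "\<exists>q5::real. \<exists>C::real > 0. \<forall>(q::nat) (a::int) (b::int) (x::real).
        prime q \<and> real q \<ge> q5 \<and> coprime a (int q) \<and>
        real q powr (1/2 + \<epsilon>) \<le> x \<and> x \<le> real q \<longrightarrow>
        norm (\<Sum>n \<in> {n \<in> {1..nat \<lfloor>x\<rfloor>}. coprime n q}.
                 of_nat (divisor_k k n) *
                 eq (int q) (a * modinv (int q) (int n) + b * int n))
          \<le> C * x * real q powr (- c * \<epsilon> ^ 4)"
    proof (rule exI[of _ q5], rule exI[of _ C], intro conjI C0 allI impI)
      fix q :: nat and a b :: int and x :: real
      assume H: "prime q \<and> real q \<ge> q5 \<and> coprime a (int q) \<and> real q powr (1/2 + \<epsilon>) \<le> x \<and> x \<le> real q"
      then have q: "prime q" "real q \<ge> q0" and a: "coprime a (int q)" and x: "real q powr (1/2 + \<epsilon>) \<le> x" "x \<le> real q"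
        by (auto simp: q5_def)
      have q1: "real q > 1" using prime_gt_1_nat[OF q(1)] by simp
      have q2: "2 ^ k < real q powr (1 / (2 * real k))"
      proof -
        have "2 ^ k + 1 = ((2 ^ k + 1) powr (2 * real k)) powr (1 / (2 * real k))"
          using k0 by (simp add: powr_powr add_pos_pos)
        also have "\<dots> \<le> real q powr (1 / (2 * real k))" using H by (intro powr_mono2) (auto simp: q5_def)
        finally show ?thesis by simp
      qed
      define X where "X = nat \<lfloor>x\<rfloor>"
      have x1: "x \<ge> 1"
      proof -
        have "1 \<le> real q powr (1/2 + \<epsilon>)" using q1 \<epsilon> by (simp add: ge_one_powr_ge_zero)
        then show ?thesis using x by linarith
      qed
      note Xx = nat_floor_bounds[OF x1, folded X_def]
      have Xq: "X \<le> q" using Xx(2) x(2) by linarith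
      define G where "G = D ^ k * real q powr (\<sigma> / 4)"
      have G0: "G \<ge> 0" using D(1) by (simp add: G_def)
      have G: "real (ndiv m) ^ k \<le> G" if "0 < m" "m \<le> q" for m
      proof -
        have "real (ndiv m) \<le> D * real m powr \<eta>" by (rule D(2)[OF that(1)])
        also have "\<dots> \<le> D * real q powr \<eta>" using that D(1) \<eta>0 by (intro mult_left_mono powr_mono2) auto
        finally have "real (ndiv m) ^ k \<le> (D * real q powr \<eta>) ^ k" by (intro power_mono) auto
        also have "\<dots> = D ^ k * (real q powr \<eta>) ^ k" by (rule power_mult_distrib)
        also have "(real q powr \<eta>) ^ k = real q powr (\<sigma> / 4)"
          unfolding \<eta>k[symmetric] powr_powr[symmetric] using q1 by (intro powr_realpow[symmetric]) simp
        finally show ?thesis by (simp add: G_def)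
      qed
      have G1: "G \<ge> 1"
      proof -
        have "1 * 1 \<le> D ^ k * real q powr (\<sigma> / 4)" using D(1) q1 \<sigma>0 by (intro mult_mono one_le_power ge_one_powr_ge_zero) auto
        then show ?thesis by (simp add: G_def)
      qed
      let ?p = "\<lambda>f. \<Prod>i\<in>{0..<k}. f i :: nat"
      define F where "F = {f \<in> {0..<k} \<rightarrow>\<^sub>E {1..X}. ?p f \<le> X \<and> coprime (?p f) q}"
      \<comment> \<open>The exponents of the dyadic box containing \<open>f\<close>; its fibres
        split the sum into at most (floor_log X + 1)^k boxes.\<close>
      define \<phi> where "\<phi> = (\<lambda>f. \<lambda>i\<in>{0..<k}. floor_log (f i :: nat))"
      define \<T> where "\<T> = {0..<k} \<rightarrow>\<^sub>E {0..floor_log X}"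
      have finF: "finite F" unfolding F_def by (rule finite_subset[of _ "{0..<k} \<rightarrow>\<^sub>E {1..X}"]) (auto intro: finite_PiE)
      have fin\<T>: "finite \<T>" by (simp add: \<T>_def finite_PiE)
      have img: "\<phi> ` F \<subseteq> \<T>"
      proof (rule image_subsetI)
        fix f assume f: "f \<in> F"
        have "floor_log (f i) \<le> floor_log X" if "i \<in> {0..<k}" for i
        proof -
          have "f i \<le> X" using f that by (auto simp: F_def PiE_iff)
          then show ?thesis by (rule floor_log_le_iff)
        qed
        then show "\<phi> f \<in> \<T>" by (auto simp: \<phi>_def \<T>_def)
      qed
      have each: "norm (\<Sum>f\<in>{f \<in> F. \<phi> f = l}. phase q a b (?p f)) \<le> 10 * 2 ^ k * G * x * real q powr (- \<sigma>)" if l: "l \<in> \<T>" for l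
      proof (cases "{f \<in> F. \<phi> f = l} = {}")
        case True
        have "0 \<le> 10 * 2 ^ k * G * x * real q powr (- \<sigma>)" using G0 x1 by simp
        then show ?thesis unfolding True by simp
      next
        case False
        define W where "W = (\<Prod>i\<in>{0..<k}. 2 ^ l i :: nat)"
        have Fl: "{f \<in> F. \<phi> f = l} = {f \<in> box {0..<k} l. ?p f \<le> X \<and> coprime (?p f) q}"
        proof (intro equalityI subsetI)
          fix f assume f: "f \<in> {f \<in> F. \<phi> f = l}"
          have "2 ^ l i \<le> f i \<and> f i < 2 * 2 ^ l i" if i: "i \<in> {0..<k}" for i
          proof -
            have "l i = floor_log (f i)" using f i by (auto simp: \<phi>_def)
            moreover have "f i > 0" using f i by (force simp: F_def PiE_iff)
            ultimately show ?thesis using floor_log_exp2_le floor_log_exp2_gt by simp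
          qed
          then show "f \<in> {f \<in> box {0..<k} l. ?p f \<le> X \<and> coprime (?p f) q}"
            using f by (auto simp: box_def F_def PiE_iff)
        next
          fix f assume f: "f \<in> {f \<in> box {0..<k} l. ?p f \<le> X \<and> coprime (?p f) q}"
          have fi: "2 ^ l i \<le> f i" "f i < 2 * 2 ^ l i" if "i \<in> {0..<k}" for i
            using f that by (auto simp: box_def PiE_iff)
          have pos: "f i > 0" if "i \<in> {0..<k}" for i
          proof -
            have "(0::nat) < 2 ^ l i" by simp
            then show ?thesis using fi(1)[OF that] by (rule less_le_trans)
          qed
          have pp: "?p f > 0" using pos by (intro prod_pos) auto
          have "f i \<in> {1..X}" if i: "i \<in> {0..<k}" for i
          proof -
            have "f i dvd ?p f" using i by (intro dvd_prodI) auto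
            then have "f i \<le> ?p f" using pp by (rule dvd_imp_le)
            then show ?thesis using f pos[OF i] by auto
          qed
          then have fF: "f \<in> F" using f by (auto simp: F_def box_def PiE_iff)
          have "floor_log (f i) = l i" if i: "i \<in> {0..<k}" for i
            by (rule floor_log_eqI) (use fi[OF i] pos[OF i] in auto)
          then have "\<phi> f = l" using l by (auto simp: \<phi>_def \<T>_def PiE_iff extensional_def restrict_def fun_eq_iff)
          then show "f \<in> {f \<in> F. \<phi> f = l}" using fF by simp
        qed
        have WX: "W \<le> X"
        proof -
          obtain f where "f \<in> box {0..<k} l" "?p f \<le> X" using False unfolding Fl by auto
          then show ?thesis using box_prod_bounds(1)[of "{0..<k}" f l] unfolding W_def by simp
        qed
        then have Wx: "real W \<le> x" using Xx(2) by linarith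
        show ?thesis
        proof (cases "real q powr (1 / 2 + \<epsilon> / 2) \<le> real W")
          case True
          have "norm (\<Sum>f\<in>{f \<in> box {0..<k} l. ?p f \<le> X \<and> coprime (?p f) q}. phase q a b (?p f)) \<le> 10 * 2 ^ k * G * real W * real q powr (- \<sigma>)"
            unfolding W_def
          proof (rule box_sum_le[OF assms q a Xq _ _ _ \<epsilon>(1) G G0 q2])
            fix R N :: nat and \<gamma> :: "nat \<Rightarrow> real" and Y :: "nat \<Rightarrow> nat"
            assume h: "R \<ge> 1" "2 * R < q" "N \<ge> 1" "N \<le> q" "\<forall>m. Y m < 2 * N \<and> Y m < q" "\<forall>m. 0 \<le> \<gamma> m \<and> \<gamma> m \<le> G"
              "real q powr (1 / 2 + \<epsilon> / 2) \<le> real R * real N" "real q powr (1 / (2 * real k)) \<le> real N"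
            have "norm (bisum q a b R N \<gamma> Y) \<le> 10 * G * real R * real N * real q powr (- \<epsilon> * \<delta> / 64)"
              by (rule bil[THEN spec, THEN spec, THEN spec, THEN spec, THEN spec, THEN spec, THEN spec, THEN spec, THEN mp, THEN mp, THEN mp, THEN mp, THEN mp, THEN mp, THEN mp, THEN mp, THEN mp, THEN mp, THEN mp, OF q a h])
            then show "norm (bisum q a b R N \<gamma> Y) \<le> 10 * G * real R * real N * real q powr (- \<sigma>)"
              by (simp add: \<sigma>_def)
          qed (use True WX in \<open>auto simp: W_def\<close>)
          also have "\<dots> \<le> 10 * 2 ^ k * G * x * real q powr (- \<sigma>)"
            using Wx G0 by (intro mult_right_mono mult_left_mono) auto
          finally show ?thesis unfolding Fl .
        next
          case False
          have "norm (\<Sum>f\<in>{f \<in> box {0..<k} l. ?p f \<le> X \<and> coprime (?p f) q}. phase q a b (?p f))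
             \<le> (\<Sum>f\<in>{f \<in> box {0..<k} l. ?p f \<le> X \<and> coprime (?p f) q}. 1)"
            by (rule sum_norm_le) simp
          also have "\<dots> \<le> real (card (box {0..<k} l))"
            using finite_box[of "{0..<k}" l] by (simp add: card_mono)
          also have "\<dots> = real W" by (simp add: card_box W_def)
          \<comment> \<open>A small box is bounded trivially: it is shorter than x by at least
            q^(\<epsilon>/2), and \<sigma> \<le> \<epsilon>/2.\<close>
          also have "\<dots> \<le> real q powr (1 / 2 + \<epsilon> / 2)" using False by simp
          also have "\<dots> = real q powr (1 / 2 + \<epsilon>) * real q powr (- (\<epsilon> / 2))"
            unfolding powr_add[symmetric] by (rule arg_cong[of _ _ "(powr) (real q)"]) simp
          also have "\<dots> \<le> x * real q powr (- \<sigma>)" using x \<sigma>\<epsilon> q1 x1 by (intro mult_mono powr_mono) auto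
          also have "\<dots> = 1 * (x * real q powr (- \<sigma>))" by simp
          also have "\<dots> \<le> (10 * 2 ^ k * G) * (x * real q powr (- \<sigma>))"
          proof (rule mult_right_mono)
            have "1 * 1 * 1 \<le> 10 * 2 ^ k * G" using G1 by (intro mult_mono one_le_power) auto
            then show "1 \<le> 10 * 2 ^ k * G" by simp
          qed (use x1 in simp)
          finally show ?thesis unfolding Fl by (simp only: mult.assoc)
        qed
      qed
      have "(\<Sum>n \<in> {n \<in> {1..nat \<lfloor>x\<rfloor>}. coprime n q}. of_nat (divisor_k k n) * eq (int q) (a * modinv (int q) (int n) + b * int n))
         = (\<Sum>n \<in> {n \<in> {1..X}. coprime n q}. of_nat (divisor_k k n) * phase q a b n)"
        by (simp add: X_def phase_def)
      also have "\<dots> = (\<Sum>f\<in>F. phase q a b (?p f))"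
        unfolding F_def by (rule divisor_sum_eq_tuple_sum)
      also have "\<dots> = (\<Sum>l\<in>\<T>. \<Sum>f\<in>{f \<in> F. \<phi> f = l}. phase q a b (?p f))"
        by (rule sum.group[OF finF fin\<T> img, symmetric])
      finally have "norm (\<Sum>n \<in> {n \<in> {1..nat \<lfloor>x\<rfloor>}. coprime n q}. of_nat (divisor_k k n) * eq (int q) (a * modinv (int q) (int n) + b * int n))
         \<le> (\<Sum>l\<in>\<T>. 10 * 2 ^ k * G * x * real q powr (- \<sigma>))"
        by (simp only:) (intro sum_norm_le each)
      also have "\<dots> = real (card \<T>) * (10 * 2 ^ k * G * x * real q powr (- \<sigma>))" by simp
      also have "real (card \<T>) = real (floor_log X + 1) ^ k"
        by (simp add: \<T>_def card_PiE)
      also have "real (floor_log X + 1) ^ k * (10 * 2 ^ k * G * x * real q powr (- \<sigma>)) \<le> (c\<^sub>1 ^ k * real q powr (\<sigma> / 4)) * (10 * 2 ^ k * G * x * real q powr (- \<sigma>))"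
      proof (rule mult_right_mono)
        have "real (floor_log X + 1) \<le> c\<^sub>1 * real q powr \<eta>"
        proof -
          let ?e = "real (floor_log X)"
          have "1 + \<eta> * ?e * ln 2 \<le> exp (\<eta> * ?e * ln 2)" by (rule exp_ge_add_one_self)
          also have "\<dots> = (2 ^ floor_log X) powr \<eta>" by (simp add: powr_def ln_realpow mult_ac)
          also have "\<dots> \<le> real q powr \<eta>"
          proof (intro powr_mono2)
            have "2 ^ floor_log X \<le> X" using Xx(3) by (intro floor_log_exp2_le) simp
            then have "2 ^ floor_log X \<le> q" using Xq by linarith
            then show "2 ^ floor_log X \<le> real q" by (metis of_nat_le_iff of_nat_numeral of_nat_power)
          qed (use \<eta>0 in auto)
          finally have *: "1 + \<eta> * ?e * ln 2 \<le> real q powr \<eta>" .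
          have d: "\<eta> * ln 2 > 0" using \<eta>0 by simp
          have "1 \<le> c\<^sub>1 * (\<eta> * ln 2)" using d by (auto simp: c\<^sub>1_def max_def field_simps)
          then have "?e \<le> c\<^sub>1 * (\<eta> * ?e * ln 2)"
            using mult_right_mono[of 1 "c\<^sub>1 * (\<eta> * ln 2)" ?e] by (simp add: mult_ac)
          with c\<^sub>1 have "?e + 1 \<le> c\<^sub>1 * (1 + \<eta> * ?e * ln 2)" by (simp add: distrib_left)
          also have "\<dots> \<le> c\<^sub>1 * real q powr \<eta>" using * c\<^sub>1 by (intro mult_left_mono) auto
          finally show ?thesis by simp
        qed
        then have "real (floor_log X + 1) ^ k \<le> (c\<^sub>1 * real q powr \<eta>) ^ k" by (intro power_mono) auto
        also have "\<dots> = c\<^sub>1 ^ k * (real q powr \<eta>) ^ k" by (rule power_mult_distrib)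
        also have "(real q powr \<eta>) ^ k = real q powr (\<sigma> / 4)"
          unfolding \<eta>k[symmetric] powr_powr[symmetric] using q1 by (intro powr_realpow[symmetric]) simp
        finally show "real (floor_log X + 1) ^ k \<le> c\<^sub>1 ^ k * real q powr (\<sigma> / 4)" .
        show "0 \<le> 10 * 2 ^ k * G * x * real q powr (- \<sigma>)" using G0 x1 by simp
      qed
      also have "\<dots> = C * x * (real q powr (\<sigma> / 4) * real q powr (\<sigma> / 4) * real q powr (- \<sigma>))"
        unfolding C_def G_def by (simp only: mult_ac)
      also have "real q powr (\<sigma> / 4) * real q powr (\<sigma> / 4) * real q powr (- \<sigma>) = real q powr (- \<sigma> / 2)"
        unfolding powr_add[symmetric] by (rule arg_cong[of _ _ "(powr) (real q)"]) simp
      also have "C * x * real q powr (- \<sigma> / 2) \<le> C * x * real q powr (- c * \<epsilon> ^ 4)"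
        using C0 x1 q1 c\<sigma> by (intro mult_left_mono powr_mono) auto
      finally show "norm (\<Sum>n \<in> {n \<in> {1..nat \<lfloor>x\<rfloor>}. coprime n q}. of_nat (divisor_k k n) * eq (int q) (a * modinv (int q) (int n) + b * int n))
          \<le> C * x * real q powr (- c * \<epsilon> ^ 4)" .
    qed
  qed
qed

end
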